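(* Let $d\ge 1$ and let $(X_t)_{t\ge 0}$ be a stochastic process on $\mathbb{T}^d=(\mathbb{R}/2\pi\mathbb{Z})^d$ with stationary independent increments whose increment distributions are $D_t=\beta_t\delta+(1-\beta_t)\gamma_t$, satisfying the standing assumptions on the process listed in the context. Suppose there exists a time $t_0>0$ such that the Fourier coefficients $\{\hat\gamma_{t_0}(k)\}_{k\in\mathbb{Z}^d}$ are all distinct and nonzero. Then the family $$\mathcal{F}_d=\{\mathbf{1}_{\Omega}\mid \Omega\subseteq\mathbb{T}^d \text{ open},\ \mathrm{Lebesgue}_d(\partial\Omega)=0\}$$ is reconstructible by $X_t$.
   Context: Standing assumptions on the process: there is a family of probability distributions $(D_t)_{t\ge0}$ on $\mathbb{T}^d$ such that (1) $X_{t_2}-X_{t_1}\sim D_{t_2-t_1}$ for every $t_2\ge t_1\ge 0$; (2) for all $0\le t_1\le\dots\le t_n$, the increments $X_{t_2}-X_{t_1},\dots,X_{t_n}-X_{t_{n-1}}$ are independent; (3) $D_{t+s}=D_t\star D_s$ for all $s,t\ge0$, where $\star$ is convolution. Moreover $D_t$ is either continuous (given by a density) or a mixture of an atom at $0$ and such a distribution: $D_t(x)=\beta_t\delta(x)+(1-\beta_t)\gamma_t(x)$, where $\delta$ is the Dirac distribution at $0$, $\gamma_t$ is a probability density function on $\mathbb{T}^d$, $\beta_t\in[0,1]$, and $\gamma_t\in L^2(\mathbb{T}^d)$ for all $t>0$. The function $\beta_t$ is not identically $1$ (the process is not constant). Fourier coefficients: for $g:\mathbb{T}^d\to\mathbb{C}$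 and $k\in\mathbb{Z}^d$, $\hat g(k)=\int_{\mathbb{T}^d}g(x)e^{-ik\cdot x}\,dx$. Reconstructibility: a family $\mathcal{F}$ of real functions on $\mathbb{T}^d$ is reconstructible by $X_t$ if there is a function $A:\mathbb{R}^{\mathbb{R}^+}\to\mathbb{R}^{\mathbb{T}^d}$ (with $\mathbb{R}^+=[0,\infty)$) such that for every $f\in\mathcal{F}$, with probability $1$ there exists a (random) shift $\theta\in\mathbb{T}^d$ such that $A\big((f(X_t))_{t\ge0}\big)(x)=f(x+\theta)$ for almost all $x$. *)

theory Defs
  imports "HOL-Probability.Probability"
begin

section \<open>The torus as a topological group\<close>

definition torus_rel :: "real ^ 'n \<Rightarrow> real ^ 'n \<Rightarrow> bool" where
  "torus_rel x y \<longleftrightarrow> (\<forall>i. \<exists>k::int. x $ i - y $ i = 2 * pi * of_int k)"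

lemma equivp_torus_rel: "equivp torus_rel"
proof (rule equivpI)
  show "reflp torus_rel"
    by (auto intro!: reflpI exI[of _ 0] simp: torus_rel_def)
  show "symp torus_rel"
  proof (rule sympI)
    fix x y :: "real ^ 'n" assume *: "torus_rel x y"
    show "torus_rel y x" unfolding torus_rel_def
    proof
      fix i from * obtain k where "x $ i - y $ i = 2 * pi * of_int k"
        unfolding torus_rel_def by blast
      then have "y $ i - x $ i = 2 * pi * of_int (- k)" by simp
      then show "\<exists>k. y $ i - x $ i = 2 * pi * of_int k" by blast
    qed
  qed
  show "transp torus_rel"
  proof (rule transpI)
    fix x y z :: "real ^ 'n" assume *: "torus_rel x y" "torus_rel y z"
    show "torus_rel x z" unfolding torus_rel_def
    proof
      fix i from * obtain k l where
        "x $ i - y $ i = 2 * pi * of_int k" "y $ i - z $ i = 2 * pi * of_int l"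
        unfolding torus_rel_def by blast
      then have "x $ i - z $ i = 2 * pi * of_int (k + l)" by (simp add: algebra_simps)
      then show "\<exists>k. x $ i - z $ i = 2 * pi * of_int k" by blast
    qed
  qed
qed

quotient_type (overloaded) 'n torus = "real ^ 'n::finite" / torus_rel
  morphisms rep_torus to_torus
  by (rule equivp_torus_rel)

lemma torus_rel_add: "torus_rel a b \<Longrightarrow> torus_rel c d \<Longrightarrow> torus_rel (a + c) (b + d)"
  unfolding torus_rel_def
proof
  fix i
  assume "\<forall>i. \<exists>k::int. a $ i - b $ i = 2 * pi * of_int k"
    "\<forall>i. \<exists>k::int. c $ i - d $ i = 2 * pi * of_int k"
  then obtain k l where
    "a $ i - b $ i = 2 * pi * of_int k" "c $ i - d $ i = 2 * pi * of_int l" by blast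
  then have "(a + c) $ i - (b + d) $ i = 2 * pi * of_int (k + l)" by (simp add: algebra_simps)
  then show "\<exists>k::int. (a + c) $ i - (b + d) $ i = 2 * pi * of_int k" by blast
qed

lemma torus_rel_uminus: "torus_rel a b \<Longrightarrow> torus_rel (- a) (- b)"
  unfolding torus_rel_def
proof
  fix i
  assume "\<forall>i. \<exists>k::int. a $ i - b $ i = 2 * pi * of_int k"
  then obtain k where "a $ i - b $ i = 2 * pi * of_int k" by blast
  then have "(- a) $ i - (- b) $ i = 2 * pi * of_int (- k)" by simp
  then show "\<exists>k::int. (- a) $ i - (- b) $ i = 2 * pi * of_int k" by blast
qed

instantiation torus :: (finite) ab_group_add
begin

lift_definition zero_torus :: "'a torus" is 0 .

lift_definition plus_torus :: "'a torus \<Rightarrow> 'a torus \<Rightarrow> 'a torus" is "(+)"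
  by (rule torus_rel_add)

lift_definition uminus_torus :: "'a torus \<Rightarrow> 'a torus" is uminus
  by (rule torus_rel_uminus)

lift_definition minus_torus :: "'a torus \<Rightarrow> 'a torus \<Rightarrow> 'a torus" is "(-)"
  unfolding diff_conv_add_uminus by (intro torus_rel_add torus_rel_uminus)

instance
  by standard (transfer, simp add: add_ac equivp_reflp[OF equivp_torus_rel])+

end

text \<open>The quotient topology.\<close>

instantiation torus :: (finite) topological_space
begin

definition open_torus :: "'a torus set \<Rightarrow> bool" where
  "open_torus U \<longleftrightarrow> open (to_torus -` U)"

instance
  by standard (auto simp: open_torus_def vimage_Union vimage_Int)

end

lemma to_torus_eq_iff: "to_torus x = to_torus y \<longleftrightarrow> torus_rel x y"
  by (rule torus.abs_eq_iff)

lemma surj_to_torus: "surj to_torus"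
  by (metis Quotient3_abs_rep Quotient3_torus surjI)

lemma continuous_on_to_torus [continuous_intros]: "continuous_on A to_torus"
  by (rule continuous_on_subset[OF _ subset_UNIV])
    (simp add: continuous_on_open_vimage open_torus_def)

lemma to_torus_measurable [measurable]: "to_torus \<in> borel_measurable borel"
  by (intro borel_measurable_continuous_onI continuous_on_to_torus)

lemma open_to_torus_image:
  fixes U :: "(real ^ 'n::finite) set"
  assumes "open U"
  shows "open (to_torus ` U)"
proof -
  have "to_torus -` to_torus ` U = (\<Union>v\<in>{v. torus_rel v 0}. (+) v ` U)"
  proof (intro equalityI subsetI)
    fix x assume "x \<in> to_torus -` to_torus ` U"
    then obtain u where u: "u \<in> U" "torus_rel x u" by (auto simp: to_torus_eq_iff)
    then have "torus_rel (x - u) 0" by (auto simp: torus_rel_def)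
    moreover have "x = (x - u) + u" by simp
    ultimately show "x \<in> (\<Union>v\<in>{v. torus_rel v 0}. (+) v ` U)" using u by blast
  next
    fix x assume "x \<in> (\<Union>v\<in>{v. torus_rel v 0}. (+) v ` U)"
    then obtain v u where v: "torus_rel v 0" "u \<in> U" "x = v + u" by blast
    then have "torus_rel x u" by (auto simp: torus_rel_def)
    with v show "x \<in> to_torus -` to_torus ` U" by (auto simp: to_torus_eq_iff[symmetric])
  qed
  then show ?thesis
    using assms by (auto simp: open_torus_def intro!: open_UN open_translation)
qed

lemma nhds_to_torus:
  fixes x :: "real ^ 'n::finite"
  shows "nhds (to_torus x) = filtermap to_torus (nhds x)"
proof (rule antisym)
  have "filterlim to_torus (nhds (to_torus x)) (nhds x)"
    using continuous_on_to_torus[of "UNIV :: (real ^ 'n) set"]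
    by (simp add: continuous_on_def tendsto_at_iff_tendsto_nhds)
  then show "filtermap to_torus (nhds x) \<le> nhds (to_torus x)"
    by (simp add: filterlim_def)
  show "nhds (to_torus x) \<le> filtermap to_torus (nhds x)"
  proof (rule filter_leI)
    fix P assume "eventually P (filtermap to_torus (nhds x))"
    then obtain S where S: "open S" "x \<in> S" "\<forall>y\<in>S. P (to_torus y)"
      by (auto simp: eventually_filtermap eventually_nhds)
    then show "eventually P (nhds (to_torus x))"
      by (auto simp: eventually_nhds intro!: exI[of _ "to_torus ` S"] open_to_torus_image)
  qed
qed

instance torus :: (finite) topological_ab_group_add
proof
  fix a b :: "'a torus"
  obtain x y where [simp]: "a = to_torus x" "b = to_torus y"
    using surj_to_torus by (metis surjD)
  have "((\<lambda>z. to_torus (fst z + snd z)) \<longlongrightarrow> to_torus (x + y)) (nhds x \<times>\<^sub>F nhds y)"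
  proof (rule filterlim_compose[of to_torus])
    show "(to_torus \<longlongrightarrow> to_torus (x + y)) (nhds (x + y))"
      by (simp add: filterlim_def nhds_to_torus)
  qed (rule tendsto_add_Pair)
  then show "((\<lambda>z. fst z + snd z) \<longlongrightarrow> a + b) (nhds a \<times>\<^sub>F nhds b)"
    by (simp add: nhds_to_torus prod_filtermap1 prod_filtermap2 filterlim_filtermap
        case_prod_beta plus_torus.abs_eq[symmetric])
next
  fix a :: "'a torus"
  obtain x where [simp]: "a = to_torus x" using surj_to_torus by (metis surjD)
  have "((\<lambda>z. to_torus (- z)) \<longlongrightarrow> to_torus (- x)) (nhds x)"
  proof (rule filterlim_compose[of to_torus])
    show "(to_torus \<longlongrightarrow> to_torus (- x)) (nhds (- x))"
      by (simp add: filterlim_def nhds_to_torus)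
  qed (rule tendsto_uminus_nhds)
  then show "(uminus \<longlongrightarrow> - a) (nhds a)"
    by (simp add: nhds_to_torus filterlim_filtermap uminus_torus.abs_eq)
qed

text \<open>Second countability ensures that the Borel sets of the product of two tori are
  the product sets, so that addition is measurable in the definition of convolution below.\<close>

instance torus :: (finite) second_countable_topology
proof
  obtain B :: "(real ^ 'a) set set" where B: "countable B" "topological_basis B"
    using ex_countable_basis by blast
  have "topological_basis ((`) to_torus ` B)"
  proof (rule topological_basisI)
    fix S :: "'a torus set" assume "S \<in> (`) to_torus ` B"
    then show "open S" using B by (auto intro!: open_to_torus_image topological_basis_open)
  next
    fix S :: "'a torus set" and p assume S: "open S" "p \<in> S"
    obtain x where x: "p = to_torus x" using surj_to_torus by (metis surjD)
    with S have "open (to_torus -` S)" "x \<in> to_torus -` S" by (auto simp: open_torus_def)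
    then obtain U where "U \<in> B" "x \<in> U" "U \<subseteq> to_torus -` S"
      by (rule topological_basisE[OF B(2)])
    then show "\<exists>B'\<in>(`) to_torus ` B. p \<in> B' \<and> B' \<subseteq> S"
      using x by (intro bexI[of _ "to_torus ` U"]) auto
  qed
  then have "open = generate_topology ((`) to_torus ` B)"
    by (rule topological_basis_imp_subbasis)
  moreover have "countable ((`) to_torus ` B)" using B(1) by (rule countable_image)
  ultimately show "\<exists>B::'a torus set set. countable B \<and> open = generate_topology B"
    by blast
qed

section \<open>Lebesgue measure and Fourier coefficients on the torus\<close>

text \<open>Lebesgue measure with total mass \<open>(2 * pi) ^ d\<close>, transported from the
  fundamental domain.\<close>

definition torus_lebesgue :: "'n::finite torus measure" where
  "torus_lebesgue =
     distr (restrict_space lborel {x :: real ^ 'n. \<forall>i. 0 \<le> x $ i \<and> x $ i < 2 * pi}) borel to_torus"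

text \<open>The character \<open>exp (\<i> * (k \<bullet> x))\<close>.\<close>

lift_definition torus_char :: "int ^ 'n \<Rightarrow> 'n::finite torus \<Rightarrow> complex" is
  "\<lambda>k x. cis (\<Sum>i\<in>UNIV. of_int (k $ i) * x $ i)"
proof -
  fix k :: "int ^ 'n" and x y :: "real ^ 'n"
  assume "torus_rel x y"
  then obtain l :: "'n \<Rightarrow> int" where l: "\<And>i. x $ i - y $ i = 2 * pi * of_int (l i)"
    unfolding torus_rel_def by metis
  have "(\<Sum>i\<in>UNIV. of_int (k $ i) * x $ i) - (\<Sum>i\<in>UNIV. of_int (k $ i) * y $ i)
      = (\<Sum>i\<in>UNIV. of_int (k $ i) * (x $ i - y $ i))"
    by (simp add: sum_subtractf right_diff_distrib)
  also have "\<dots> = 2 * pi * of_int (\<Sum>i\<in>UNIV. k $ i * l i)"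
    by (simp add: l sum_distrib_left mult_ac)
  finally have "(\<Sum>i\<in>UNIV. of_int (k $ i) * x $ i) =
      (\<Sum>i\<in>UNIV. of_int (k $ i) * y $ i) + 2 * pi * of_int (\<Sum>i\<in>UNIV. k $ i * l i)"
    by simp
  then show "cis (\<Sum>i\<in>UNIV. of_int (k $ i) * x $ i) = cis (\<Sum>i\<in>UNIV. of_int (k $ i) * y $ i)"
    by (simp only: cis_mult[symmetric] cis_multiple_2pi[OF Ints_of_int] mult_1_right)
qed

definition torus_fourier :: "('n::finite torus \<Rightarrow> complex) \<Rightarrow> int ^ 'n \<Rightarrow> complex" where
  "torus_fourier g k = (LINT x|torus_lebesgue. g x * torus_char (- k) x)"

text \<open>The library's convolution is restricted to ordered Euclidean spaces.\<close>

definition torus_convolution ::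
    "'n::finite torus measure \<Rightarrow> 'n torus measure \<Rightarrow> 'n torus measure" where
  "torus_convolution \<mu> \<nu> = distr (\<mu> \<Otimes>\<^sub>M \<nu>) borel (\<lambda>(x, y). x + y)"

section \<open>Processes with stationary independent increments\<close>

definition torus_prob_density :: "('n::finite torus \<Rightarrow> real) \<Rightarrow> bool" where
  "torus_prob_density g \<longleftrightarrow>
     g \<in> borel_measurable borel \<and> (\<forall>x. 0 \<le> g x) \<and> (\<integral>\<^sup>+x. ennreal (g x) \<partial>torus_lebesgue) = 1"

text \<open>Time is the half-line \<open>{0..}\<close>; the values of \<open>X\<close>, \<open>D\<close>, \<open>\<beta>\<close>, \<open>\<gamma>\<close> at negative times
  are irrelevant.  A purely continuous \<open>D t\<close> is the case \<open>\<beta> t = 0\<close>.  Nothing is assumed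
  about \<open>X 0\<close> or about the regularity of the paths.\<close>

locale torus_process = prob_space M
  for M :: "'w measure" +
  fixes X :: "real \<Rightarrow> 'w \<Rightarrow> 'n::finite torus"
    and D :: "real \<Rightarrow> 'n torus measure"
    and \<beta> :: "real \<Rightarrow> real"
    and \<gamma> :: "real \<Rightarrow> 'n torus \<Rightarrow> real"
  assumes X_measurable: "\<And>t. 0 \<le> t \<Longrightarrow> X t \<in> borel_measurable M"
    and D_prob_space: "\<And>t. 0 \<le> t \<Longrightarrow> prob_space (D t)"
    and sets_D: "\<And>t. 0 \<le> t \<Longrightarrow> sets (D t) = sets borel"
    and stationary_increments:
      "\<And>s t. 0 \<le> s \<Longrightarrow> s \<le> t \<Longrightarrow> distr M borel (\<lambda>\<omega>. X t \<omega> - X s \<omega>) = D (t - s)"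
    and independent_increments:
      "\<And>(n::nat) (t::nat \<Rightarrow> real). 0 \<le> t 0 \<Longrightarrow> (\<And>i. i < n \<Longrightarrow> t i \<le> t (Suc i)) \<Longrightarrow>
        indep_vars (\<lambda>_. borel) (\<lambda>i \<omega>. X (t (Suc i)) \<omega> - X (t i) \<omega>) {..<n}"
    and D_convolution:
      "\<And>s t. 0 \<le> s \<Longrightarrow> 0 \<le> t \<Longrightarrow> D (t + s) = torus_convolution (D t) (D s)"
    and \<beta>_range: "\<And>t. 0 \<le> t \<Longrightarrow> \<beta> t \<in> {0..1}"
    and \<gamma>_density: "\<And>t. 0 \<le> t \<Longrightarrow> torus_prob_density (\<gamma> t)"
    and D_mixture:
      "\<And>t A. 0 \<le> t \<Longrightarrow> A \<in> sets borel \<Longrightarrow>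
        emeasure (D t) A =
          ennreal (\<beta> t) * emeasure (return borel 0) A
          + ennreal (1 - \<beta> t) * emeasure (density torus_lebesgue (\<lambda>x. ennreal (\<gamma> t x))) A"
    and \<gamma>_square_integrable: "\<And>t. 0 < t \<Longrightarrow> integrable torus_lebesgue (\<lambda>x. (\<gamma> t x)\<^sup>2)"
    and \<beta>_not_identically_1: "\<exists>t\<ge>0. \<beta> t \<noteq> 1"

section \<open>Reconstructibility\<close>

text \<open>The observation is restricted to \<open>{0..}\<close>, i.e. it is \<open>undefined\<close> at negative times,
  so that \<open>A\<close> is effectively a function of \<open>(f (X t))\<close> for \<open>t \<ge> 0\<close> only.  No measurability
  is required of \<open>A\<close>; the shift \<open>\<theta>\<close> may depend on the outcome \<open>\<omega>\<close>.\<close>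

definition reconstructible ::
    "'w measure \<Rightarrow> (real \<Rightarrow> 'w \<Rightarrow> 'n::finite torus) \<Rightarrow> ('n torus \<Rightarrow> real) set \<Rightarrow> bool" where
  "reconstructible M X F \<longleftrightarrow>
     (\<exists>A :: (real \<Rightarrow> real) \<Rightarrow> 'n torus \<Rightarrow> real. \<forall>f\<in>F. AE \<omega> in M. \<exists>\<theta>.
        AE x in torus_lebesgue. A (\<lambda>t\<in>{0..}. f (X t \<omega>)) x = f (x + \<theta>))"

definition open_null_boundary_indicators :: "('n::finite torus \<Rightarrow> real) set" where
  "open_null_boundary_indicators =
     {indicator \<Omega> | \<Omega>. open \<Omega> \<and> emeasure torus_lebesgue (frontier \<Omega>) = 0}"

end

theory Submission
  imports Defs "HOL-Library.Discrete_Functions"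
begin

text \<open>
  Observe \<open>X\<close> only at the multiples of \<open>t0\<close>; this is a random walk with step law \<open>D t0\<close>, for which
  the character with frequency \<open>k\<close> is an eigenfunction of the convolution operator \<open>P\<close> with
  eigenvalue \<open>ev k\<close>.  The numbers \<open>ev k\<close> are pairwise distinct, so none but \<open>ev 0\<close> equals \<open>1\<close>;
  the covariances of products of characters along the walk are then geometric progressions with bounded sums.
  Hence almost surely all empirical averages of products of characters at consecutive times converge.  The starting point may depend on the
  increments, but it cancels from all covariances.  For the indicator \<open>f\<close> of an open set with null
  boundary, sandwiching between trigonometric polynomials shows that a path determines all the
  correlations \<open>\<integral> f P\<^sup>a (f P\<^sup>b (f \<dots>))\<close>.

  As the \<open>ev k\<close> are distinct and accumulate only at a value that none of them attains, the powers of
  \<open>P\<close> separate the frequencies, and the correlations yield all products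
  \<open>fcoef f k\<^sub>1 * \<dots> * fcoef f k\<^sub>m\<close> with \<open>k\<^sub>1 + \<dots> + k\<^sub>m = 0\<close>.  These are the moments of the Fourier
  coefficients of a uniformly random translate of \<open>f\<close>, and they determine the orbit of \<open>f\<close> by compactness of
  the torus.  The reconstruction picks any indicator function that is compatible with the observed path.
\<close>

section \<open>Characters and topology of the torus\<close>

text \<open>Genericity of a path is expressed through characters alone. There are countably many
  words of characters, so one null set serves the whole uncountable family, and off it the argument
  is deterministic: two indicators that produce the same observations along two generic paths,
  possibly of different outcomes, agree up to translation. This is what makes an arbitrary choice of
  a compatible function legitimate. The price is a transfer from characters to \<open>f\<close>
  along each single generic path, where approximation in mean says nothing. A null boundary yields
  majorants of the error that are themselves trigonometric polynomials, hence controlled along the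
  path. The eigenvalue is \<open>ev k = \<beta> t0 + (1 - \<beta> t0) * F (- k)\<close>, where
  \<open>F\<close> lists the Fourier coefficients of the density at \<open>t0\<close>. Their
  distinctness makes \<open>ev\<close> injective, their non-vanishing keeps
  \<open>\<beta> t0\<close> out of its range, and square integrability makes
  \<open>\<beta> t0\<close> its only accumulation point. The first two points rest on
  \<open>\<beta> t0 < 1\<close>, which holds because the masses of the atoms multiply under
  convolution.\<close>

lemma torus_cases: obtains v where "x = to_torus v"
  using surj_to_torus by (metis surjD)

lemma torus_char_add: "torus_char k (x + y) = torus_char k x * torus_char k y"
  by transfer (simp add: cis_mult distrib_left sum.distrib)

lemma torus_char_add_left: "torus_char (k + l) x = torus_char k x * torus_char l x"
  by transfer (simp add: cis_mult distrib_right sum.distrib)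

lemma torus_char_0 [simp]: "torus_char k 0 = 1" "torus_char 0 x = 1"
  by (transfer, simp)+

lemma norm_torus_char [simp]: "norm (torus_char k x) = 1"
  by transfer simp

lemma torus_char_uminus: "torus_char (- k) x = cnj (torus_char k x)"
  by transfer (simp add: cis_cnj sum_negf)

lemma torus_char_uminus_right: "torus_char k (- x) = cnj (torus_char k x)"
  by transfer (simp add: cis_cnj sum_negf)

lemma torus_char_cnj_mult [simp]:
  "torus_char k x * cnj (torus_char k x) = 1" "cnj (torus_char k x) * torus_char k x = 1"
  by (simp_all add: complex_norm_square[symmetric] mult.commute[of "cnj _"])

lemma continuous_on_torus_char [continuous_intros]: "continuous_on A (torus_char k)"
proof -
  have "continuous_on UNIV (\<lambda>v::real^'a. cis (\<Sum>i\<in>UNIV. of_int (k $ i) * v $ i))"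
    by (intro continuous_intros)
  then have c: "continuous_on UNIV (torus_char k \<circ> to_torus)"
    by (simp add: comp_def torus_char.abs_eq)
  have "open (torus_char k -` B)" if "open B" for B
    using c that unfolding continuous_on_open_vimage[OF open_UNIV] open_torus_def
    by (simp add: vimage_comp)
  then have "continuous_on UNIV (torus_char k)"
    by (simp add: continuous_on_open_vimage)
  then show ?thesis by (rule continuous_on_subset) simp
qed

lemma torus_char_measurable [measurable]: "torus_char k \<in> borel_measurable borel"
  by (intro borel_measurable_continuous_onI continuous_on_torus_char)

text \<open>The characters whose frequency is a unit vector read off the single coordinates modulo
  \<open>2 * pi\<close>.\<close>

lemma torus_char_separates:
  assumes "x \<noteq> y"
  obtains i where "torus_char (axis i 1) x \<noteq> torus_char (axis i 1) y"
proof -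
  obtain v w where [simp]: "x = to_torus v" "y = to_torus w" by (metis torus_cases)
  have "\<not> torus_rel v w" using assms by (simp add: to_torus_eq_iff)
  then obtain i where i: "\<And>k::int. v $ i - w $ i \<noteq> 2 * pi * of_int k"
    unfolding torus_rel_def by blast
  have *: "torus_char (axis i 1) (to_torus u) = cis (u $ i)" for u :: "real^'a"
  proof -
    have "(\<Sum>j\<in>UNIV. of_int ((axis i 1 :: int^'a) $ j) * u $ j) = (\<Sum>j\<in>UNIV. if j = i then u $ j else 0)"
      by (intro sum.cong) (auto simp: axis_def)
    then show ?thesis by (simp add: torus_char.abs_eq)
  qed
  have "cis (v $ i) \<noteq> cis (w $ i)"
  proof
    assume "cis (v $ i) = cis (w $ i)"
    then have "cis (v $ i - w $ i) = 1" by (simp add: cis_divide[symmetric])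
    then obtain n :: int where "v $ i - w $ i = 2 * pi * of_int n"
      by (auto simp: complex_eq_iff cos_one_2pi_int)
    with i show False by blast
  qed
  then show ?thesis using that[of i] by (simp add: *)
qed

text \<open>Disjoint neighbourhoods are pulled back from the complex plane along a separating
  character.\<close>

instance torus :: (finite) t2_space
proof
  fix x y :: "'a torus" assume "x \<noteq> y"
  then obtain i where "torus_char (axis i 1) x \<noteq> torus_char (axis i 1) y"
    by (rule torus_char_separates)
  then obtain U V where UV: "open U" "open V" "torus_char (axis i 1) x \<in> U"
      "torus_char (axis i 1) y \<in> V" "U \<inter> V = {}"
    by (rule hausdorff[THEN exE]) blast
  have o: "open (torus_char (axis i 1) -` B)" if "open B" for B
    using continuous_on_torus_char[of UNIV "axis i 1"] that by (simp add: continuous_on_open_vimage)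
  show "\<exists>U V. open U \<and> open V \<and> x \<in> U \<and> y \<in> V \<and> U \<inter> V = {}"
    using UV o by (intro exI[of _ "torus_char (axis i 1) -` U"] exI[of _ "torus_char (axis i 1) -` V"]) auto
qed

section \<open>Fundamental domain and compactness\<close>

definition torus_box :: "(real ^ 'n) set" where
  "torus_box = {x. \<forall>i. 0 \<le> x $ i \<and> x $ i < 2 * pi}"

lemma to_torus_box: "to_torus ` torus_box = UNIV"
proof (intro equalityI subsetI)
  fix x :: "'a torus"
  obtain v where v: "x = to_torus v" by (rule torus_cases)
  define q where "q i = \<lfloor>v $ i / (2 * pi)\<rfloor>" for i
  define w :: "real^'a" where "w = (\<chi> i. v $ i - 2 * pi * of_int (q i))"
  have "torus_rel v w" by (auto simp: torus_rel_def w_def)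
  moreover have "w \<in> torus_box"
  proof -
    have "0 \<le> w $ i \<and> w $ i < 2 * pi" for i
    proof -
      have "of_int (q i) \<le> v $ i / (2 * pi)" "v $ i / (2 * pi) < of_int (q i) + 1"
        unfolding q_def by linarith+
      then show ?thesis by (simp add: w_def pos_le_divide_eq pos_divide_less_eq algebra_simps)
    qed
    then show ?thesis by (simp add: torus_box_def)
  qed
  ultimately show "x \<in> to_torus ` torus_box" using v to_torus_eq_iff[of v w] by auto
qed simp

lemma torus_box_subset_cbox: "torus_box \<subseteq> cbox 0 (\<chi> i. 2 * pi)"
  by (auto simp: torus_box_def mem_box_cart less_imp_le)

lemma compact_torus: "compact (UNIV :: 'n::finite torus set)"
proof -
  have "to_torus ` cbox 0 (\<chi> i. 2 * pi) = (UNIV :: 'n torus set)"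
    using to_torus_box image_mono[OF torus_box_subset_cbox, of to_torus] by blast
  then show ?thesis
    by (metis compact_cbox compact_continuous_image continuous_on_to_torus)
qed

lemma compact_closed_torus: "closed C \<Longrightarrow> compact (C :: 'n::finite torus set)"
  using compact_Int_closed[OF compact_torus, of C] by simp

lemma continuous_torus_bounded:
  fixes f :: "'n::finite torus \<Rightarrow> 'b::real_normed_vector"
  assumes "continuous_on UNIV f"
  obtains B where "0 < B" "\<And>x. norm (f x) \<le> B"
proof -
  have "bounded (range f)"
    by (intro compact_imp_bounded compact_continuous_image assms compact_torus)
  then show ?thesis using that unfolding bounded_pos by auto
qed

section \<open>Normalised Haar measure\<close>

lemma cart_slab_measurable [measurable]:
  "{x::real^'n::finite. a \<le> x $ i \<and> x $ i < b} \<in> sets borel"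
proof -
  have "{x::real^'n. a \<le> x $ i \<and> x $ i < b} = {x. a \<le> x $ i} \<inter> {x. x $ i < b}" by blast
  then show ?thesis
    by (auto intro!: sets.Int borel_closed borel_open closed_Collect_le open_Collect_less continuous_intros)
qed

lemma cart_box_measurable:
  "{x::real^'n::finite. \<forall>j\<in>J. a \<le> x $ j \<and> x $ j < b} \<in> sets borel"
proof -
  have "{x::real^'n. \<forall>j\<in>J. a \<le> x $ j \<and> x $ j < b}
      = (\<Inter>j. if j \<in> J then {x. a \<le> x $ j \<and> x $ j < b} else UNIV)" by (auto split: if_splits)
  also have "\<dots> \<in> sets borel" by (intro sets.finite_INT) auto
  finally show ?thesis .
qed

lemma torus_box_measurable [measurable]: "torus_box \<in> sets borel"
  using cart_box_measurable[of UNIV 0 "2 * pi"] by (simp add: torus_box_def)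

lemma sets_torus_lebesgue [simp, measurable_cong]: "sets torus_lebesgue = sets borel"
  by (simp add: torus_lebesgue_def)

lemma space_torus_lebesgue [simp]: "space torus_lebesgue = UNIV"
  by (simp add: torus_lebesgue_def)

lemma emeasure_torus_lebesgue:
  assumes [measurable]: "A \<in> sets borel"
  shows "emeasure torus_lebesgue A = (\<integral>\<^sup>+x. indicator torus_box x * indicator A (to_torus x) \<partial>lborel)"
proof -
  have "emeasure torus_lebesgue A
      = (\<integral>\<^sup>+x. indicator A (to_torus x) \<partial>restrict_space lborel torus_box)"
    unfolding torus_lebesgue_def torus_box_def[symmetric]
    by (subst nn_integral_indicator[symmetric], simp)
      (subst nn_integral_distr, auto intro!: measurable_restrict_space1)
  also have "\<dots> = (\<integral>\<^sup>+x. indicator torus_box x * indicator A (to_torus x) \<partial>lborel)"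
    by (subst nn_integral_restrict_space) (auto simp: mult.commute)
  finally show ?thesis .
qed

lemma nn_integral_lborel_translate:
  assumes [measurable]: "h \<in> borel_measurable borel"
  shows "(\<integral>\<^sup>+x. h (c + x) \<partial>lborel) = (\<integral>\<^sup>+x. h x \<partial>(lborel :: 'b::euclidean_space measure))"
  by (subst (2) lborel_distr_plus[of c, symmetric]) (simp add: nn_integral_distr)

lemma to_torus_add: "to_torus (v + w) = to_torus v + to_torus w"
  by (simp add: plus_torus.abs_eq)

lemma axis_component: "axis i a $ j = (if j = i then a else 0)"
  by (simp add: axis_def)

lemma to_torus_axis_2pi: "to_torus (axis i (2 * pi)) = 0"
  unfolding zero_torus_def to_torus_eq_iff torus_rel_def
  by (auto simp: axis_def intro: exI[of _ 1] exI[of _ 0])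

text \<open>Translating the fundamental box by \<open>s\<close> along an axis pushes a slab out of the box;
  translation by \<open>2 * pi\<close> brings it back.\<close>

lemma emeasure_torus_lebesgue_axis:
  fixes A :: "'n::finite torus set"
  assumes [measurable]: "A \<in> sets borel" and s: "0 \<le> s" "s < 2 * pi"
  shows "emeasure torus_lebesgue ((+) (to_torus (axis i s)) -` A) = emeasure torus_lebesgue A"
proof -
  let ?T = "to_torus :: real^'n \<Rightarrow> 'n torus"
  define R :: "(real^'n) set" where "R = {x. \<forall>j. j \<noteq> i \<longrightarrow> 0 \<le> x $ j \<and> x $ j < 2 * pi}"
  define S where "S a b = R \<inter> {x. a \<le> x $ i \<and> x $ i < b}" for a b
  have R: "R \<in> sets borel"
    using cart_box_measurable[of "- {i}" 0 "2 * pi"] by (simp add: R_def)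
  have [measurable]: "S a b \<in> sets borel" for a b
    unfolding S_def using R by (intro sets.Int cart_slab_measurable)
  have [measurable]: "(+) c -` A \<in> sets borel" for c :: "'n torus"
  proof -
    have "(+) c \<in> borel_measurable borel"
      by (intro borel_measurable_continuous_onI continuous_intros)
    from measurable_sets[OF this assms(1)] show ?thesis by simp
  qed
  have m: "(\<lambda>x. indicator (S a b) x * indicator A (?T x) :: ennreal) \<in> borel_measurable borel" for a b
    by measurable
  have "emeasure torus_lebesgue ((+) (?T (axis i s)) -` A)
      = (\<integral>\<^sup>+x. indicator (S s (2*pi+s)) (axis i s + x) * indicator A (?T (axis i s + x)) \<partial>lborel)"
    unfolding emeasure_torus_lebesgue[OF \<open>(+) (?T (axis i s)) -` A \<in> sets borel\<close>]
    by (intro nn_integral_cong)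
      (auto simp: torus_box_def S_def R_def axis_component to_torus_add indicator_def split: if_splits)
  also have "\<dots> = (\<integral>\<^sup>+x. indicator (S s (2*pi+s)) x * indicator A (?T x) \<partial>lborel)"
    by (rule nn_integral_lborel_translate[OF m])
  also have "\<dots> = (\<integral>\<^sup>+x. indicator (S s (2*pi)) x * indicator A (?T x)
       + indicator (S (2*pi) (2*pi+s)) x * indicator A (?T x) \<partial>lborel)"
    using s by (intro nn_integral_cong) (auto simp: S_def indicator_def)
  also have "\<dots> = (\<integral>\<^sup>+x. indicator (S s (2*pi)) x * indicator A (?T x) \<partial>lborel)
      + (\<integral>\<^sup>+x. indicator (S (2*pi) (2*pi+s)) x * indicator A (?T x) \<partial>lborel)"
    by (intro nn_integral_add) simp_all
  also have "(\<integral>\<^sup>+x. indicator (S (2*pi) (2*pi+s)) x * indicator A (?T x) \<partial>lborel)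
      = (\<integral>\<^sup>+x. indicator (S (2*pi) (2*pi+s)) (axis i (2*pi) + x) * indicator A (?T (axis i (2*pi) + x)) \<partial>lborel)"
    by (rule nn_integral_lborel_translate[OF m, symmetric])
  also have "\<dots> = (\<integral>\<^sup>+x. indicator (S 0 s) x * indicator A (?T x) \<partial>lborel)"
    by (intro nn_integral_cong)
      (auto simp: S_def R_def indicator_def axis_component to_torus_add to_torus_axis_2pi split: if_splits)
  also have "(\<integral>\<^sup>+x. indicator (S s (2*pi)) x * indicator A (?T x) \<partial>lborel) + \<dots>
      = (\<integral>\<^sup>+x. indicator (S s (2*pi)) x * indicator A (?T x) + indicator (S 0 s) x * indicator A (?T x) \<partial>lborel)"
    by (intro nn_integral_add[symmetric]) simp_all
  also have "\<dots> = emeasure torus_lebesgue A"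
    unfolding emeasure_torus_lebesgue[OF assms(1)]
    using s by (intro nn_integral_cong) (auto simp: S_def R_def torus_box_def indicator_def, (smt (verit))+)
  finally show ?thesis .
qed


lemma plus_torus_measurable [measurable]: "(+) (c :: 'n::finite torus) \<in> borel_measurable borel"
  by (intro borel_measurable_continuous_onI continuous_intros)

text \<open>The translations that preserve the measure of all Borel sets are closed under addition.
  Every point has a representative in the fundamental box and is the sum of its axis components,
  each of which is covered by the axis case.\<close>

lemma emeasure_torus_lebesgue_translate:
  fixes A :: "'n::finite torus set"
  assumes A: "A \<in> sets borel"
  shows "emeasure torus_lebesgue ((+) c -` A) = emeasure torus_lebesgue A"
proof -
  define G where "G = {c :: 'n torus. \<forall>A\<in>sets borel.
    emeasure torus_lebesgue ((+) c -` A) = emeasure torus_lebesgue A}"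
  have [measurable]: "(+) c -` A \<in> sets borel" if "A \<in> sets borel" for c :: "'n torus" and A
    using measurable_sets[OF plus_torus_measurable that] by simp
  have add: "a + b \<in> G" if "a \<in> G" "b \<in> G" for a b
  proof -
    have "(+) (a + b) -` A = (+) b -` ((+) a -` A)" for A by (auto simp: add.assoc)
    with that show ?thesis by (auto simp: G_def)
  qed
  obtain v where v: "v \<in> torus_box" "c = to_torus v" using to_torus_box by (metis UNIV_I imageE)
  have "to_torus (\<Sum>i\<in>I. axis i (v $ i)) \<in> G" if "finite I" for I
    using that
  proof (induction I)
    case empty
    have "(+) (to_torus 0) -` A = A" for A :: "'n torus set" by (auto simp: zero_torus_def[symmetric])
    then show ?case by (simp add: G_def)
  next
    case (insert i I)
    have "to_torus (axis i (v $ i)) \<in> G"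
      using v by (auto simp: G_def torus_box_def intro!: emeasure_torus_lebesgue_axis)
    with insert show ?case by (simp add: to_torus_add add)
  qed
  from this[of UNIV] have "to_torus (\<Sum>i\<in>UNIV. axis i (v $ i)) \<in> G" by simp
  also have "(\<Sum>i\<in>UNIV. axis i (v $ i)) = v"
    by (simp add: vec_eq_iff axis_component)
  finally show ?thesis using v A by (simp add: G_def)
qed

lemma emeasure_torus_lebesgue_UNIV:
  "0 < emeasure (torus_lebesgue :: 'n::finite torus measure) UNIV"
  "emeasure (torus_lebesgue :: 'n::finite torus measure) UNIV < \<infinity>"
proof -
  have eq: "emeasure (torus_lebesgue :: 'n torus measure) UNIV
      = emeasure lborel (torus_box :: (real^'n) set)"
    by (subst emeasure_torus_lebesgue) (auto simp: nn_integral_indicator)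
  have "emeasure lborel (torus_box :: (real^'n) set) \<le> emeasure lborel (cbox 0 (\<chi> i. 2 * pi) :: (real^'n) set)"
    by (intro emeasure_mono torus_box_subset_cbox) simp
  also have "\<dots> < \<infinity>" using emeasure_lborel_cbox_finite by blast
  finally show "emeasure (torus_lebesgue :: 'n torus measure) UNIV < \<infinity>" by (simp add: eq)
  have "0 < emeasure lborel (box 0 (\<chi> i. 2 * pi) :: (real^'n) set)"
    by (subst emeasure_lborel_box_eq) (auto simp: Basis_vec_def inner_axis intro!: prod_pos)
  also have "\<dots> \<le> emeasure lborel (torus_box :: (real^'n) set)"
    by (intro emeasure_mono) (auto simp: torus_box_def mem_box_cart less_imp_le)
  finally show "0 < emeasure (torus_lebesgue :: 'n torus measure) UNIV" by (simp add: eq)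
qed

definition torus_volume :: "'n::finite itself \<Rightarrow> real" where
  "torus_volume _ = measure (torus_lebesgue :: 'n torus measure) UNIV"

lemma torus_volume_pos: "0 < torus_volume TYPE('n::finite)"
  using emeasure_torus_lebesgue_UNIV[where 'n = 'n] unfolding torus_volume_def measure_def
  by (simp add: enn2real_positive_iff)

definition haar :: "'n::finite torus measure" where
  "haar = density torus_lebesgue (\<lambda>_. ennreal (1 / torus_volume TYPE('n)))"

lemma sets_haar [simp, measurable_cong]: "sets haar = sets borel"
  by (simp add: haar_def)

lemma space_haar [simp]: "space haar = UNIV"
  by (simp add: haar_def)

lemma emeasure_haar:
  assumes "A \<in> sets borel"
  shows "emeasure (haar :: 'n::finite torus measure) A
      = ennreal (1 / torus_volume TYPE('n)) * emeasure torus_lebesgue A"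
  using assms by (simp add: haar_def emeasure_density nn_integral_cmult_indicator)

lemma prob_space_haar: "prob_space (haar :: 'n::finite torus measure)"
proof
  have "emeasure (torus_lebesgue :: 'n torus measure) UNIV = ennreal (torus_volume TYPE('n))"
    unfolding torus_volume_def using emeasure_torus_lebesgue_UNIV[where 'n = 'n]
    by (intro emeasure_eq_ennreal_measure) auto
  then show "emeasure (haar :: 'n torus measure) (space haar) = 1"
    using torus_volume_pos[where 'n = 'n] by (simp add: emeasure_haar ennreal_mult[symmetric])
qed

interpretation haar: prob_space "haar :: 'n::finite torus measure"
  by (rule prob_space_haar)

lemma measure_haar_UNIV [simp]: "measure haar UNIV = 1"
  using haar.prob_space by simp

lemma integral_haar:
  fixes h :: "'n::finite torus \<Rightarrow> complex"
  assumes "h \<in> borel_measurable borel"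
  shows "(LINT x|haar. h x) = (LINT x|torus_lebesgue. h x) / torus_volume TYPE('n)"
  using assms torus_volume_pos[where 'n = 'n] unfolding haar_def
  by (subst integral_density) (simp_all add: scaleR_conv_of_real field_simps)

lemma AE_haar_iff:
  "(AE x in (haar :: 'n::finite torus measure). P x) \<longleftrightarrow> (AE x in torus_lebesgue. P x)"
  unfolding haar_def using torus_volume_pos[where 'n = 'n] by (subst AE_density) auto

lemma distr_haar_translate: "distr haar borel ((+) c) = (haar :: 'n::finite torus measure)"
proof (rule measure_eqI)
  fix A :: "'n torus set" assume "A \<in> sets (distr haar borel ((+) c))"
  then have [measurable]: "A \<in> sets borel" by simp
  have "(+) c -` A \<in> sets borel" using measurable_sets[OF plus_torus_measurable, of A] by simp
  then show "emeasure (distr haar borel ((+) c)) A = emeasure haar A"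
    by (subst emeasure_distr) (auto simp: emeasure_haar emeasure_torus_lebesgue_translate)
qed simp

lemma integral_haar_translate:
  fixes h :: "'n::finite torus \<Rightarrow> 'b::{banach, second_countable_topology}"
  assumes [measurable]: "h \<in> borel_measurable borel"
  shows "(LINT x|haar. h (c + x)) = (LINT x|haar. h x)"
  by (subst (2) distr_haar_translate[of c, symmetric]) (simp add: integral_distr)

lemma nn_integral_haar_translate:
  fixes h :: "'n::finite torus \<Rightarrow> ennreal"
  assumes [measurable]: "h \<in> borel_measurable borel"
  shows "(\<integral>\<^sup>+x. h (c + x) \<partial>haar) = (\<integral>\<^sup>+x. h x \<partial>haar)"
  by (subst (2) distr_haar_translate[of c, symmetric]) (simp add: nn_integral_distr)

text \<open>For \<open>k \<noteq> 0\<close> some translation multiplies the character by \<open>-1\<close>.\<close>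

lemma integral_torus_char:
  "(LINT x|haar. torus_char k x) = (if k = 0 then 1 else 0)"
proof (cases "k = 0")
  case False
  then obtain i where i: "k $ i \<noteq> 0" by (auto simp: vec_eq_iff)
  define c where "c = to_torus (axis i (pi / of_int (k $ i)))"
  have "(\<Sum>j\<in>UNIV. of_int (k $ j) * axis i (pi / of_int (k $ i)) $ j)
      = (\<Sum>j\<in>UNIV. if j = i then pi else 0)"
    using i by (intro sum.cong) (auto simp: axis_component)
  then have "torus_char k c = -1" by (simp add: c_def torus_char.abs_eq)
  then have "(LINT x|haar. torus_char k (c + x)) = - (LINT x|haar. torus_char k x)"
    by (simp add: torus_char_add)
  then have "(LINT x|haar. torus_char k x) = - (LINT x|haar. torus_char k x)"
    by (simp add: integral_haar_translate)
  then show ?thesis using False by simp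
qed simp

lemma integrable_haar_bounded:
  fixes h :: "'n::finite torus \<Rightarrow> 'b::{banach, second_countable_topology}"
  assumes "h \<in> borel_measurable borel" "\<And>x. norm (h x) \<le> B"
  shows "integrable haar h"
  using assms by (intro haar.integrable_const_bound[of _ B]) auto

lemma integrable_haar_continuous:
  fixes h :: "'n::finite torus \<Rightarrow> 'b::{banach, second_countable_topology}"
  assumes "continuous_on UNIV h"
  shows "integrable haar h"
proof -
  obtain B where "\<And>x. norm (h x) \<le> B" using continuous_torus_bounded[OF assms] by blast
  then show ?thesis
    using assms by (intro integrable_haar_bounded borel_measurable_continuous_onI) auto
qed

section \<open>Trigonometric polynomials\<close>

text \<open>Generation by rules instead of explicit finite sums: every linear statement about
  trigonometric polynomials becomes an induction whose only real case is a single character. Closure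
  under products follows because frequencies add.\<close>

inductive trig :: "('n::finite torus \<Rightarrow> complex) \<Rightarrow> bool" where
  trig_char: "trig (torus_char k)"
| trig_add: "trig p \<Longrightarrow> trig q \<Longrightarrow> trig (\<lambda>x. p x + q x)"
| trig_scale: "trig p \<Longrightarrow> trig (\<lambda>x. c * p x)"

lemma trig_const: "trig (\<lambda>_. c)"
  using trig_scale[OF trig_char[of 0], of c] by simp

lemma trig_mult:
  assumes "trig p" "trig q"
  shows "trig (\<lambda>x. p x * q x)"
  using assms(1)
proof induction
  case (trig_char k)
  show ?case using assms(2)
  proof induction
    case (trig_char l)
    have "(\<lambda>x. torus_char k x * torus_char l x) = torus_char (k + l)"
      by (simp add: fun_eq_iff torus_char_add_left)
    then show ?case by (simp add: trig.trig_char)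
  next
    case (trig_add p q)
    then show ?case using trig.trig_add by (fastforce simp: distrib_left)
  next
    case (trig_scale p c)
    then show ?case using trig.trig_scale[of _ c] by (simp add: mult.left_commute)
  qed
next
  case (trig_add p q)
  then show ?case using trig.trig_add by (fastforce simp: distrib_right)
next
  case (trig_scale p c)
  then show ?case using trig.trig_scale[of _ c] by (simp add: mult.assoc)
qed

lemma trig_continuous: "trig p \<Longrightarrow> continuous_on A p"
  by (induction rule: trig.induct) (auto intro!: continuous_intros)

lemma trig_measurable: "trig p \<Longrightarrow> p \<in> borel_measurable borel"
  by (intro borel_measurable_continuous_onI trig_continuous)

lemma trig_Re_char: "trig (\<lambda>x. complex_of_real (Re (torus_char k x)))"
proof -
  have "(\<lambda>x. complex_of_real (Re (torus_char k x)))
      = (\<lambda>x. (1/2) * (torus_char k x + torus_char (- k) x))"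
    by (auto simp: torus_char_uminus complex_add_cnj)
  then show ?thesis
    using trig_scale[OF trig_add[OF trig_char trig_char], of "1/2" k "- k"] by simp
qed

lemma trig_Im_char: "trig (\<lambda>x. complex_of_real (Im (torus_char k x)))"
proof -
  have "(\<lambda>x. complex_of_real (Im (torus_char k x)))
      = (\<lambda>x. (- \<i>/2) * (torus_char k x + (-1) * torus_char (- k) x))"
    by (rule ext) (simp add: torus_char_uminus complex_eq_iff)
  then show ?thesis
    using trig_scale[OF trig_add[OF trig_char trig_scale[OF trig_char]], of "- \<i>/2" k "-1" "- k"]
    by simp
qed

text \<open>Stone-Weierstrass for the real functions whose complexification is a trigonometric
  polynomial. Real and imaginary parts of the coordinate characters belong to this ring and separate
  points.\<close>

lemma trig_dense_continuous:
  fixes \<phi> :: "'n::finite torus \<Rightarrow> real"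
  assumes "continuous_on UNIV \<phi>" "0 < e"
  obtains p where "trig (\<lambda>x. complex_of_real (p x))" "\<And>x. \<bar>\<phi> x - p x\<bar> < e"
proof -
  let ?R = "{p :: 'n torus \<Rightarrow> real. trig (\<lambda>x. complex_of_real (p x))}"
  interpret function_ring_on ?R UNIV
  proof
    fix f assume "f \<in> ?R"
    then have "continuous_on UNIV (\<lambda>x. Re (complex_of_real (f x)))"
      by (intro continuous_intros trig_continuous) simp
    then show "continuous_on UNIV f" by simp
  next
    fix x y :: "'n torus" assume "x \<noteq> y"
    then obtain i where "torus_char (axis i 1) x \<noteq> torus_char (axis i 1) y"
      by (rule torus_char_separates)
    then consider "Re (torus_char (axis i 1) x) \<noteq> Re (torus_char (axis i 1) y)"
      | "Im (torus_char (axis i 1) x) \<noteq> Im (torus_char (axis i 1) y)"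
      by (auto simp: complex_eq_iff)
    then show "\<exists>f\<in>?R. f x \<noteq> f y"
    proof cases
      case 1
      then show ?thesis by (intro bexI[of _ "\<lambda>x. Re (torus_char (axis i 1) x)"]) (auto simp: trig_Re_char)
    next
      case 2
      then show ?thesis by (intro bexI[of _ "\<lambda>x. Im (torus_char (axis i 1) x)"]) (auto simp: trig_Im_char)
    qed
  qed (auto simp: compact_torus trig_const intro: trig_add trig_mult)
  obtain p where "p \<in> ?R" "\<And>x. \<bar>\<phi> x - p x\<bar> < e"
    using Stone_Weierstrass_basic[OF assms] by auto
  with that show ?thesis by auto
qed

section \<open>Approximation of indicator functions\<close>

text \<open>The coordinate characters embed the torus into a metric space, and the image of
  \<open>C\<close> is compact, hence closed. Tents of slope \<open>j\<close> in the distance to this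
  image decrease to the indicator.\<close>

lemma closed_indicator_limit:
  fixes C :: "'n::finite torus set"
  assumes "closed C"
  obtains \<psi> :: "nat \<Rightarrow> 'n torus \<Rightarrow> real"
  where "\<And>j. continuous_on UNIV (\<psi> j)" "\<And>j x. \<psi> j x \<in> {0..1}"
    "\<And>j x. indicator C x \<le> \<psi> j x" "\<And>x. (\<lambda>j. \<psi> j x) \<longlonglongrightarrow> indicator C x"
proof (cases "C = {}")
  \<comment> \<open>The empty set is treated apart because \<open>infdist\<close> to it is 0 by
    convention, so that the tents used below would be constantly 1.\<close>
  case True
  then show ?thesis using that[of "\<lambda>_ _. 0"] by simp
next
  case False
  define \<iota> :: "'n torus \<Rightarrow> complex ^ 'n" where "\<iota> x = (\<chi> i. torus_char (axis i 1) x)" for x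
  have cont: "continuous_on A \<iota>" for A
    unfolding \<iota>_def by (intro continuous_intros)
  have inj: "inj \<iota>"
    by (rule injI) (metis (no_types, lifting) \<iota>_def torus_char_separates vec_lambda_beta)
  have "compact (\<iota> ` C)" by (intro compact_continuous_image cont compact_closed_torus assms)
  then have cl: "closed (\<iota> ` C)" by (rule compact_imp_closed)
  define \<psi> where "\<psi> j x = max 0 (1 - real j * infdist (\<iota> x) (\<iota> ` C))" for j x
  show ?thesis
  proof (rule that[of \<psi>])
    show "continuous_on UNIV (\<psi> j)" for j
      unfolding \<psi>_def by (intro continuous_intros cont)
    show "\<psi> j x \<in> {0..1}" for j x by (simp add: \<psi>_def infdist_nonneg)
    show "indicator C x \<le> \<psi> j x" for j x
      by (cases "x \<in> C") (auto simp: \<psi>_def)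
    show "(\<lambda>j. \<psi> j x) \<longlonglongrightarrow> indicator C x" for x
    proof (cases "x \<in> C")
      case True
      then show ?thesis by (simp add: \<psi>_def)
    next
      case x: False
      then have "\<iota> x \<notin> \<iota> ` C" using inj by (auto dest: injD)
      then have pos: "0 < infdist (\<iota> x) (\<iota> ` C)"
        using infdist_pos_not_in_closed[OF cl] False by simp
      obtain N where N: "1 / infdist (\<iota> x) (\<iota> ` C) \<le> real N" using real_arch_simple by blast
      have "\<psi> j x = 0" if "j \<ge> N" for j
      proof -
        have "1 / infdist (\<iota> x) (\<iota> ` C) \<le> real j" using N that by linarith
        then show ?thesis using pos by (simp add: \<psi>_def field_simps)
      qed
      then have "eventually (\<lambda>j. \<psi> j x = 0) sequentially" by (auto simp: eventually_sequentially)
      then show ?thesis using x by (simp add: tendsto_eventually)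
    qed
  qed
qed

lemma emeasure_frontier_haar:
  "emeasure torus_lebesgue (frontier S) = 0 \<Longrightarrow> measure haar (frontier S) = 0"
  by (simp add: measure_def emeasure_haar frontier_closed borel_closed)

text \<open>Tents above the closure of \<open>\<Omega>\<close> and, after reflection, above its
  complement enclose the indicator. Their gap tends to the indicator of the frontier, which is null,
  so dominated convergence makes its integral small; Stone-Weierstrass then replaces both bounds by
  polynomials.\<close>

lemma null_frontier_sandwich:
  fixes \<Omega> :: "'n::finite torus set"
  assumes "open \<Omega>" "emeasure torus_lebesgue (frontier \<Omega>) = 0" "0 < e" "e \<le> 1"
  obtains p q where "trig (\<lambda>x. complex_of_real (p x))" "trig (\<lambda>x. complex_of_real (q x))"
    "\<And>x. p x \<le> indicator \<Omega> x" "\<And>x. indicator \<Omega> x \<le> q x" "\<And>x. - 1 \<le> p x" "\<And>x. q x \<le> 2"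
    "(LINT x|haar. q x - p x) < e"
proof -
  obtain \<psi> :: "nat \<Rightarrow> 'n torus \<Rightarrow> real" where \<psi>: "\<And>j. continuous_on UNIV (\<psi> j)" "\<And>j x. \<psi> j x \<in> {0..1}"
    "\<And>j x. indicator (closure \<Omega>) x \<le> \<psi> j x" "\<And>x. (\<lambda>j. \<psi> j x) \<longlonglongrightarrow> indicator (closure \<Omega>) x"
    using closed_indicator_limit[OF closed_closure] by metis
  obtain \<phi> :: "nat \<Rightarrow> 'n torus \<Rightarrow> real" where \<phi>: "\<And>j. continuous_on UNIV (\<phi> j)" "\<And>j x. \<phi> j x \<in> {0..1}"
    "\<And>j x. indicator (- \<Omega>) x \<le> \<phi> j x" "\<And>x. (\<lambda>j. \<phi> j x) \<longlonglongrightarrow> indicator (- \<Omega>) x"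
    using closed_indicator_limit[of "- \<Omega>"] assms(1) by (metis closed_Compl)
  have m [measurable]: "\<psi> j \<in> borel_measurable borel" "\<phi> j \<in> borel_measurable borel" for j
    using \<psi>(1) \<phi>(1) by (auto intro: borel_measurable_continuous_onI)
  have [measurable]: "frontier \<Omega> \<in> sets borel" by (intro borel_closed frontier_closed)
  have lim: "(\<lambda>j. \<psi> j x - (1 - \<phi> j x)) \<longlonglongrightarrow> indicator (frontier \<Omega>) x" for x
  proof -
    have "(\<lambda>j. \<psi> j x - (1 - \<phi> j x)) \<longlonglongrightarrow> indicator (closure \<Omega>) x - (1 - indicator (- \<Omega>) x)"
      by (intro tendsto_diff tendsto_const \<psi>(4) \<phi>(4))
    also have "indicator (closure \<Omega>) x - (1 - indicator (- \<Omega>) x) = (indicator (frontier \<Omega>) x :: real)"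
      using assms(1) closure_subset[of \<Omega>] by (auto simp: frontier_def interior_open indicator_def)
    finally show ?thesis .
  qed
  have "(\<lambda>j. LINT x|haar. \<psi> j x - (1 - \<phi> j x)) \<longlonglongrightarrow> (LINT x|haar. indicator (frontier \<Omega>) x)"
  proof (rule integral_dominated_convergence[where w = "\<lambda>_. 2"])
    show "AE x in haar. (\<lambda>j. \<psi> j x - (1 - \<phi> j x)) \<longlonglongrightarrow> indicator (frontier \<Omega>) x"
      using lim by simp
    show "integrable haar (\<lambda>_::'n torus. 2 :: real)" by simp
    show "AE x in haar. norm (\<psi> j x - (1 - \<phi> j x)) \<le> 2" for j
    proof (rule AE_I2)
      fix x show "norm (\<psi> j x - (1 - \<phi> j x)) \<le> 2"
        using \<psi>(2)[of j x] \<phi>(2)[of j x] unfolding real_norm_def by auto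
    qed
  qed measurable
  also have "(LINT x|haar. indicator (frontier \<Omega>) x) = (0::real)"
    using emeasure_frontier_haar[OF assms(2)] by simp
  finally have "eventually (\<lambda>j. (LINT x|haar. \<psi> j x - (1 - \<phi> j x)) < e / 2) sequentially"
    using assms(3) by (intro order_tendstoD(2)) auto
  then obtain j where j: "(LINT x|haar. \<psi> j x - (1 - \<phi> j x)) < e / 2"
    using eventually_happens trivial_limit_sequentially by blast
  \<comment> \<open>Each polynomial is off by at most \<open>d\<close> and is moved outwards by
    another \<open>d\<close>. The gap grows by \<open>4 * d = e / 2\<close>, the other half of
    \<open>e\<close> being spent on the tents.\<close>
  define d where "d = e / 8"
  have d: "0 < d" "d \<le> 1/8" using assms by (auto simp: d_def)
  obtain q where q: "trig (\<lambda>x. complex_of_real (q x))" "\<And>x. \<bar>\<psi> j x - q x\<bar> < d"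
    using trig_dense_continuous[OF \<psi>(1) d(1)] by metis
  obtain p where p: "trig (\<lambda>x. complex_of_real (p x))" "\<And>x. \<bar>(1 - \<phi> j x) - p x\<bar> < d"
    using trig_dense_continuous[OF continuous_on_diff[OF continuous_on_const \<phi>(1)] d(1)] by metis
  have sh: "trig (\<lambda>x. complex_of_real (r x + c))" if "trig (\<lambda>x. complex_of_real (r x))" for r and c
    using trig_add[OF that trig_const[of "complex_of_real c"]] by simp
  have cont: "continuous_on UNIV r" if "trig (\<lambda>x. complex_of_real (r x))" for r :: "'n torus \<Rightarrow> real"
    using continuous_on_Re[OF trig_continuous[OF that]] by simp
  show ?thesis
  proof (rule that[of "\<lambda>x. p x + (- d)" "\<lambda>x. q x + d"])
    show "p x + (- d) \<le> indicator \<Omega> x" for x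
      using p(2)[of x] \<phi>(3)[of x j] \<phi>(2)[of j x] unfolding abs_less_iff by (cases "x \<in> \<Omega>") simp_all
    show "indicator \<Omega> x \<le> q x + d" for x
    proof (cases "x \<in> \<Omega>")
      case True
      then have "x \<in> closure \<Omega>" using closure_subset by blast
      then show ?thesis using q(2)[of x] \<psi>(3)[of x j] True unfolding abs_less_iff by simp
    next
      case False
      then show ?thesis using q(2)[of x] \<psi>(2)[of j x] unfolding abs_less_iff by simp
    qed
    show "- 1 \<le> p x + (- d)" for x using p(2)[of x] \<phi>(2)[of j x] d unfolding abs_less_iff by simp
    show "q x + d \<le> 2" for x using q(2)[of x] \<psi>(2)[of j x] d unfolding abs_less_iff by simp
    have "(LINT x|haar. (q x + d) - (p x + (- d))) \<le> (LINT x|haar. (\<psi> j x - (1 - \<phi> j x)) + 4 * d)"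
    proof (rule integral_mono)
      fix x show "(q x + d) - (p x + (- d)) \<le> (\<psi> j x - (1 - \<phi> j x)) + 4 * d"
        using p(2)[of x] q(2)[of x] by linarith
    qed (intro integrable_haar_continuous continuous_intros cont[OF p(1)] cont[OF q(1)] \<psi>(1) \<phi>(1))+
    also have "\<dots> = (LINT x|haar. (\<psi> j x - (1 - \<phi> j x))) + 4 * d"
      by (subst Bochner_Integration.integral_add)
        (intro integrable_haar_continuous continuous_intros \<psi>(1) \<phi>(1), simp_all)
    also have "\<dots> < e" using j by (simp add: d_def)
    finally show "(LINT x|haar. (q x + d) - (p x + (- d))) < e" .
    show "trig (\<lambda>x. complex_of_real (p x + (- d)))" by (rule sh[OF p(1)])
    show "trig (\<lambda>x. complex_of_real (q x + d))" by (rule sh[OF q(1)])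
  qed
qed

section \<open>Fourier coefficients\<close>

text \<open>Normalised variant of \<open>torus_fourier\<close>: with respect to \<open>haar\<close>
  the characters are orthonormal, so Bessel's inequality carries no constant.\<close>

definition fcoef :: "('n::finite torus \<Rightarrow> complex) \<Rightarrow> int ^ 'n \<Rightarrow> complex" where
  "fcoef h k = (LINT x|haar. h x * torus_char (- k) x)"

lemma integrable_haar_mult_bounded:
  fixes h g :: "'n::finite torus \<Rightarrow> complex"
  assumes "integrable haar h" "g \<in> borel_measurable borel" "\<And>x. norm (g x) \<le> B"
  shows "integrable haar (\<lambda>x. h x * g x)"
proof (rule Bochner_Integration.integrable_bound)
  show "integrable haar (\<lambda>x. of_real B * h x)" using assms(1) by simp
  show "AE x in haar. norm (h x * g x) \<le> norm (of_real B * h x)"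
  proof (rule AE_I2)
    fix x
    have "norm (h x) * norm (g x) \<le> norm (h x) * \<bar>B\<bar>"
      using assms(3)[of x] by (intro mult_left_mono) auto
    then show "norm (h x * g x) \<le> norm (of_real B * h x)" by (simp add: norm_mult mult.commute)
  qed
qed (use assms in \<open>simp add: borel_measurable_integrable\<close>)

lemma cnj_measurable [measurable]: "cnj \<in> borel_measurable borel"
  by (intro borel_measurable_continuous_onI continuous_intros)

lemma integrable_haar_mult_char:
  "integrable haar h \<Longrightarrow> integrable haar (\<lambda>x. h x * torus_char k x)"
  by (rule integrable_haar_mult_bounded[of _ _ 1]) auto

lemma fcoef_add:
  "integrable haar h \<Longrightarrow> integrable haar g \<Longrightarrow> fcoef (\<lambda>x. h x + g x) k = fcoef h k + fcoef g k"
  by (simp add: fcoef_def distrib_right integrable_haar_mult_char)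

lemma fcoef_diff:
  "integrable haar h \<Longrightarrow> integrable haar g \<Longrightarrow> fcoef (\<lambda>x. h x - g x) k = fcoef h k - fcoef g k"
  by (simp add: fcoef_def left_diff_distrib integrable_haar_mult_char)

lemma fcoef_scale: "fcoef (\<lambda>x. c * h x) k = c * fcoef h k"
  by (simp add: fcoef_def mult.assoc)

lemma fcoef_char: "fcoef (torus_char l) k = (if k = l then 1 else 0)"
proof -
  have "fcoef (torus_char l) k = (LINT x|haar. torus_char (l - k) x)"
    unfolding fcoef_def by (simp add: torus_char_add_left[symmetric])
  then show ?thesis by (simp add: integral_torus_char)
qed

lemma integral_mult_char: "(LINT x|haar. h x * torus_char k x) = fcoef h (- k)"
  by (simp add: fcoef_def)

lemma fcoef_translate:
  assumes [measurable]: "h \<in> borel_measurable borel"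
  shows "fcoef (\<lambda>x. h (x + c)) k = torus_char k c * fcoef h k"
proof -
  have "fcoef (\<lambda>x. h (x + c)) k = (LINT x|haar. torus_char k c * (h (c + x) * torus_char (- k) (c + x)))"
    unfolding fcoef_def
    by (intro Bochner_Integration.integral_cong)
      (auto simp: torus_char_add torus_char_uminus add.commute[of c] mult_ac)
  also have "\<dots> = torus_char k c * (LINT x|haar. h (c + x) * torus_char (- k) (c + x))"
    by simp
  also have "(LINT x|haar. h (c + x) * torus_char (- k) (c + x)) = fcoef h k"
    unfolding fcoef_def by (rule integral_haar_translate) measurable
  finally show ?thesis .
qed

lemma integrable_norm_sq_imp_integrable:
  fixes h :: "'n::finite torus \<Rightarrow> complex"
  assumes [measurable]: "h \<in> borel_measurable borel" and "integrable haar (\<lambda>x. (norm (h x))\<^sup>2)"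
  shows "integrable haar h"
proof (rule Bochner_Integration.integrable_bound)
  show "integrable haar (\<lambda>x. 1 + (norm (h x))\<^sup>2)" using assms(2) by simp
  have "norm (h x) \<le> 1 + (norm (h x))\<^sup>2" for x
    by (metis (no_types) add.commute add_increasing2 le_cases norm_ge_zero one_le_power
        power2_eq_square mult_left_mono mult.right_neutral add_increasing zero_le_one zero_le_power2)
  then show "AE x in haar. norm (h x) \<le> norm (1 + (norm (h x))\<^sup>2)" by (auto intro!: AE_I2)
qed simp

text \<open>With \<open>s\<close> the partial Fourier sum over \<open>K\<close>, the integrals of
  \<open>h * cnj s\<close>, \<open>cnj h * s\<close> and \<open>s * cnj s\<close> all equal the sum
  of squares. Expanding the nonnegative integral of the squared norm of \<open>h - s\<close> gives
  the claim.\<close>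

lemma bessel_inequality:
  fixes h :: "'n::finite torus \<Rightarrow> complex"
  assumes [measurable]: "h \<in> borel_measurable borel" and sq: "integrable haar (\<lambda>x. (norm (h x))\<^sup>2)"
    and K: "finite K"
  shows "(\<Sum>k\<in>K. (norm (fcoef h k))\<^sup>2) \<le> (LINT x|haar. (norm (h x))\<^sup>2)"
proof -
  let ?S = "\<Sum>k\<in>K. (norm (fcoef h k))\<^sup>2"
  define s where "s x = (\<Sum>k\<in>K. fcoef h k * torus_char k x)" for x
  have h: "integrable haar h" by (rule integrable_norm_sq_imp_integrable[OF assms(1) sq])
  have s_cont: "continuous_on UNIV s" unfolding s_def by (intro continuous_intros)
  have [measurable]: "s \<in> borel_measurable borel" using s_cont by (rule borel_measurable_continuous_onI)
  obtain B where B: "\<And>x. norm (s x) \<le> B" using continuous_torus_bounded[OF s_cont] by blast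
  have int: "integrable haar (\<lambda>x. g x * cnj (s x))" if "integrable haar g" for g
    by (rule integrable_haar_mult_bounded[OF that, of _ B]) (measurable, simp add: B)
  have against: "(LINT x|haar. g x * cnj (s x)) = (\<Sum>k\<in>K. cnj (fcoef h k) * fcoef g k)"
    if "integrable haar g" for g
  proof -
    have "(LINT x|haar. g x * cnj (s x))
        = (LINT x|haar. (\<Sum>k\<in>K. cnj (fcoef h k) * (g x * torus_char (- k) x)))"
      by (intro Bochner_Integration.integral_cong)
        (auto simp: s_def sum_distrib_left torus_char_uminus mult_ac)
    also have "\<dots> = (\<Sum>k\<in>K. cnj (fcoef h k) * fcoef g k)"
      using that by (subst Bochner_Integration.integral_sum) (auto simp: fcoef_def integrable_haar_mult_char)
    finally show ?thesis .
  qed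
  have fs: "fcoef s k = (if k \<in> K then fcoef h k else 0)" for k
  proof -
    have "fcoef s k = (\<Sum>l\<in>K. fcoef h l * (LINT x|haar. torus_char l x * torus_char (- k) x))"
      unfolding fcoef_def[of s] s_def sum_distrib_right mult.assoc
      by (subst Bochner_Integration.integral_sum)
        (auto intro!: integrable_haar_continuous continuous_intros)
    also have "\<dots> = (\<Sum>l\<in>K. if l = k then fcoef h l else 0)"
      unfolding fcoef_def[symmetric] fcoef_char by (intro sum.cong) auto
    finally show ?thesis using K by simp
  qed
  have hs: "(LINT x|haar. h x * cnj (s x)) = of_real ?S"
    by (subst against[OF h]) (simp add: complex_norm_square mult.commute del: of_real_power)
  have ss: "(LINT x|haar. s x * cnj (s x)) = of_real ?S"
    by (subst against)
      (auto simp: fs complex_norm_square mult.commute simp del: of_real_power intro!: integrable_haar_continuous s_cont)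
  have sh: "(LINT x|haar. cnj (h x) * s x) = of_real ?S"
  proof -
    have "(LINT x|haar. cnj (h x) * s x) = cnj (LINT x|haar. h x * cnj (s x))"
      using integral_bounded_linear[OF bounded_linear_cnj int[OF h]] by simp
    then show ?thesis by (simp add: hs)
  qed
  have i1: "integrable haar (\<lambda>x. complex_of_real ((norm (h x))\<^sup>2))"
    using sq by (rule integrable_of_real)
  have i4: "integrable haar (\<lambda>x. cnj (h x) * s x)"
    using h by (intro integrable_haar_mult_bounded[of _ _ B]) (auto simp: B)
  have i3: "integrable haar (\<lambda>x. s x * cnj (s x))"
    by (intro integrable_haar_continuous continuous_intros s_cont)
  have "complex_of_real (LINT x|haar. (norm (h x - s x))\<^sup>2) = (LINT x|haar. complex_of_real ((norm (h x - s x))\<^sup>2))"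
    by (rule integral_complex_of_real[symmetric])
  also have "\<dots> = (LINT x|haar. complex_of_real ((norm (h x))\<^sup>2) - h x * cnj (s x) - cnj (h x) * s x + s x * cnj (s x))"
    by (intro Bochner_Integration.integral_cong) (auto simp: complex_norm_square algebra_simps simp del: of_real_power)
  also have "\<dots> = of_real (LINT x|haar. (norm (h x))\<^sup>2) - of_real ?S - of_real ?S + of_real ?S"
    using i1 int[OF h] i3 i4 by (simp add: hs ss sh del: of_real_power)
  finally have "complex_of_real (LINT x|haar. (norm (h x - s x))\<^sup>2) = of_real ((LINT x|haar. (norm (h x))\<^sup>2) - ?S)"
    by simp
  then have "(LINT x|haar. (norm (h x - s x))\<^sup>2) = (LINT x|haar. (norm (h x))\<^sup>2) - ?S"
    by (simp only: of_real_eq_iff)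
  moreover have "0 \<le> (LINT x|haar. (norm (h x - s x))\<^sup>2)" by (intro integral_nonneg_AE) auto
  ultimately show ?thesis by simp
qed

text \<open>Cauchy-Schwarz and Bessel for both factors. The asymmetric bound, supremum for
  \<open>u\<close> and mean square for \<open>h\<close>, fits its use in
  \<open>parseval_P_pow\<close>, where \<open>u\<close> is fixed and \<open>h\<close> is a small
  remainder. Coefficient \<open>- k\<close> is paired with \<open>k\<close> because the integral of
  \<open>u * h\<close> involves no conjugation.\<close>

lemma sum_norm_fcoef_mult_le:
  fixes u h :: "'n::finite torus \<Rightarrow> complex"
  assumes "u \<in> borel_measurable borel" "\<And>x. norm (u x) \<le> B"
    "h \<in> borel_measurable borel" "\<And>x. norm (h x) \<le> C" "finite K"
  shows "(\<Sum>k\<in>K. norm (fcoef u (- k)) * norm (fcoef h k)) \<le> B * sqrt (LINT x|haar. (norm (h x))\<^sup>2)"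
proof -
  have B: "0 \<le> B" using assms(2)[of 0] norm_ge_zero order_trans by blast
  have sq: "integrable haar (\<lambda>x. (norm (u x))\<^sup>2)"
    using assms(1,2) by (intro integrable_haar_bounded[where B = "B\<^sup>2"]) (auto intro: power_mono)
  have sq': "integrable haar (\<lambda>x. (norm (h x))\<^sup>2)"
    using assms(3,4) by (intro integrable_haar_bounded[where B = "C\<^sup>2"]) (auto intro: power_mono)
  have "(\<Sum>k\<in>K. (norm (fcoef u (- k)))\<^sup>2) = (\<Sum>k\<in>uminus ` K. (norm (fcoef u k))\<^sup>2)"
    by (subst sum.reindex) (auto simp: inj_on_def)
  also have "\<dots> \<le> (LINT x|haar. (norm (u x))\<^sup>2)"
    using assms(5) by (intro bessel_inequality assms(1) sq) auto
  also have "\<dots> \<le> (LINT x|(haar :: 'n torus measure). B\<^sup>2)"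
    using assms(2) by (intro integral_mono') (auto intro: power_mono)
  finally have "sqrt (\<Sum>k\<in>K. (norm (fcoef u (- k)))\<^sup>2) \<le> B"
    using B by (intro real_le_lsqrt) (auto intro: sum_nonneg)
  moreover have "sqrt (\<Sum>k\<in>K. (norm (fcoef h k))\<^sup>2) \<le> sqrt (LINT x|haar. (norm (h x))\<^sup>2)"
    using bessel_inequality[OF assms(3) sq' assms(5)] by simp
  ultimately have "L2_set (\<lambda>k. norm (fcoef u (- k))) K * L2_set (\<lambda>k. norm (fcoef h k)) K
      \<le> B * sqrt (LINT x|haar. (norm (h x))\<^sup>2)"
    unfolding L2_set_def using B by (intro mult_mono) (auto intro: sum_nonneg)
  moreover have "(\<Sum>k\<in>K. norm (fcoef u (- k)) * norm (fcoef h k))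
      \<le> L2_set (\<lambda>k. norm (fcoef u (- k))) K * L2_set (\<lambda>k. norm (fcoef h k)) K"
    using L2_set_mult_ineq[of "\<lambda>k. norm (fcoef u (- k))" "\<lambda>k. norm (fcoef h k)" K] by simp
  ultimately show ?thesis by linarith
qed

lemma fcoef_mult_abs_summable:
  fixes u h :: "'n::finite torus \<Rightarrow> complex"
  assumes "u \<in> borel_measurable borel" "\<And>x. norm (u x) \<le> B"
    "h \<in> borel_measurable borel" "\<And>x. norm (h x) \<le> C"
  shows "(\<lambda>k. norm (fcoef u (- k) * fcoef h k)) summable_on UNIV"
proof (subst abs_summable_iff_bdd_above, rule bdd_aboveI2)
  fix F :: "(int ^ 'n) set" assume "F \<in> {F. F \<subseteq> UNIV \<and> finite F}"
  then show "(\<Sum>k\<in>F. norm (fcoef u (- k) * fcoef h k)) \<le> B * sqrt (LINT x|haar. (norm (h x))\<^sup>2)"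
    using sum_norm_fcoef_mult_le[OF assms, of F] by (simp add: norm_mult)
qed

section \<open>Functions approximable by bounded trigonometric polynomials\<close>

text \<open>One constant \<open>C\<close> bounds \<open>h\<close> and all its approximants.
  Convergence in mean alone is not stable under products; together with a uniform bound it is, and
  it also yields approximation in mean square.\<close>

definition trig_approx :: "('n::finite torus \<Rightarrow> complex) \<Rightarrow> bool" where
  "trig_approx h \<longleftrightarrow> h \<in> borel_measurable borel \<and>
     (\<exists>C. (\<forall>x. norm (h x) \<le> C) \<and>
       (\<forall>e>0. \<exists>p. trig p \<and> (\<forall>x. norm (p x) \<le> C) \<and> (LINT x|haar. norm (h x - p x)) < e))"

lemma trig_approxI:
  assumes "h \<in> borel_measurable borel" "\<And>x. norm (h x) \<le> C"
    "\<And>e. 0 < e \<Longrightarrow> \<exists>p. trig p \<and> (\<forall>x. norm (p x) \<le> C) \<and> (LINT x|haar. norm (h x - p x)) < e"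
  shows "trig_approx h"
  using assms unfolding trig_approx_def by blast

lemma trig_approxE:
  assumes "trig_approx h"
  obtains C where "1 \<le> C" "\<And>x. norm (h x) \<le> C"
    "\<And>e. 0 < e \<Longrightarrow> \<exists>p. trig p \<and> (\<forall>x. norm (p x) \<le> C) \<and> (LINT x|haar. norm (h x - p x)) < e"
proof -
  obtain C where C: "\<And>x. norm (h x) \<le> C"
    "\<And>e. 0 < e \<Longrightarrow> \<exists>p. trig p \<and> (\<forall>x. norm (p x) \<le> C) \<and> (LINT x|haar. norm (h x - p x)) < e"
    using assms unfolding trig_approx_def by blast
  have le: "norm (y :: complex) \<le> C \<Longrightarrow> norm y \<le> max 1 C" for y by simp
  show ?thesis
    using C(2) by (intro that[of "max 1 C"] le C(1)) (fastforce simp: le)+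
qed

lemma trig_approx_bounded: "trig_approx h \<Longrightarrow> \<exists>B. \<forall>x. norm (h x) \<le> B"
  unfolding trig_approx_def by blast

lemma trig_approx_measurable: "trig_approx h \<Longrightarrow> h \<in> borel_measurable borel"
  by (simp add: trig_approx_def)

lemma trig_approx_integrable: "trig_approx h \<Longrightarrow> integrable haar h"
  by (metis integrable_haar_bounded trig_approx_def)

lemma integrable_trig: "trig p \<Longrightarrow> integrable haar p"
  by (intro integrable_haar_continuous trig_continuous)

lemma trig_approx_trig:
  assumes "trig p"
  shows "trig_approx p"
proof -
  obtain B where "\<And>x. norm (p x) \<le> B"
    using continuous_torus_bounded[OF trig_continuous[OF assms]] by blast
  then show ?thesis
    using assms by (intro trig_approxI[of _ B] trig_measurable) (auto intro!: exI[of _ p])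
qed

lemma trig_approx_mult:
  assumes "trig_approx h" "trig_approx g"
  shows "trig_approx (\<lambda>x. h x * g x)"
proof -
  obtain C where C: "1 \<le> C" "\<And>x. norm (h x) \<le> C"
    "\<And>e. 0 < e \<Longrightarrow> \<exists>p. trig p \<and> (\<forall>x. norm (p x) \<le> C) \<and> (LINT x|haar. norm (h x - p x)) < e"
    using assms(1) by (rule trig_approxE) blast
  obtain D where D: "1 \<le> D" "\<And>x. norm (g x) \<le> D"
    "\<And>e. 0 < e \<Longrightarrow> \<exists>p. trig p \<and> (\<forall>x. norm (p x) \<le> D) \<and> (LINT x|haar. norm (g x - p x)) < e"
    using assms(2) by (rule trig_approxE) blast
  note [measurable] = trig_approx_measurable[OF assms(1)] trig_approx_measurable[OF assms(2)]
  show ?thesis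
  proof (rule trig_approxI[where C = "C * D"])
    show "norm (h x * g x) \<le> C * D" for x
      using C(1) C(2)[of x] D(2)[of x] by (auto simp: norm_mult intro!: mult_mono)
    fix e :: real assume e: "0 < e"
    obtain p where p: "trig p" "\<forall>x. norm (p x) \<le> C" "(LINT x|haar. norm (h x - p x)) < e / (2 * D)"
      using C(3)[of "e / (2 * D)"] e D by auto
    obtain q where q: "trig q" "\<forall>x. norm (q x) \<le> D" "(LINT x|haar. norm (g x - q x)) < e / (2 * C)"
      using D(3)[of "e / (2 * C)"] e C by auto
    note [simp] = trig_approx_integrable[OF assms(1)] trig_approx_integrable[OF assms(2)]
      integrable_trig[OF p(1)] integrable_trig[OF q(1)]
    have "(LINT x|haar. norm (h x * g x - p x * q x))
        \<le> (LINT x|haar. D * norm (h x - p x) + C * norm (g x - q x))"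
    proof (rule integral_mono')
      fix x
      have "h x * g x - p x * q x = (h x - p x) * g x + p x * (g x - q x)" by (simp add: algebra_simps)
      then have "norm (h x * g x - p x * q x) \<le> norm (h x - p x) * norm (g x) + norm (p x) * norm (g x - q x)"
        by (metis norm_mult norm_triangle_ineq)
      also have "\<dots> \<le> norm (h x - p x) * D + C * norm (g x - q x)"
        using D(2) p(2) by (intro add_mono mult_mono) (auto intro: order_trans[OF norm_ge_zero])
      finally show "norm (h x * g x - p x * q x) \<le> D * norm (h x - p x) + C * norm (g x - q x)"
        by (simp add: mult.commute)
    qed (use C D in auto)
    also have "\<dots> = D * (LINT x|haar. norm (h x - p x)) + C * (LINT x|haar. norm (g x - q x))"
      by simp
    also have "\<dots> < D * (e / (2 * D)) + C * (e / (2 * C))"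
      using p(3) q(3) C D by (intro add_strict_mono mult_strict_left_mono) auto
    also have "\<dots> = e" using C D by simp
    finally show "\<exists>p. trig p \<and> (\<forall>x. norm (p x) \<le> C * D) \<and> (LINT x|haar. norm (h x * g x - p x)) < e"
      using p q C D
      by (intro exI[of _ "\<lambda>x. p x * q x"])
        (auto simp: trig_mult norm_mult intro!: mult_mono intro: order_trans[OF norm_ge_zero])
  qed measurable
qed

lemma trig_approx_diff:
  assumes "trig_approx h" "trig_approx g"
  shows "trig_approx (\<lambda>x. h x - g x)"
proof -
  obtain C where C: "1 \<le> C" "\<And>x. norm (h x) \<le> C"
    "\<And>e. 0 < e \<Longrightarrow> \<exists>p. trig p \<and> (\<forall>x. norm (p x) \<le> C) \<and> (LINT x|haar. norm (h x - p x)) < e"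
    using assms(1) by (rule trig_approxE) blast
  obtain D where D: "1 \<le> D" "\<And>x. norm (g x) \<le> D"
    "\<And>e. 0 < e \<Longrightarrow> \<exists>p. trig p \<and> (\<forall>x. norm (p x) \<le> D) \<and> (LINT x|haar. norm (g x - p x)) < e"
    using assms(2) by (rule trig_approxE) blast
  note [measurable] = trig_approx_measurable[OF assms(1)] trig_approx_measurable[OF assms(2)]
  have tri: "norm (a - b) \<le> C + D" if "norm a \<le> C" "norm b \<le> D" for a b :: complex
    using norm_triangle_ineq4[of a b] that by linarith
  show ?thesis
  proof (rule trig_approxI[where C = "C + D"])
    show "norm (h x - g x) \<le> C + D" for x by (intro tri C D)
    fix e :: real assume e: "0 < e"
    obtain p where p: "trig p" "\<forall>x. norm (p x) \<le> C" "(LINT x|haar. norm (h x - p x)) < e / 2"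
      using C(3)[of "e / 2"] e by auto
    obtain q where q: "trig q" "\<forall>x. norm (q x) \<le> D" "(LINT x|haar. norm (g x - q x)) < e / 2"
      using D(3)[of "e / 2"] e by auto
    note [simp] = trig_approx_integrable[OF assms(1)] trig_approx_integrable[OF assms(2)]
      integrable_trig[OF p(1)] integrable_trig[OF q(1)]
    have "(LINT x|haar. norm ((h x - g x) - (p x + (-1) * q x)))
        \<le> (LINT x|haar. norm (h x - p x) + norm (g x - q x))"
    proof (rule integral_mono')
      fix x
      have "(h x - g x) - (p x + (-1) * q x) = (h x - p x) - (g x - q x)" by simp
      then show "norm ((h x - g x) - (p x + (-1) * q x)) \<le> norm (h x - p x) + norm (g x - q x)"
        by (metis norm_triangle_ineq4)
    qed auto
    also have "\<dots> < e" using p(3) q(3) by simp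
    finally show "\<exists>p. trig p \<and> (\<forall>x. norm (p x) \<le> C + D) \<and> (LINT x|haar. norm (h x - g x - p x)) < e"
      using p(1,2) q(1,2) tri
      by (intro exI[of _ "\<lambda>x. p x + (-1) * q x"] conjI trig_add trig_scale) auto
  qed measurable
qed

lemma trig_approx_translate:
  assumes "trig_approx h"
  shows "trig_approx (\<lambda>x. h (x + c))"
proof -
  obtain C where C: "1 \<le> C" "\<And>x. norm (h x) \<le> C"
    "\<And>e. 0 < e \<Longrightarrow> \<exists>p. trig p \<and> (\<forall>x. norm (p x) \<le> C) \<and> (LINT x|haar. norm (h x - p x)) < e"
    using assms(1) by (rule trig_approxE) blast
  note [measurable] = trig_approx_measurable[OF assms(1)]
  have tr: "trig (\<lambda>x. p (x + c))" if "trig p" for p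
    using that
  proof induction
    case (trig_char k)
    show ?case using trig_scale[OF trig.trig_char[of k], of "torus_char k c"]
      by (simp add: torus_char_add mult.commute)
  qed (auto intro: trig.intros)
  show ?thesis
  proof (rule trig_approxI[where C = C])
    have "(\<lambda>x. h (c + x)) \<in> borel_measurable borel" by measurable
    then show "(\<lambda>x. h (x + c)) \<in> borel_measurable borel" by (simp add: add.commute)
    fix e :: real assume e: "0 < e"
    obtain p where p: "trig p" "\<forall>x. norm (p x) \<le> C" "(LINT x|haar. norm (h x - p x)) < e"
      using C(3)[of "e"] e by auto
    note [measurable] = trig_measurable[OF p(1)]
    have "(LINT x|haar. norm (h (c + x) - p (c + x))) = (LINT x|haar. norm (h x - p x))"
      by (rule integral_haar_translate) measurable
    with p tr[OF p(1)] show "\<exists>p. trig p \<and> (\<forall>x. norm (p x) \<le> C) \<and> (LINT x|haar. norm (h (x + c) - p x)) < e"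
      by (intro exI[of _ "\<lambda>x. p (x + c)"]) (auto simp: add.commute)
  qed (use C in auto)
qed

text \<open>Completeness of the characters. Such an \<open>h\<close> is orthogonal to every
  trigonometric polynomial \<open>p\<close>, so the integral of its squared norm equals that of
  \<open>h * cnj (h - p)\<close>, which is at most \<open>C\<close> times the error of
  \<open>p\<close> in mean.\<close>

lemma trig_approx_fcoef_zero:
  assumes "trig_approx h" "\<And>k. fcoef h k = 0"
  shows "AE x in haar. h x = 0"
proof -
  obtain C where C: "1 \<le> C" "\<And>x. norm (h x) \<le> C"
    "\<And>e. 0 < e \<Longrightarrow> \<exists>p. trig p \<and> (\<forall>x. norm (p x) \<le> C) \<and> (LINT x|haar. norm (h x - p x)) < e"
    using assms(1) by (rule trig_approxE) blast
  note [measurable] = trig_approx_measurable[OF assms(1)]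
  have h: "integrable haar h" by (rule trig_approx_integrable[OF assms(1)])
  have orth: "integrable haar (\<lambda>x. h x * cnj (p x)) \<and> (LINT x|haar. h x * cnj (p x)) = 0" if "trig p" for p
    using that
  proof induction
    case (trig_char k)
    then show ?case using assms(2)[of k] integrable_haar_mult_char[OF h, of "- k"]
      by (simp add: fcoef_def torus_char_uminus)
  qed (simp_all add: distrib_left mult.left_commute)
  have sq: "integrable haar (\<lambda>x. (norm (h x))\<^sup>2)"
    using C by (intro integrable_haar_bounded[where B = "C\<^sup>2"]) (auto intro: power_mono)
  have "(LINT x|haar. (norm (h x))\<^sup>2) \<le> e" if "0 < e" for e
  proof -
    have "0 < e / C" using that C(1) by (intro divide_pos_pos) auto
    then obtain p where p: "trig p" "\<forall>x. norm (p x) \<le> C" "(LINT x|haar. norm (h x - p x)) < e / C"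
      using C(3) by blast
    note [measurable] = trig_measurable[OF p(1)]
    have "norm (cnj (h x - p x)) \<le> C + C" for x
      using norm_triangle_ineq4[of "h x" "p x"] C(2)[of x] p(2)[rule_format, of x]
      by (simp only: complex_mod_cnj)
    then have i: "integrable haar (\<lambda>x. h x * cnj (h x - p x))"
      using h by (intro integrable_haar_mult_bounded[where B = "C + C"]) simp_all
    have "complex_of_real (LINT x|haar. (norm (h x))\<^sup>2) = (LINT x|haar. complex_of_real ((norm (h x))\<^sup>2))"
      by (rule integral_complex_of_real[symmetric])
    also have "\<dots> = (LINT x|haar. h x * cnj (h x - p x) + h x * cnj (p x))"
      by (intro Bochner_Integration.integral_cong) (auto simp: complex_norm_square algebra_simps simp del: of_real_power)
    also have "\<dots> = (LINT x|haar. h x * cnj (h x - p x))"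
      using i orth[OF p(1)] by (subst Bochner_Integration.integral_add) auto
    finally have "(LINT x|haar. (norm (h x))\<^sup>2) = Re (LINT x|haar. h x * cnj (h x - p x))"
      by (metis Re_complex_of_real)
    also have "\<dots> \<le> norm (LINT x|haar. h x * cnj (h x - p x))" by (rule complex_Re_le_cmod)
    also have "\<dots> \<le> (LINT x|haar. norm (h x * cnj (h x - p x)))" by (rule integral_norm_bound)
    also have "\<dots> \<le> (LINT x|haar. C * norm (h x - p x))"
      using C h integrable_trig[OF p(1)]
      by (intro integral_mono') (auto simp: norm_mult complex_mod_cnj[of "_ - _", simplified] intro!: mult_right_mono)
    also have "\<dots> \<le> e" using p(3) C(1) by (simp add: field_simps)
    finally show ?thesis .
  qed
  then have "(LINT x|haar. (norm (h x))\<^sup>2) \<le> 0" by (rule field_le_epsilon) simp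
  moreover have "0 \<le> (LINT x|haar. (norm (h x))\<^sup>2)" by (intro integral_nonneg_AE) auto
  ultimately have "(LINT x|haar. (norm (h x))\<^sup>2) = 0" by linarith
  then show ?thesis using integral_nonneg_eq_0_iff_AE[OF sq] by auto
qed

definition torus_indicator :: "'n::finite torus set \<Rightarrow> 'n torus \<Rightarrow> complex" where
  "torus_indicator \<Omega> x = complex_of_real (indicator \<Omega> x)"

text \<open>The point is the error majorant \<open>g\<close>: being a trigonometric polynomial, it
  has averages along a generic path that are known to converge. A small error in mean would give no
  control on one path.\<close>

lemma indicator_approx:
  fixes \<Omega> :: "'n::finite torus set"
  assumes "open \<Omega>" "emeasure torus_lebesgue (frontier \<Omega>) = 0" "0 < e"
  obtains p and g :: "'n torus \<Rightarrow> real"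
  where "trig p" "\<And>x. norm (p x) \<le> 2" "trig (\<lambda>x. complex_of_real (g x))"
    "\<And>x. norm (torus_indicator \<Omega> x - p x) \<le> g x" "(LINT x|haar. g x) < e"
proof -
  obtain p q :: "'n torus \<Rightarrow> real" where pq: "trig (\<lambda>x. complex_of_real (p x))" "trig (\<lambda>x. complex_of_real (q x))"
    "\<And>x. p x \<le> indicator \<Omega> x" "\<And>x. indicator \<Omega> x \<le> q x" "\<And>x. - 1 \<le> p x" "\<And>x. q x \<le> 2"
    "(LINT x|haar. q x - p x) < min e 1"
    by (rule null_frontier_sandwich[OF assms(1,2), of "min e 1"]) (use assms(3) in simp_all)
  show ?thesis
  proof (rule that[of "\<lambda>x. complex_of_real (p x)" "\<lambda>x. q x - p x"])
    show "trig (\<lambda>x. complex_of_real (q x - p x))"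
      using trig_add[OF pq(2) trig_scale[OF pq(1), of "-1"]] by simp
    show "norm (complex_of_real (p x)) \<le> 2" for x
      unfolding norm_of_real using pq(3)[of x] pq(5)[of x] indicator_le_1[of \<Omega> x, where ?'a = real] by linarith
    show "norm (torus_indicator \<Omega> x - complex_of_real (p x)) \<le> q x - p x" for x
      unfolding torus_indicator_def of_real_diff[symmetric] norm_of_real
      using pq(3)[of x] pq(4)[of x] by simp
  qed (use pq in simp_all)
qed

lemma norm_torus_indicator: "norm (torus_indicator \<Omega> x) \<le> 1"
  by (simp add: torus_indicator_def indicator_def)

lemma trig_approx_torus_indicator:
  fixes \<Omega> :: "'n::finite torus set"
  assumes "open \<Omega>" "emeasure torus_lebesgue (frontier \<Omega>) = 0"
  shows "trig_approx (torus_indicator \<Omega>)"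
proof (rule trig_approxI[where C = 2])
  have [measurable]: "\<Omega> \<in> sets borel" using assms(1) by (rule borel_open)
  show m: "torus_indicator \<Omega> \<in> borel_measurable borel" unfolding torus_indicator_def by measurable
  show "norm (torus_indicator \<Omega> x) \<le> 2" for x using norm_torus_indicator[of \<Omega> x] by linarith
  fix e :: real assume "0 < e"
  obtain p and g :: "'n torus \<Rightarrow> real" where pg: "trig p" "\<And>x. norm (p x) \<le> 2"
    "trig (\<lambda>x. complex_of_real (g x))" "\<And>x. norm (torus_indicator \<Omega> x - p x) \<le> g x" "(LINT x|haar. g x) < e"
    by (rule indicator_approx[OF assms \<open>0 < e\<close>], rule that)
  have "(LINT x|haar. norm (torus_indicator \<Omega> x - p x)) \<le> (LINT x|haar. g x)"
    using integrable_Re[OF integrable_trig[OF pg(3)]] order_trans[OF norm_ge_zero pg(4)]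
    by (intro integral_mono' pg(4)) simp_all
  also have "\<dots> < e" by (rule pg(5))
  finally show "\<exists>p. trig p \<and> (\<forall>x. norm (p x) \<le> 2) \<and> (LINT x|haar. norm (torus_indicator \<Omega> x - p x)) < e"
    using pg(1,2) by blast
qed

lemma fcoef_torus_indicator_uminus: "fcoef (torus_indicator \<Omega>) (- k) = cnj (fcoef (torus_indicator \<Omega>) k)"
proof -
  have "cnj (fcoef (torus_indicator \<Omega>) k) = (LINT x|haar. cnj (torus_indicator \<Omega> x * torus_char (- k) x))"
    unfolding fcoef_def by (rule Bochner_Integration.integral_cnj[symmetric])
  also have "\<dots> = fcoef (torus_indicator \<Omega>) (- k)"
    unfolding fcoef_def by (simp add: torus_indicator_def torus_char_uminus)
  finally show ?thesis by simp
qed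

section \<open>The convolution operator of a random walk\<close>

locale torus_walk = prob_space \<mu>
  for \<mu> :: "'n::finite torus measure" +
  assumes sets_walk [measurable_cong, simp]: "sets \<mu> = sets borel"
begin

lemma space_walk [simp]: "space \<mu> = UNIV"
  using sets_eq_imp_space_eq[OF sets_walk] by simp

definition P :: "('n torus \<Rightarrow> complex) \<Rightarrow> 'n torus \<Rightarrow> complex" where
  "P h x = (LINT y|\<mu>. h (x + y))"

definition ev :: "int ^ 'n \<Rightarrow> complex" where
  "ev k = (LINT y|\<mu>. torus_char k y)"

lemma integrable_walk_bounded:
  fixes h :: "'n torus \<Rightarrow> complex"
  assumes "h \<in> borel_measurable borel" "\<And>x. norm (h x) \<le> B"
  shows "integrable \<mu> h"
  using assms by (intro integrable_const_bound[of _ B]) auto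

lemma integrable_walk_translate:
  fixes h :: "'n torus \<Rightarrow> complex"
  assumes [measurable]: "h \<in> borel_measurable borel" and "\<And>x. norm (h x) \<le> B"
  shows "integrable \<mu> (\<lambda>y. h (x + y))"
  using assms(2) by (intro integrable_walk_bounded[of _ B]) measurable

lemma P_measurable [measurable (raw)]:
  assumes [measurable]: "h \<in> borel_measurable borel"
  shows "P h \<in> borel_measurable borel"
  unfolding P_def by measurable

lemma norm_walk_integral_le:
  fixes h :: "'n torus \<Rightarrow> complex"
  assumes "\<And>y. norm (h y) \<le> B"
  shows "norm (LINT y|\<mu>. h y) \<le> B"
proof -
  have "0 \<le> B" using assms[of 0] norm_ge_zero order_trans by blast
  have "norm (LINT y|\<mu>. h y) \<le> (LINT y|\<mu>. norm (h y))" by (rule integral_norm_bound)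
  also have "\<dots> \<le> (LINT y|\<mu>. B)"
    using assms \<open>0 \<le> B\<close> by (intro integral_mono') auto
  also have "\<dots> = B" using prob_space by simp
  finally show ?thesis .
qed

lemma norm_P_le: "(\<And>x. norm (h x) \<le> B) \<Longrightarrow> norm (P h x) \<le> B"
  unfolding P_def by (rule norm_walk_integral_le)

lemma norm_ev_le: "norm (ev k) \<le> 1"
  unfolding ev_def by (rule norm_walk_integral_le) simp

lemma ev_0 [simp]: "ev 0 = 1"
  using prob_space by (simp add: ev_def)

lemma ev_uminus: "ev (- k) = cnj (ev k)"
  by (simp add: ev_def torus_char_uminus)

lemma P_char: "P (torus_char k) = (\<lambda>x. ev k * torus_char k x)"
  by (simp add: P_def ev_def torus_char_add fun_eq_iff mult.commute)

lemma P_add: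
  assumes "h \<in> borel_measurable borel" "\<And>x. norm (h x) \<le> B"
    "g \<in> borel_measurable borel" "\<And>x. norm (g x) \<le> C"
  shows "P (\<lambda>x. h x + g x) = (\<lambda>x. P h x + P g x)"
  unfolding P_def using integrable_walk_translate[OF assms(1,2)] integrable_walk_translate[OF assms(3,4)]
  by (simp add: fun_eq_iff)

lemma P_diff:
  assumes "h \<in> borel_measurable borel" "\<And>x. norm (h x) \<le> B"
    "g \<in> borel_measurable borel" "\<And>x. norm (g x) \<le> C"
  shows "P (\<lambda>x. h x - g x) = (\<lambda>x. P h x - P g x)"
  unfolding P_def using integrable_walk_translate[OF assms(1,2)] integrable_walk_translate[OF assms(3,4)]
  by (simp add: fun_eq_iff)

lemma P_scale: "P (\<lambda>x. c * h x) = (\<lambda>x. c * P h x)"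
  by (simp add: P_def fun_eq_iff)

text \<open>An \<open>L\<^sup>1\<close> contraction, by Fubini and invariance of Haar measure.\<close>

lemma integral_norm_P_le:
  assumes [measurable]: "h \<in> borel_measurable borel" and B: "\<And>x. norm (h x) \<le> B"
  shows "(LINT x|haar. norm (P h x)) \<le> (LINT x|haar. norm (h x))"
proof -
  interpret pair_sigma_finite haar \<mu> ..
  have h: "integrable haar h" using assms by (rule integrable_haar_bounded)
  have Ph: "integrable haar (P h)"
    by (rule integrable_haar_bounded[of _ B]) (measurable, rule norm_P_le[OF B])
  have m: "(\<lambda>z. ennreal (norm (h (fst z + snd z)))) \<in> borel_measurable (haar \<Otimes>\<^sub>M \<mu>)"
    by measurable
  have "ennreal (LINT x|haar. norm (P h x)) = (\<integral>\<^sup>+x. ennreal (norm (P h x)) \<partial>haar)"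
    using Ph by (intro nn_integral_eq_integral[symmetric]) auto
  also have "\<dots> \<le> (\<integral>\<^sup>+x. (\<integral>\<^sup>+y. ennreal (norm (h (x + y))) \<partial>\<mu>) \<partial>haar)"
    unfolding P_def
    by (intro nn_integral_mono integral_norm_bound_ennreal integrable_walk_translate[OF assms])
  also have "\<dots> = (\<integral>\<^sup>+y. (\<integral>\<^sup>+x. ennreal (norm (h (x + y))) \<partial>haar) \<partial>\<mu>)"
    using Fubini'[of "\<lambda>x y. ennreal (norm (h (x + y)))"] m by (simp add: case_prod_beta)
  also have "\<dots> = (\<integral>\<^sup>+y. (\<integral>\<^sup>+x. ennreal (norm (h x)) \<partial>haar) \<partial>\<mu>)"
  proof (rule nn_integral_cong)
    fix y
    show "(\<integral>\<^sup>+x. ennreal (norm (h (x + y))) \<partial>haar) = (\<integral>\<^sup>+x. ennreal (norm (h x)) \<partial>haar)"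
      using nn_integral_haar_translate[of "\<lambda>x. ennreal (norm (h x))" y] by (simp add: add.commute)
  qed
  also have "\<dots> = (\<integral>\<^sup>+x. ennreal (norm (h x)) \<partial>haar)" using emeasure_space_1 by simp
  also have "\<dots> = ennreal (LINT x|haar. norm (h x))"
    using h by (intro nn_integral_eq_integral) auto
  finally show ?thesis by (simp add: integral_nonneg_AE)
qed

lemma trig_P: "trig p \<Longrightarrow> trig (P p)"
proof (induction rule: trig.induct)
  case (trig_char k)
  then show ?case by (simp add: P_char trig_scale trig.trig_char)
next
  case (trig_add p q)
  obtain B where "\<And>x. norm (p x) \<le> B"
    using continuous_torus_bounded[OF trig_continuous[OF trig_add(1)]] by blast
  moreover obtain C where "\<And>x. norm (q x) \<le> C"
    using continuous_torus_bounded[OF trig_continuous[OF trig_add(2)]] by blast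
  ultimately have "P (\<lambda>x. p x + q x) = (\<lambda>x. P p x + P q x)"
    using trig_measurable[OF trig_add(1)] trig_measurable[OF trig_add(2)] by (intro P_add)
  then show ?case using trig_add by (simp add: trig.trig_add)
next
  case (trig_scale p c)
  then show ?case by (simp add: P_scale trig.trig_scale)
qed

text \<open>\<open>P\<close> maps trigonometric polynomials to such and contracts both the supremum
  and the mean, so the images of the approximants serve with the same constant.\<close>

lemma trig_approx_P:
  assumes "trig_approx h"
  shows "trig_approx (P h)"
proof -
  obtain C where C: "1 \<le> C" "\<And>x. norm (h x) \<le> C"
    "\<And>e. 0 < e \<Longrightarrow> \<exists>p. trig p \<and> (\<forall>x. norm (p x) \<le> C) \<and> (LINT x|haar. norm (h x - p x)) < e"
    using assms by (rule trig_approxE) blast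
  note [measurable] = trig_approx_measurable[OF assms]
  show ?thesis
  proof (rule trig_approxI[where C = C])
    show "norm (P h x) \<le> C" for x by (rule norm_P_le[OF C(2)])
    fix e :: real assume e: "0 < e"
    obtain p where p: "trig p" "\<And>x. norm (p x) \<le> C" "(LINT x|haar. norm (h x - p x)) < e"
      using C(3)[of "e"] e by auto
    note [measurable] = trig_measurable[OF p(1)]
    have bd: "norm (h x - p x) \<le> C + C" for x
      using norm_triangle_ineq4[of "h x" "p x"] C(2)[of x] p(2)[of x] by linarith
    have "(LINT x|haar. norm (P h x - P p x)) = (LINT x|haar. norm (P (\<lambda>x. h x - p x) x))"
      by (subst P_diff[of h C p C]) (simp_all add: C p)
    also have "\<dots> \<le> (LINT x|haar. norm (h x - p x))"
      by (rule integral_norm_P_le[OF _ bd]) measurable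
    finally show "\<exists>p. trig p \<and> (\<forall>x. norm (p x) \<le> C) \<and> (LINT x|haar. norm (P h x - p x)) < e"
      using p norm_P_le[OF p(2)] by (intro exI[of _ "P p"]) (auto simp: trig_P)
  qed measurable
qed

section \<open>Iterates of the convolution operator and Parseval's identity for them\<close>

lemma P_pow_measurable [measurable (raw)]:
  "h \<in> borel_measurable borel \<Longrightarrow> (P ^^ a) h \<in> borel_measurable borel"
  by (induction a) (auto intro: P_measurable)

lemma norm_P_pow_le:
  assumes "\<And>x. norm (h x) \<le> B"
  shows "norm ((P ^^ a) h x) \<le> B"
  by (induction a arbitrary: x) (auto intro: norm_P_le assms)

lemma P_pow_char: "(P ^^ a) (torus_char k) = (\<lambda>x. ev k ^ a * torus_char k x)"
  by (induction a) (simp_all add: P_scale P_char mult.assoc mult.left_commute)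

lemma P_pow_scale: "(P ^^ a) (\<lambda>x. c * h x) = (\<lambda>x. c * (P ^^ a) h x)"
  by (induction a) (simp_all add: P_scale)

lemma P_pow_add:
  assumes "h \<in> borel_measurable borel" "\<And>x. norm (h x) \<le> B"
    "g \<in> borel_measurable borel" "\<And>x. norm (g x) \<le> C"
  shows "(P ^^ a) (\<lambda>x. h x + g x) = (\<lambda>x. (P ^^ a) h x + (P ^^ a) g x)"
proof (induction a)
  case (Suc a)
  then show ?case
    using P_add[OF P_pow_measurable[OF assms(1)] norm_P_pow_le[OF assms(2)]
        P_pow_measurable[OF assms(3)] norm_P_pow_le[OF assms(4)], of a a]
    by simp
qed simp

lemma P_pow_diff:
  assumes "h \<in> borel_measurable borel" "\<And>x. norm (h x) \<le> B"
    "g \<in> borel_measurable borel" "\<And>x. norm (g x) \<le> C"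
  shows "(P ^^ a) (\<lambda>x. h x - g x) = (\<lambda>x. (P ^^ a) h x - (P ^^ a) g x)"
  using P_pow_add[OF assms(1,2), of "\<lambda>x. (-1) * g x" C a] assms(3,4)
  by (simp only: P_pow_scale) simp

lemma integral_norm_P_pow_le:
  assumes "h \<in> borel_measurable borel" and "\<And>x. norm (h x) \<le> B"
  shows "(LINT x|haar. norm ((P ^^ a) h x)) \<le> (LINT x|haar. norm (h x))"
proof (induction a)
  case (Suc a)
  have "(LINT x|haar. norm ((P ^^ Suc a) h x)) \<le> (LINT x|haar. norm ((P ^^ a) h x))"
    using integral_norm_P_le[OF P_pow_measurable[OF assms(1)] norm_P_pow_le[OF assms(2)], of a] by simp
  with Suc show ?case by simp
qed simp

text \<open>The sum is stationary once \<open>L\<close> contains the spectrum of \<open>p\<close>.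
  Asking only for some finite \<open>K\<close> below \<open>L\<close> avoids naming the spectrum,
  and sums of polynomials are handled by the union of two such sets.\<close>

lemma trig_integral_P_pow:
  assumes "trig p" and u: "integrable haar u"
  shows "\<exists>K. finite K \<and> (\<forall>L. finite L \<and> K \<subseteq> L \<longrightarrow>
    (\<Sum>k\<in>L. fcoef u (- k) * fcoef p k * ev k ^ a) = (LINT x|haar. u x * (P ^^ a) p x))"
  using assms(1)
proof (induction rule: trig.induct)
  case (trig_char k)
  have "(\<Sum>l\<in>L. fcoef u (- l) * fcoef (torus_char k) l * ev l ^ a)
      = (LINT x|haar. u x * (P ^^ a) (torus_char k) x)" if "finite L" "{k} \<subseteq> L" for L
  proof -
    have "(\<Sum>l\<in>L. fcoef u (- l) * fcoef (torus_char k) l * ev l ^ a)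
        = (\<Sum>l\<in>L. if l = k then fcoef u (- k) * ev k ^ a else 0)"
      by (intro sum.cong) (auto simp: fcoef_char)
    also have "\<dots> = (LINT x|haar. ev k ^ a * (u x * torus_char k x))"
      using that by (simp add: integral_mult_char mult.commute)
    finally show ?thesis by (simp add: P_pow_char mult_ac)
  qed
  then show ?case by (intro exI[of _ "{k}"]) simp
next
  case (trig_add p q)
  obtain K where K: "finite K" "\<And>L. finite L \<Longrightarrow> K \<subseteq> L \<Longrightarrow>
    (\<Sum>k\<in>L. fcoef u (- k) * fcoef p k * ev k ^ a) = (LINT x|haar. u x * (P ^^ a) p x)"
    using trig_add.IH(1) by blast
  obtain K' where K': "finite K'" "\<And>L. finite L \<Longrightarrow> K' \<subseteq> L \<Longrightarrow>
    (\<Sum>k\<in>L. fcoef u (- k) * fcoef q k * ev k ^ a) = (LINT x|haar. u x * (P ^^ a) q x)"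
    using trig_add.IH(2) by blast
  obtain B where B: "\<And>x. norm (p x) \<le> B"
    using continuous_torus_bounded[OF trig_continuous[OF trig_add(1)]] by blast
  obtain C where C: "\<And>x. norm (q x) \<le> C"
    using continuous_torus_bounded[OF trig_continuous[OF trig_add(2)]] by blast
  note m = trig_measurable[OF trig_add(1)] trig_measurable[OF trig_add(2)]
  have "(\<Sum>k\<in>L. fcoef u (- k) * fcoef (\<lambda>x. p x + q x) k * ev k ^ a)
      = (LINT x|haar. u x * (P ^^ a) (\<lambda>x. p x + q x) x)" if L: "finite L" "K \<union> K' \<subseteq> L" for L
  proof -
    have "(\<Sum>k\<in>L. fcoef u (- k) * fcoef (\<lambda>x. p x + q x) k * ev k ^ a)
        = (LINT x|haar. u x * (P ^^ a) p x) + (LINT x|haar. u x * (P ^^ a) q x)"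
      using K(2)[of L] K'(2)[of L] L
      by (simp add: fcoef_add integrable_trig trig_add(1,2) distrib_left distrib_right sum.distrib)
    also have "\<dots> = (LINT x|haar. u x * (P ^^ a) p x + u x * (P ^^ a) q x)"
      using m by (intro Bochner_Integration.integral_add[symmetric] integrable_haar_mult_bounded[OF u])
        (auto intro: P_pow_measurable norm_P_pow_le[OF B] norm_P_pow_le[OF C])
    finally show ?thesis by (simp add: P_pow_add[OF m(1) B m(2) C] distrib_left)
  qed
  then show ?case using K(1) K'(1) by (intro exI[of _ "K \<union> K'"]) simp
next
  case (trig_scale p c)
  then obtain K where K: "finite K" "\<And>L. finite L \<Longrightarrow> K \<subseteq> L \<Longrightarrow>
    (\<Sum>k\<in>L. fcoef u (- k) * fcoef p k * ev k ^ a) = (LINT x|haar. u x * (P ^^ a) p x)"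
    by blast
  have "(\<Sum>k\<in>L. fcoef u (- k) * fcoef (\<lambda>x. c * p x) k * ev k ^ a)
      = c * (\<Sum>k\<in>L. fcoef u (- k) * fcoef p k * ev k ^ a)" for L
    by (simp add: fcoef_scale sum_distrib_left mult_ac)
  then show ?case using K by (intro exI[of _ K]) (simp add: P_pow_scale mult.left_commute)
qed

text \<open>Exact for trigonometric polynomials. For the remainder \<open>r = h - p\<close>,
  Cauchy-Schwarz with Bessel controls the coefficient side in mean square, and the contraction
  property of \<open>P\<close> controls the integral side in mean.\<close>

lemma parseval_P_pow:
  assumes um: "u \<in> borel_measurable borel" and B: "\<And>x. norm (u x) \<le> B" and h: "trig_approx h"
  shows "((\<lambda>k. fcoef u (- k) * fcoef h k * ev k ^ a) has_sum (LINT x|haar. u x * (P ^^ a) h x)) UNIV"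
proof -
  obtain C where C: "1 \<le> C" "\<And>x. norm (h x) \<le> C"
    "\<And>e. 0 < e \<Longrightarrow> \<exists>p. trig p \<and> (\<forall>x. norm (p x) \<le> C) \<and> (LINT x|haar. norm (h x - p x)) < e"
    using h by (rule trig_approxE) blast
  note [measurable] = trig_approx_measurable[OF h] um
  have B0: "0 \<le> B" using B[of 0] norm_ge_zero order_trans by blast
  have u: "integrable haar u" using um B by (rule integrable_haar_bounded)
  have hi: "integrable haar h" by (rule trig_approx_integrable[OF h])
  show ?thesis
    unfolding has_sum_def
  proof (rule tendstoI)
    fix e :: real assume e: "0 < e"
    \<comment> \<open>The two errors will add up to \<open>B * (2 * C + 1) * \<eta>\<close>. The
      factor \<open>B + 1\<close> in place of \<open>B\<close> keeps \<open>W\<close> positive when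
      \<open>B = 0\<close>.\<close>
    define W where "W = (B + 1) * (2 * C + 1)"
    have W: "0 < W" using B0 C(1) by (simp add: W_def)
    define \<eta> where "\<eta> = min 1 (e / (2 * W))"
    have \<eta>: "0 < \<eta>" "\<eta> \<le> 1" "\<eta> \<le> e / (2 * W)"
      using e W by (simp_all add: \<eta>_def)
    then have "0 < \<eta>\<^sup>2" by simp
    \<comment> \<open>Accuracy \<open>\<eta>\<^sup>2\<close> in mean becomes
      \<open>2 * C * \<eta>\<close> in mean square, since the remainder is bounded by
      \<open>2 * C\<close> and \<open>2 * C\<close> is at least 1.\<close>
    then obtain p where p: "trig p" "\<And>x. norm (p x) \<le> C" "(LINT x|haar. norm (h x - p x)) < \<eta>\<^sup>2"
      using C(3) by blast
    note [measurable] = trig_measurable[OF p(1)]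
    have pi: "integrable haar p" by (rule integrable_trig[OF p(1)])
    define r where "r x = h x - p x" for x
    have [measurable]: "r \<in> borel_measurable borel" unfolding r_def by measurable
    have r: "norm (r x) \<le> 2 * C" for x
      using norm_triangle_ineq4[of "h x" "p x"] C(2)[of x] p(2)[of x] unfolding r_def by linarith
    have r1: "(LINT x|haar. norm (r x)) < \<eta>\<^sup>2" using p(3) by (simp add: r_def)
    have "(LINT x|haar. (norm (r x))\<^sup>2) \<le> (LINT x|haar. 2 * C * norm (r x))"
    proof (rule integral_mono')
      show "integrable haar (\<lambda>x. 2 * C * norm (r x))" unfolding r_def using hi pi by simp
      show "(norm (r x))\<^sup>2 \<le> 2 * C * norm (r x)" for x
        unfolding power2_eq_square using r[of x] by (intro mult_right_mono) auto
      show "0 \<le> 2 * C * norm (r x)" for x using C(1) by simp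
    qed
    also have "\<dots> \<le> 2 * C * \<eta>\<^sup>2" using r1 C(1) by simp
    also have "\<dots> \<le> (2 * C)\<^sup>2 * \<eta>\<^sup>2"
      using C(1) self_le_power[of "2 * C" 2] by (intro mult_right_mono) simp_all
    also have "\<dots> = (2 * C * \<eta>)\<^sup>2" by (simp add: power_mult_distrib)
    finally have r2: "sqrt (LINT x|haar. (norm (r x))\<^sup>2) \<le> 2 * C * \<eta>"
      using C(1) \<eta>(1) by (intro real_le_lsqrt) (simp_all add: integral_nonneg_AE)
    obtain K where K: "finite K" "\<And>L. finite L \<Longrightarrow> K \<subseteq> L \<Longrightarrow>
      (\<Sum>k\<in>L. fcoef u (- k) * fcoef p k * ev k ^ a) = (LINT x|haar. u x * (P ^^ a) p x)"
      using trig_integral_P_pow[OF p(1) u, of a] by auto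
    have "dist (\<Sum>k\<in>L. fcoef u (- k) * fcoef h k * ev k ^ a) (LINT x|haar. u x * (P ^^ a) h x) < e"
      if L: "finite L" "K \<subseteq> L" for L
    proof -
      have "(\<Sum>k\<in>L. fcoef u (- k) * fcoef h k * ev k ^ a) - (LINT x|haar. u x * (P ^^ a) p x)
          = (\<Sum>k\<in>L. fcoef u (- k) * fcoef r k * ev k ^ a)"
        unfolding K(2)[OF L, symmetric] r_def fcoef_diff[OF hi pi]
        by (simp only: sum_subtractf left_diff_distrib right_diff_distrib)
      also have "norm \<dots> \<le> (\<Sum>k\<in>L. norm (fcoef u (- k)) * norm (fcoef r k))"
      proof (rule sum_norm_le)
        fix k
        have "norm (ev k ^ a) \<le> 1" using norm_ev_le by (simp add: norm_power power_le_one)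
        then show "norm (fcoef u (- k) * fcoef r k * ev k ^ a) \<le> norm (fcoef u (- k)) * norm (fcoef r k)"
          unfolding norm_mult by (intro mult_left_le) auto
      qed
      also have "\<dots> \<le> B * sqrt (LINT x|haar. (norm (r x))\<^sup>2)"
        using L by (intro sum_norm_fcoef_mult_le[OF um B _ r]) auto
      also have "\<dots> \<le> B * (2 * C * \<eta>)" using r2 B0 by (rule mult_left_mono)
      finally have 1: "norm ((\<Sum>k\<in>L. fcoef u (- k) * fcoef h k * ev k ^ a)
          - (LINT x|haar. u x * (P ^^ a) p x)) \<le> B * (2 * C * \<eta>)" .
      have int: "integrable haar (\<lambda>x. u x * (P ^^ a) g x)"
        if "g \<in> borel_measurable borel" "\<And>x. norm (g x) \<le> D" for g D
        by (rule integrable_haar_mult_bounded[OF u P_pow_measurable[OF that(1)] norm_P_pow_le[OF that(2)]])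
      have "(LINT x|haar. u x * (P ^^ a) h x) - (LINT x|haar. u x * (P ^^ a) p x)
          = (LINT x|haar. u x * (P ^^ a) r x)"
        unfolding r_def P_pow_diff[OF trig_approx_measurable[OF h] C(2) trig_measurable[OF p(1)] p(2)] right_diff_distrib
        by (rule Bochner_Integration.integral_diff[symmetric])
          (rule int[OF trig_approx_measurable[OF h] C(2)], rule int[OF trig_measurable[OF p(1)] p(2)])
      also have "norm \<dots> \<le> (LINT x|haar. norm (u x * (P ^^ a) r x))" by (rule integral_norm_bound)
      also have "\<dots> \<le> (LINT x|haar. B * norm ((P ^^ a) r x))"
      proof (rule integral_mono')
        show "integrable haar (\<lambda>x. B * norm ((P ^^ a) r x))"
          using integrable_haar_bounded[OF P_pow_measurable[OF \<open>r \<in> borel_measurable borel\<close>] norm_P_pow_le[OF r]]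
          by simp
      qed (use B B0 in \<open>auto simp: norm_mult intro: mult_right_mono\<close>)
      also have "\<dots> = B * (LINT x|haar. norm ((P ^^ a) r x))" by simp
      also have "\<dots> \<le> B * (LINT x|haar. norm (r x))"
        using B0 by (intro mult_left_mono integral_norm_P_pow_le[OF _ r]) auto
      also have "\<dots> \<le> B * \<eta>\<^sup>2" using r1 B0 by (intro mult_left_mono) auto
      also have "\<dots> \<le> B * \<eta>" using \<eta> B0 by (intro mult_left_mono) (auto simp: power2_eq_square mult_left_le)
      finally have 2: "norm ((LINT x|haar. u x * (P ^^ a) h x) - (LINT x|haar. u x * (P ^^ a) p x)) \<le> B * \<eta>" .
      have "B * (2 * C * \<eta>) + B * \<eta> = B * (2 * C + 1) * \<eta>" by (simp add: algebra_simps)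
      also have "\<dots> \<le> W * \<eta>" unfolding W_def using \<eta> C(1) by (intro mult_right_mono) simp_all
      also have "\<dots> \<le> W * (e / (2 * W))" using \<eta>(3) W by (intro mult_left_mono) simp_all
      also have "\<dots> = e / 2" using W by simp
      also have "\<dots> < e" using e by simp
      finally have 3: "B * (2 * C * \<eta>) + B * \<eta> < e" .
      show ?thesis
        unfolding dist_norm using 1 2 3
          norm_triangle_ineq4[of "(\<Sum>k\<in>L. fcoef u (- k) * fcoef h k * ev k ^ a) - (LINT x|haar. u x * (P ^^ a) p x)"
            "(LINT x|haar. u x * (P ^^ a) h x) - (LINT x|haar. u x * (P ^^ a) p x)"]
        by simp
    qed
    then show "eventually (\<lambda>L. dist (\<Sum>k\<in>L. fcoef u (- k) * fcoef h k * ev k ^ a)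
        (LINT x|haar. u x * (P ^^ a) h x) < e) (finite_subsets_at_top UNIV)"
      using K(1) by (auto simp: eventually_finite_subsets_at_top)
  qed
qed

end

section \<open>Recovering summands from power sums\<close>

text \<open>The vanishing of all power sums survives multiplication of the coefficients by any
  polynomial in \<open>l k\<close>. A suitable polynomial removes the finitely many other terms at
  least as far from \<open>w\<close> as \<open>l k0\<close>. Multiplication by
  \<open>(l k - w) ^ n\<close> then makes the term of \<open>k0\<close> decay strictly more slowly
  than all that remain, so its coefficient is 0.\<close>

lemma power_sums_determine_coefficients:
  fixes c l :: "'k \<Rightarrow> complex"
  assumes summable: "(\<lambda>k. norm (c k)) summable_on UNIV"
    and zero: "\<And>a. ((\<lambda>k. c k * l k ^ a) has_sum 0) UNIV"
    and inj: "inj l" and l: "\<And>k. norm (l k) \<le> 1" "\<And>k. l k \<noteq> w"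
    and fin: "\<And>e. 0 < e \<Longrightarrow> finite {k. e \<le> norm (l k - w)}"
  shows "c k0 = 0"
proof (rule ccontr)
  assume c: "c k0 \<noteq> 0"
  define Z where "Z f \<longleftrightarrow> (\<forall>a. ((\<lambda>k. f k * l k ^ a) has_sum 0) UNIV)" for f :: "'k \<Rightarrow> complex"
  have Z_step: "Z (\<lambda>k. f k * (l k - v))" if "Z f" for f v
  proof -
    have *: "((\<lambda>k. f k * l k ^ a) has_sum 0) UNIV" for a using that unfolding Z_def by blast
    have "((\<lambda>k. f k * l k ^ Suc a + (- v) * (f k * l k ^ a)) has_sum (0 + (- v) * 0)) UNIV" for a
      by (rule has_sum_add[OF *[of "Suc a"] has_sum_cmult_right[OF *]])
    then show ?thesis by (simp add: Z_def algebra_simps)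
  qed
  define r where "r = norm (l k0 - w)"
  have r: "0 < r" using l by (simp add: r_def)
  \<comment> \<open>Indices at the same distance \<open>r\<close> as \<open>k0\<close> are included;
    injectivity of \<open>l\<close> keeps the factors that remove them nonzero at
    \<open>k0\<close>.\<close>
  define K where "K = {k. r \<le> norm (l k - w)} - {k0}"
  have K: "finite K" unfolding K_def using fin[OF r] by simp
  define b where "b k = c k * (\<Prod>j\<in>K. (l k - l j))" for k
  have "Z (\<lambda>k. c k * (\<Prod>j\<in>J. (l k - l j)))" if "finite J" for J
    using that
  proof (induction J)
    case empty
    then show ?case using zero by (simp add: Z_def)
  next
    case (insert j J)
    then have "Z (\<lambda>k. c k * (\<Prod>j\<in>J. (l k - l j)) * (l k - l j))" by (intro Z_step)
    then show ?case using insert by (simp add: mult_ac)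
  qed
  then have Zb: "Z b" using K unfolding b_def by simp
  have Zbn: "Z (\<lambda>k. b k * (l k - w) ^ n)" for n
  proof (induction n)
    case (Suc n)
    then show ?case using Z_step[OF Suc, of w] by (simp add: mult_ac)
  qed (use Zb in simp)
  have b0: "b k0 \<noteq> 0"
    unfolding b_def using c K inj by (auto simp: K_def dest: injD)
  have bK: "b k = 0" if "k \<in> K" for k
    unfolding b_def using K that by (auto simp: prod_zero_iff)
  \<comment> \<open>The largest distance below \<open>r\<close>, or \<open>r/2\<close>: only
    finitely many distances lie in \<open>[r/2, r)\<close>, so the maximum stays below
    \<open>r\<close>. Inserting \<open>r/2\<close> covers all smaller distances and keeps the set
    nonempty.\<close>
  define \<rho> where "\<rho> = Max (insert (r/2) ((\<lambda>k. norm (l k - w)) ` ({k. r/2 \<le> norm (l k - w)} - {k. r \<le> norm (l k - w)})))"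
  have F: "finite ({k. r/2 \<le> norm (l k - w)} - {k. r \<le> norm (l k - w)})"
    using fin[of "r/2"] r by simp
  have \<rho>: "\<rho> < r" "0 < \<rho>"
    unfolding \<rho>_def using F r by (auto simp: Max_gr_iff)
  have le_\<rho>: "norm (l k - w) \<le> \<rho>" if "norm (l k - w) < r" for k
  proof (cases "r/2 \<le> norm (l k - w)")
    case True
    then show ?thesis unfolding \<rho>_def using F that by (intro Max_ge) auto
  next
    case False
    moreover have "r/2 \<le> \<rho>" unfolding \<rho>_def using F by (intro Max_ge) auto
    ultimately show ?thesis by simp
  qed
  have bsum: "(\<lambda>k. norm (b k)) summable_on UNIV"
  proof (rule Infinite_Sum.abs_summable_on_comparison_test)
    show "(\<lambda>k. norm (2 ^ card K * c k)) summable_on UNIV"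
      using summable_on_cmult_right[OF summable, of "2 ^ card K"] by (simp add: norm_mult norm_power)
    fix k
    have "norm (l k - l j) \<le> 2" for j
      using norm_triangle_ineq4[of "l k" "l j"] l(1)[of k] l(1)[of j] by linarith
    then have "norm (\<Prod>j\<in>K. (l k - l j)) \<le> (\<Prod>j\<in>K. 2)"
      unfolding prod_norm[symmetric] by (intro prod_mono) auto
    then show "norm (b k) \<le> norm (2 ^ card K * c k)"
      unfolding b_def norm_mult by (simp add: norm_power mult.commute mult_left_mono)
  qed
  define S where "S = infsum (\<lambda>k. norm (b k)) UNIV"
  have S: "((\<lambda>k. norm (b k)) has_sum S) UNIV" unfolding S_def using bsum by (rule has_sum_infsum)
  have bound: "norm (b k0) * r ^ n \<le> \<rho> ^ n * S" for n
  proof -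
    define d where "d k = (if k = k0 then 0 else b k * (l k - w) ^ n)" for k
    have "((\<lambda>k. if k = k0 then - (b k0 * (l k0 - w) ^ n) else 0) has_sum - (b k0 * (l k0 - w) ^ n)) UNIV"
      by (rule has_sum_finite_neutralI[of "{k0}"]) auto
    from has_sum_add[OF _ this, of "\<lambda>k. b k * (l k - w) ^ n" 0]
    have "((\<lambda>k. b k * (l k - w) ^ n + (if k = k0 then - (b k0 * (l k0 - w) ^ n) else 0))
        has_sum - (b k0 * (l k0 - w) ^ n)) UNIV"
      using Zbn[of n] unfolding Z_def by (auto dest: spec[of _ 0])
    moreover have "(\<lambda>k. b k * (l k - w) ^ n + (if k = k0 then - (b k0 * (l k0 - w) ^ n) else 0)) = d"
      by (auto simp: d_def)
    ultimately have ds: "(d has_sum - (b k0 * (l k0 - w) ^ n)) UNIV" by simp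
    have le: "norm (d k) \<le> \<rho> ^ n * norm (b k)" for k
    proof (cases "k = k0 \<or> b k = 0")
      case True
      then show ?thesis using \<rho> by (auto simp: d_def)
    next
      case False
      then have "norm (l k - w) < r" using bK[of k] by (force simp: K_def)
      then have "norm (l k - w) ^ n \<le> \<rho> ^ n" by (intro power_mono le_\<rho>) auto
      then show ?thesis using False by (simp add: d_def norm_mult norm_power mult.commute mult_right_mono)
    qed
    have "(\<lambda>k. norm (d k)) summable_on UNIV"
    proof (rule Infinite_Sum.abs_summable_on_comparison_test)
      show "(\<lambda>k. norm (\<rho> ^ n * norm (b k))) summable_on UNIV"
        using summable_on_cmult_right[OF bsum, of "\<rho> ^ n"] \<rho> by (simp add: abs_mult)
      show "norm (d k) \<le> norm (\<rho> ^ n * norm (b k))" for k using le[of k] \<rho> by (simp add: abs_mult)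
    qed
    then obtain T where T: "((\<lambda>k. norm (d k)) has_sum T) UNIV" by (auto simp: summable_on_def)
    have "norm (- (b k0 * (l k0 - w) ^ n)) \<le> T" by (rule norm_has_sum_bound[OF T ds])
    also have "T \<le> \<rho> ^ n * S"
      by (rule has_sum_mono[OF T has_sum_cmult_right[OF S] le])
    finally show ?thesis by (simp add: norm_mult norm_power r_def)
  qed
  have "norm (b k0) \<le> (\<rho> / r) ^ n * S" for n
    using bound[of n] r by (simp add: power_divide field_simps)
  moreover have "(\<lambda>n. (\<rho> / r) ^ n * S) \<longlonglongrightarrow> 0 * S"
    using \<rho> r by (intro tendsto_mult LIMSEQ_power_zero) auto
  ultimately have "norm (b k0) \<le> 0 * S"
    by (intro LIMSEQ_le_const) auto
  then show False using b0 by simp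
qed

section \<open>Nested correlations of the walk\<close>

context torus_walk begin

text \<open>Multi-time correlation: the expected product of the listed functions at times
  \<open>0, 1, ...\<close> of a walk started at \<open>x\<close>. Its Haar integral belongs to the
  walk with uniform start.\<close>

primrec nest :: "('n torus \<Rightarrow> complex) list \<Rightarrow> 'n torus \<Rightarrow> complex" where
  "nest [] = (\<lambda>_. 1)"
| "nest (h # hs) = (\<lambda>x. h x * P (nest hs) x)"

lemma P_const: "P (\<lambda>_. c) = (\<lambda>_. c)"
  using prob_space by (simp add: P_def fun_eq_iff)

lemma trig_approx_nest: "(\<And>h. h \<in> set hs \<Longrightarrow> trig_approx h) \<Longrightarrow> trig_approx (nest hs)"
  by (induction hs) (auto intro: trig_approx_mult trig_approx_P trig_approx_trig trig_const)

lemma nest_replicate: "nest (replicate a (\<lambda>_. 1) @ hs) = (P ^^ a) (nest hs)"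
  by (induction a) auto

end

text \<open>A boolean word records at which times the function is read, and each
  \<open>False\<close> lets the walk make a step unobserved. One word, chosen independently of the
  function, thus indexes the same correlation of two different functions.\<close>

definition sel :: "('n::finite torus \<Rightarrow> complex) \<Rightarrow> bool \<Rightarrow> 'n torus \<Rightarrow> complex" where
  "sel f b = (if b then f else (\<lambda>_. 1))"

lemma trig_approx_sel: "trig_approx f \<Longrightarrow> trig_approx (sel f b)"
  by (auto simp: sel_def intro: trig_approx_trig trig_const)

context torus_walk begin

text \<open>Idempotence takes care of \<open>a = 0\<close>: consecutive factors of a nested correlation are always
  separated by at least one application of \<open>P\<close>.\<close>

lemma nest_insert_power:
  "\<exists>bs'. \<forall>g. (\<forall>x. g x * g x = g x) \<longrightarrow>
      nest (map (sel g) bs') = (\<lambda>x. g x * (P ^^ a) (nest (map (sel g) bs)) x)"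
proof (cases a)
    case (Suc a')
    have "nest (map (sel g) (True # replicate a' False @ bs))
        = (\<lambda>x. g x * (P ^^ a) (nest (map (sel g) bs)) x)" for g
      by (simp add: sel_def map_replicate nest_replicate Suc)
    then show ?thesis by blast
  next
    case 0
    show ?thesis
    proof (cases bs)
      case Nil
      have "nest (map (sel g) [True]) = (\<lambda>x. g x * (P ^^ a) (nest (map (sel g) bs)) x)" for g
        by (simp add: sel_def Nil 0 P_const)
      then show ?thesis by blast
    next
      case (Cons b bs'')
      have "nest (map (sel g) (True # bs'')) = (\<lambda>x. g x * (P ^^ a) (nest (map (sel g) bs)) x)"
        if "\<forall>x. g x * g x = g x" for g
        using that by (cases b) (simp_all add: sel_def Cons 0 fun_eq_iff mult.assoc[symmetric])
      then show ?thesis by blast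
    qed
  qed
text \<open>One coefficient is split off per induction step. By Parseval, reading the function and
  then waiting \<open>a\<close> steps gives power sums of the \<open>ev j\<close>; as
  \<open>a\<close> varies, these determine every single summand. The word \<open>bs\<close> must
  vary in the induction, since the hypothesis is applied to lengthened words.\<close>

lemma nested_correlations_determine_products:
  assumes f: "trig_approx f" "\<And>x. f x * f x = f x" and g: "trig_approx g" "\<And>x. g x * g x = g x"
    and eq: "\<And>bs. (LINT x|haar. nest (map (sel f) bs) x) = (LINT x|haar. nest (map (sel g) bs) x)"
    and ev: "inj ev" "\<And>k. ev k \<noteq> w" "\<And>e. 0 < e \<Longrightarrow> finite {k. e \<le> norm (ev k - w)}"
  shows "prod_list (map (fcoef f) ks) * (LINT x|haar. torus_char (sum_list ks) x * nest (map (sel f) bs) x)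
       = prod_list (map (fcoef g) ks) * (LINT x|haar. torus_char (sum_list ks) x * nest (map (sel g) bs) x)"
proof (induction ks arbitrary: bs)
  case Nil
  then show ?case using eq by simp
next
  case (Cons k ks)
  define L where "L = sum_list ks"
  define A where "A f = prod_list (map (fcoef f) ks)" for f :: "'n torus \<Rightarrow> complex"
  define u where "u f x = torus_char L x * f x" for f :: "'n torus \<Rightarrow> complex" and x
  define h where "h f = nest (map (sel f) bs)" for f
  have ta: "trig_approx (u f)" "trig_approx (h f)" if "trig_approx f" for f
    unfolding u_def h_def
    by (rule trig_approx_mult[OF trig_approx_trig[OF trig_char] that])
      (rule trig_approx_nest, auto intro: trig_approx_sel that)
  \<comment> \<open>The factor \<open>A f\<close> stays attached: the induction hypothesis compares
    only complete products, and \<open>A f\<close> may be 0, so it cannot be cancelled.\<close>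
  define c where "c f j = A f * (fcoef (u f) (- j) * fcoef (h f) j)" for f j
  have summable: "(\<lambda>j. norm (c f j)) summable_on UNIV" if tf: "trig_approx f" for f
  proof -
    obtain B where "\<And>x. norm (u f x) \<le> B" using trig_approx_bounded[OF ta(1)[OF tf]] by blast
    moreover obtain C where "\<And>x. norm (h f x) \<le> C" using trig_approx_bounded[OF ta(2)[OF tf]] by blast
    ultimately have "(\<lambda>j. norm (fcoef (u f) (- j) * fcoef (h f) j)) summable_on UNIV"
      by (rule fcoef_mult_abs_summable[OF trig_approx_measurable[OF ta(1)[OF tf]] _
            trig_approx_measurable[OF ta(2)[OF tf]]])
    then show ?thesis
      unfolding c_def by (subst norm_mult) (rule summable_on_cmult_right)
  qed
  have has: "((\<lambda>j. c f j * ev j ^ a) has_sum A f * (LINT x|haar. u f x * (P ^^ a) (h f) x)) UNIV"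
    if tf: "trig_approx f" for f a
  proof -
    obtain B where B: "\<And>x. norm (u f x) \<le> B" using trig_approx_bounded[OF ta(1)[OF tf]] by blast
    have "((\<lambda>j. A f * (fcoef (u f) (- j) * fcoef (h f) j * ev j ^ a))
        has_sum A f * (LINT x|haar. u f x * (P ^^ a) (h f) x)) UNIV"
      by (intro has_sum_cmult_right parseval_P_pow[OF trig_approx_measurable[OF ta(1)[OF tf]] B ta(2)[OF tf]])
    then show ?thesis by (simp add: c_def mult.assoc)
  qed
  have same: "A f * (LINT x|haar. u f x * (P ^^ a) (h f) x) = A g * (LINT x|haar. u g x * (P ^^ a) (h g) x)" for a
  proof -
    obtain bs' where *: "\<forall>g. (\<forall>x. g x * g x = g x) \<longrightarrow>
        nest (map (sel g) bs') = (\<lambda>x. g x * (P ^^ a) (nest (map (sel g) bs)) x)"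
      using nest_insert_power[where a = a and bs = bs] by (elim exE)
    have bs': "nest (map (sel f) bs') = (\<lambda>x. f x * (P ^^ a) (h f) x)"
      "nest (map (sel g) bs') = (\<lambda>x. g x * (P ^^ a) (h g) x)"
      unfolding h_def by (rule *[rule_format], rule f(2), rule *[rule_format], rule g(2))
    show ?thesis using Cons.IH[of bs'] unfolding bs' by (simp add: A_def u_def L_def mult.assoc)
  qed
  have "c f j - c g j = 0" for j
  proof (rule power_sums_determine_coefficients[where c = "\<lambda>j. c f j - c g j", OF _ _ ev(1) norm_ev_le ev(2,3)])
    show "(\<lambda>j. norm (c f j - c g j)) summable_on UNIV"
    proof (rule Infinite_Sum.abs_summable_on_comparison_test)
      have "(\<lambda>j. norm (c f j) + norm (c g j)) summable_on UNIV"
        by (intro summable_on_add summable f g)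
      then show "(\<lambda>j. norm (norm (c f j) + norm (c g j))) summable_on UNIV" by simp
      show "norm (c f j - c g j) \<le> norm (norm (c f j) + norm (c g j))" for j
        using norm_triangle_ineq4[of "c f j" "c g j"] by simp
    qed
    fix a
    have "((\<lambda>j. c f j * ev j ^ a + (- 1) * (c g j * ev j ^ a)) has_sum
        (A f * (LINT x|haar. u f x * (P ^^ a) (h f) x) + (- 1) * (A g * (LINT x|haar. u g x * (P ^^ a) (h g) x)))) UNIV"
      by (intro has_sum_add has_sum_cmult_right has f g)
    then show "((\<lambda>j. (c f j - c g j) * ev j ^ a) has_sum 0) UNIV"
      unfolding same by (simp add: left_diff_distrib)
  qed
  \<comment> \<open>At this frequency the first factor of the summand is \<open>fcoef f k\<close>,
    and the second is the integral of \<open>h f\<close> against the character \<open>L + k\<close>,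
    which is the next stage of the induction.\<close>
  from this[of "- (L + k)"] have *: "c f (- (L + k)) = c g (- (L + k))" by simp
  have u: "fcoef (u f) (L + k) = fcoef f k" for f
  proof -
    have "torus_char L x * f x * torus_char (- (L + k)) x = f x * torus_char (- k) x" for x
    proof -
      have "torus_char L x * torus_char (- (L + k)) x = torus_char (- k) x"
        by (simp add: torus_char_add_left[symmetric])
      then show ?thesis by (simp add: mult_ac)
    qed
    then show ?thesis unfolding fcoef_def u_def by (simp only:)
  qed
  have hc: "fcoef (h f) (- (L + k)) = (LINT x|haar. torus_char (L + k) x * h f x)" for f
    by (simp add: fcoef_def mult.commute del: minus_add_distrib)
  show ?case
    using * unfolding c_def minus_minus u hc unfolding h_def A_def L_def
    by (simp add: mult_ac add.commute)
qed

end

section \<open>Invariants determine a function up to translation\<close>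

text \<open>Finitely many translates of \<open>U\<close> cover the compact torus; if
  \<open>U\<close> were null, so would be the whole space.\<close>

lemma haar_open_pos:
  fixes U :: "'n::finite torus set"
  assumes "open U" "U \<noteq> {}"
  shows "0 < measure haar U"
proof (rule ccontr)
  assume "\<not> 0 < measure haar U"
  then have "measure haar U = 0" using measure_nonneg[of haar U] by linarith
  then have U0: "emeasure haar U = 0" by (simp add: haar.emeasure_eq_measure)
  obtain u where u: "u \<in> U" using assms(2) by blast
  define V where "V c = (+) c -` U" for c :: "'n torus"
  have V: "open (V c)" for c
    unfolding V_def using assms(1)
    by (intro open_vimage continuous_intros)
  have V0: "emeasure haar (V c) = 0" for c
  proof -
    have "emeasure haar (V c) = emeasure (distr haar borel ((+) c)) U"
      unfolding V_def using assms(1) by (subst emeasure_distr) auto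
    then show ?thesis by (simp add: distr_haar_translate U0)
  qed
  have "UNIV \<subseteq> (\<Union>c. V c)"
  proof
    fix x :: "'n torus"
    have "x \<in> V (u - x)" using u by (simp add: V_def)
    then show "x \<in> (\<Union>c. V c)" by blast
  qed
  then obtain I where I: "finite I" "UNIV \<subseteq> (\<Union>c\<in>I. V c)"
    by (rule compactE_image[OF compact_torus, of UNIV V, rotated]) (simp_all add: V)
  have "emeasure haar (\<Union>c\<in>I. V c) \<le> (\<Sum>c\<in>I. emeasure haar (V c))"
    using I(1) V by (intro emeasure_subadditive_finite) (auto intro: borel_open)
  also have "\<dots> = 0" using V0 by simp
  finally have "emeasure haar (UNIV :: 'n torus set) = 0"
    using I(2) by (simp add: top.extremum_unique)
  then show False using haar.emeasure_space_1[where 'n = 'n] by simp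
qed

section \<open>Joint moments of a randomly translated coefficient sequence\<close>

context
  fixes a b :: "int ^ 'n::finite \<Rightarrow> complex"
  assumes prods: "\<And>ks. sum_list ks = 0 \<Longrightarrow> prod_list (map a ks) = prod_list (map b ks)"
    and a_uminus: "\<And>k. a (- k) = cnj (a k)" and b_uminus: "\<And>k. b (- k) = cnj (b k)"
begin

text \<open>Under \<open>haar\<close>, \<open>x\<close> is a uniformly random shift and
  \<open>c k * torus_char k x\<close> is the coefficient at \<open>k\<close> after the shift; words
  are the monomials in these random variables.\<close>

definition char_word :: "(int ^ 'n \<Rightarrow> complex) \<Rightarrow> (int ^ 'n) list \<Rightarrow> 'n torus \<Rightarrow> complex" where
  "char_word c ks x = prod_list (map (\<lambda>k. c k * torus_char k x) ks)"

lemma char_word_eq: "char_word c ks x = prod_list (map c ks) * torus_char (sum_list ks) x"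
  by (induction ks) (simp_all add: char_word_def torus_char_add_left mult_ac)

lemma char_word_Cons: "char_word c (k # ks) x = c k * torus_char k x * char_word c ks x"
  by (simp add: char_word_def)

definition equal_moments :: "('n torus \<Rightarrow> complex) \<Rightarrow> ('n torus \<Rightarrow> complex) \<Rightarrow> bool" where
  "equal_moments \<phi> \<psi> \<longleftrightarrow> continuous_on UNIV \<phi> \<and> continuous_on UNIV \<psi> \<and>
     (\<forall>ks. (LINT x|haar. \<phi> x * char_word a ks x) = (LINT x|haar. \<psi> x * char_word b ks x))"

text \<open>The pairs that preserve \<open>equal_moments\<close> under multiplication form an algebra, whereas
  \<open>equal_moments\<close> itself is not visibly closed under products.\<close>

definition multiplier :: "('n torus \<Rightarrow> complex) \<Rightarrow> ('n torus \<Rightarrow> complex) \<Rightarrow> bool" where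
  "multiplier \<phi> \<psi> \<longleftrightarrow> continuous_on UNIV \<phi> \<and> continuous_on UNIV \<psi> \<and>
     (\<forall>\<phi>' \<psi>'. equal_moments \<phi>' \<psi>' \<longrightarrow> equal_moments (\<lambda>x. \<phi> x * \<phi>' x) (\<lambda>x. \<psi> x * \<psi>' x))"

text \<open>If the frequencies of a word do not add up to 0, both moments vanish because a
  nontrivial character has mean 0; otherwise the assumption on products applies.\<close>

lemma equal_moments_1: "equal_moments (\<lambda>_. 1) (\<lambda>_. 1)"
  unfolding equal_moments_def
  by (auto simp: char_word_eq integral_torus_char intro: prods)

lemma continuous_char_word: "continuous_on A (char_word c ks)"
  unfolding char_word_eq[abs_def] by (intro continuous_intros)

lemma equal_moments_add:
  assumes "equal_moments \<phi> \<psi>" "equal_moments \<phi>' \<psi>'"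
  shows "equal_moments (\<lambda>x. \<phi> x + \<phi>' x) (\<lambda>x. \<psi> x + \<psi>' x)"
proof -
  have int: "integrable haar (\<lambda>x. h x * char_word c ks x)" if "continuous_on UNIV h" for h c ks
    using that by (intro integrable_haar_continuous continuous_intros continuous_char_word)
  show ?thesis
    using assms unfolding equal_moments_def
    by (simp add: distrib_right int continuous_on_add)
qed

lemma multiplier_const: "multiplier (\<lambda>_. c) (\<lambda>_. c)"
  unfolding multiplier_def equal_moments_def by (auto simp: mult.assoc intro!: continuous_intros)

text \<open>Multiplication by the entry at \<open>k\<close> just prepends \<open>k\<close> to the
  test words.\<close>

lemma multiplier_char: "multiplier (\<lambda>x. a k * torus_char k x) (\<lambda>x. b k * torus_char k x)"
  unfolding multiplier_def
proof (intro conjI allI impI)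
  fix \<phi> \<psi> assume *: "equal_moments \<phi> \<psi>"
  have eqs: "a k * torus_char k x * \<phi> x * char_word a ks x = \<phi> x * char_word a (k # ks) x"
    "b k * torus_char k x * \<psi> x * char_word b ks x = \<psi> x * char_word b (k # ks) x" for ks x
    by (simp_all add: char_word_Cons mult_ac)
  show "equal_moments (\<lambda>x. a k * torus_char k x * \<phi> x) (\<lambda>x. b k * torus_char k x * \<psi> x)"
    using * unfolding equal_moments_def eqs by (auto intro!: continuous_intros)
qed (intro continuous_intros)+

lemma multiplier_add:
  assumes "multiplier \<phi> \<psi>" "multiplier \<phi>' \<psi>'"
  shows "multiplier (\<lambda>x. \<phi> x + \<phi>' x) (\<lambda>x. \<psi> x + \<psi>' x)"
  using assms unfolding multiplier_def
  by (auto simp: distrib_right intro!: continuous_intros equal_moments_add)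

lemma multiplier_mult:
  assumes "multiplier \<phi> \<psi>" "multiplier \<phi>' \<psi>'"
  shows "multiplier (\<lambda>x. \<phi> x * \<phi>' x) (\<lambda>x. \<psi> x * \<psi>' x)"
  using assms unfolding multiplier_def
  by (auto simp: mult.assoc intro!: continuous_intros)

lemma multiplier_sum:
  assumes "finite K" "\<And>k. k \<in> K \<Longrightarrow> multiplier (\<phi> k) (\<psi> k)"
  shows "multiplier (\<lambda>x. \<Sum>k\<in>K. \<phi> k x) (\<lambda>x. \<Sum>k\<in>K. \<psi> k x)"
  using assms by (induction K) (auto intro: multiplier_add multiplier_const)

lemma multiplier_power: "multiplier \<phi> \<psi> \<Longrightarrow> multiplier (\<lambda>x. \<phi> x ^ n) (\<lambda>x. \<psi> x ^ n)"
  by (induction n) (auto intro: multiplier_mult multiplier_const)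

lemma multiplier_integral:
  assumes "multiplier \<phi> \<psi>"
  shows "(LINT x|haar. \<phi> x) = (LINT x|haar. \<psi> x)"
proof -
  have "equal_moments (\<lambda>x. \<phi> x * 1) (\<lambda>x. \<psi> x * 1)"
    using assms equal_moments_1 unfolding multiplier_def by blast
  then have "(LINT x|haar. \<phi> x * 1 * char_word a [] x) = (LINT x|haar. \<psi> x * 1 * char_word b [] x)"
    unfolding equal_moments_def by blast
  then show ?thesis by (simp add: char_word_def)
qed

text \<open>Suppose no translation works.  The squared distance \<open>D a\<close> from the translates of \<open>a\<close> to \<open>b\<close> is
  then bounded below, while \<open>D b\<close> vanishes at \<open>0\<close>; yet both have the same moments.\<close>

lemma finite_translation_exists:
  assumes K: "finite K"
  shows "\<exists>\<theta>. \<forall>k\<in>K. b k = a k * torus_char k \<theta>"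
proof (rule ccontr)
  assume neg: "\<not> ?thesis"
  define D :: "(int ^ 'n \<Rightarrow> complex) \<Rightarrow> 'n torus \<Rightarrow> real"
    where "D c x = (\<Sum>k\<in>K. (norm (c k * torus_char k x - b k))\<^sup>2)" for c x
  have D_nonneg: "0 \<le> D c x" for c x unfolding D_def by (intro sum_nonneg) simp
  have D_cont: "continuous_on UNIV (D c)" for c
    unfolding D_def by (intro continuous_intros)
  \<comment> \<open>The symmetry of \<open>c\<close> turns the conjugated factor into the entry at
    \<open>- k\<close>, so that the squared distance is a polynomial in the shifted coefficients and
    multipliers apply.\<close>
  have Dc: "complex_of_real (D c x) = (\<Sum>k\<in>K. (c k * torus_char k x + (- b k)) *
      (c (- k) * torus_char (- k) x + (- cnj (b k))))" if "\<And>k. c (- k) = cnj (c k)" for c x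
    unfolding D_def of_real_sum
    by (intro sum.cong refl) (simp only: complex_norm_square that torus_char_uminus, simp)
  have mD: "multiplier (\<lambda>x. complex_of_real (D a x)) (\<lambda>x. complex_of_real (D b x))"
    unfolding Dc[of a, OF a_uminus] Dc[of b, OF b_uminus]
    by (intro multiplier_sum K multiplier_mult multiplier_add multiplier_char multiplier_const)
  have a_pos: "0 < D a x" for x
  proof (rule ccontr)
    assume "\<not> 0 < D a x"
    then have "D a x = 0" using D_nonneg[of a x] by simp
    then have "\<forall>k\<in>K. b k = a k * torus_char k x"
      unfolding D_def using K by (simp add: sum_nonneg_eq_0_iff)
    then show False using neg by blast
  qed
  obtain y where y: "\<And>x. D a y \<le> D a x"
    using continuous_attains_inf[OF compact_torus _ D_cont[of a]] by auto
  define c where "c = D a y"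
  have c: "0 < c" "\<And>x. c \<le> D a x" using a_pos y by (simp_all add: c_def)
  obtain B1 where B1: "\<And>x. norm (D a x) \<le> B1" using continuous_torus_bounded[OF D_cont] by blast
  obtain B2 where B2: "\<And>x. norm (D b x) \<le> B2" using continuous_torus_bounded[OF D_cont] by blast
  \<comment> \<open>\<open>B\<close> dominates both distances and \<open>c\<close>, so
    \<open>1 - D a x / B\<close>, \<open>1 - D b x / B\<close> and \<open>1 - c / B\<close> all lie
    between 0 and 1.\<close>
  define B where "B = max B1 (max B2 c)"
  have B: "0 < B" "D a x \<le> B" "D b x \<le> B" "c \<le> B" for x
    using B1[of x] B2[of x] c(1) by (auto simp: B_def le_max_iff_disj)
  have "D b 0 = 0" by (simp add: D_def)
  then have "0 \<in> {x. D b x < c / 2}" using c by simp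
  moreover have "open {x. D b x < c / 2}"
    using D_cont[of b] by (intro open_Collect_less continuous_intros) auto
  ultimately have d: "0 < measure haar {x. D b x < c / 2}" by (intro haar_open_pos) auto
  define d where "d = measure haar {x. D b x < c / 2}"
  have [measurable]: "{x. D b x < c / 2} \<in> sets borel"
    using \<open>open {x. D b x < c / 2}\<close> by (rule borel_open)
  \<comment> \<open>Both ends bound one and the same moment. From above, \<open>D a\<close> is never
    below \<open>c\<close>; from below, \<open>D b\<close> is less than \<open>c / 2\<close> on an
    open set of measure \<open>d\<close>. As \<open>n\<close> grows, the two decay rates are
    incompatible.\<close>
  have le: "d * (1 - c / (2 * B)) ^ n \<le> (1 - c / B) ^ n" for n
  proof -
    have m: "multiplier (\<lambda>x. complex_of_real ((1 - D a x / B) ^ n)) (\<lambda>x. complex_of_real ((1 - D b x / B) ^ n))"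
    proof -
      have "multiplier (\<lambda>x. (1 + (- of_real (1 / B)) * of_real (D a x)) ^ n)
          (\<lambda>x. (1 + (- of_real (1 / B)) * of_real (D b x)) ^ n)"
        by (intro multiplier_power multiplier_add multiplier_mult multiplier_const mD)
      then show ?thesis by simp
    qed
    have int: "integrable haar (\<lambda>x. (1 - D e x / B) ^ n)" for e
      using B(1) by (intro integrable_haar_continuous continuous_intros D_cont) auto
    have eq: "(LINT x|haar. (1 - D a x / B) ^ n) = (LINT x|haar. (1 - D b x / B) ^ n)"
      using multiplier_integral[OF m] unfolding integral_complex_of_real of_real_eq_iff .
    have "d * (1 - c / (2 * B)) ^ n
        = (LINT x|haar. (1 - c / (2 * B)) ^ n * indicator {x. D b x < c / 2} x)"
      by (simp add: d_def)
    also have "\<dots> \<le> (LINT x|haar. (1 - D b x / B) ^ n)"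
    proof (rule integral_mono[OF _ int])
      fix x
      show "(1 - c / (2 * B)) ^ n * indicator {x. D b x < c / 2} x \<le> (1 - D b x / B) ^ n"
      proof (cases "D b x < c / 2")
        case True
        have "1 - c / (2 * B) \<le> 1 - D b x / B" "0 \<le> 1 - c / (2 * B)"
          using True B(1,4) c(1) by (simp_all add: field_simps)
        then show ?thesis using True by (simp add: power_mono)
      qed (use B in \<open>simp add: zero_le_power\<close>)
      have "integrable haar (indicator {x. D b x < c / 2} :: 'n torus \<Rightarrow> real)"
      proof (rule integrable_haar_bounded[where B = 1])
        show "(indicator {x. D b x < c / 2} :: 'n torus \<Rightarrow> real) \<in> borel_measurable borel"
          using \<open>{x. D b x < c / 2} \<in> sets borel\<close> by (rule borel_measurable_indicator)
      qed (simp add: indicator_def)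
      then show "integrable haar (\<lambda>x. (1 - c / (2 * B)) ^ n * indicator {x. D b x < c / 2} x)"
        by (rule integrable_mult_right)
    qed
    also have "\<dots> = (LINT x|haar. (1 - D a x / B) ^ n)" by (rule eq[symmetric])
    also have "\<dots> \<le> (LINT x|(haar :: 'n torus measure). (1 - c / B) ^ n)"
      using c B int by (intro integral_mono power_mono) (simp_all add: divide_right_mono)
    finally show ?thesis by simp
  qed
  have q: "0 < 1 - c / (2 * B)" "0 \<le> 1 - c / B" "1 - c / B < 1 - c / (2 * B)"
    using B(1,4) c(1) by (simp_all add: field_simps)
  have "d \<le> ((1 - c / B) / (1 - c / (2 * B))) ^ n" for n
    using le[of n] q(1) by (simp add: power_divide pos_le_divide_eq)
  moreover have "(\<lambda>n. ((1 - c / B) / (1 - c / (2 * B))) ^ n) \<longlonglongrightarrow> 0"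
    using q by (intro LIMSEQ_power_zero) (simp add: abs_of_nonneg)
  ultimately have "d \<le> 0" by (intro LIMSEQ_le_const) auto
  then show False using d by (simp add: d_def)
qed

text \<open>For every \<open>k\<close> the admissible shifts form a closed set. Finite intersections
  are nonempty by the previous lemma, hence by compactness so is the intersection of all of
  them.\<close>

lemma translation_exists: "\<exists>\<theta>. \<forall>k. b k = a k * torus_char k \<theta>"
proof -
  have "UNIV \<inter> (\<Inter>k\<in>UNIV. {\<theta>. b k = a k * torus_char k \<theta>}) \<noteq> {}"
  proof (rule compact_imp_fip_image[OF compact_torus])
    show "closed {\<theta>. b k = a k * torus_char k \<theta>}" for k
      by (intro closed_Collect_eq continuous_intros)
    fix K :: "(int ^ 'n) set" assume "finite K"
    then show "UNIV \<inter> (\<Inter>k\<in>K. {\<theta>. b k = a k * torus_char k \<theta>}) \<noteq> {}"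
      using finite_translation_exists by blast
  qed
  then show ?thesis by blast
qed

end

section \<open>A law of large numbers for weakly correlated variables\<close>

text \<open>If \<open>j\<^sup>2\<close> is the last square not above \<open>N\<close>, at most
  \<open>2 * j\<close> terms follow it. Divided by \<open>j\<^sup>2\<close>, their bounded sum tends
  to 0.\<close>

lemma averages_tendsto_0_along_squares:
  fixes v :: "nat \<Rightarrow> complex"
  assumes B: "\<And>n. norm (v n) \<le> B"
    and sq: "(\<lambda>j. (\<Sum>n<j\<^sup>2. v n) / of_nat (j\<^sup>2)) \<longlonglongrightarrow> 0"
  shows "(\<lambda>N. (\<Sum>n<N. v n) / of_nat N) \<longlonglongrightarrow> 0"
proof -
  have B0: "0 \<le> B" using B[of 0] norm_ge_zero order_trans by blast
  have fl: "filterlim floor_sqrt at_top sequentially"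
    unfolding filterlim_at_top
  proof
    fix Z
    show "eventually (\<lambda>N. Z \<le> floor_sqrt N) sequentially"
      using eventually_ge_at_top[of "Z\<^sup>2"]
    proof eventually_elim
      case (elim N)
      then have "floor_sqrt (Z\<^sup>2) \<le> floor_sqrt N" by (rule mono_floor_sqrt')
      then show ?case by simp
    qed
  qed
  define r where "r j = norm ((\<Sum>n<j\<^sup>2. v n) / of_nat (j\<^sup>2)) + 2 * B / real j" for j :: nat
  have "(\<lambda>j. norm ((\<Sum>n<j\<^sup>2. v n) / of_nat (j\<^sup>2)) + 2 * B / real j) \<longlonglongrightarrow> 0 + 0"
    by (intro tendsto_add tendsto_norm_zero sq lim_const_over_n)
  then have "r \<longlonglongrightarrow> 0" by (simp add: r_def[abs_def])
  then have lim: "(\<lambda>N. r (floor_sqrt N)) \<longlonglongrightarrow> 0" by (rule filterlim_compose[OF _ fl])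
  show ?thesis
  proof (rule Lim_null_comparison[OF _ lim])
    show "eventually (\<lambda>N. norm ((\<Sum>n<N. v n) / of_nat N) \<le> r (floor_sqrt N)) sequentially"
      using eventually_gt_at_top[of 0]
    proof eventually_elim
      case (elim N)
      define j where "j = floor_sqrt N"
      have j: "0 < j" using elim by (simp add: j_def)
      have jN: "j\<^sup>2 \<le> N" unfolding j_def by (rule floor_sqrt_power2_le)
      have "N < (Suc j)\<^sup>2" unfolding j_def by (rule Suc_floor_sqrt_power2_gt)
      then have Nj: "N - j\<^sup>2 \<le> 2 * j" by (simp add: power2_eq_square)
      have "(\<Sum>n<N. v n) = (\<Sum>n<j\<^sup>2. v n) + (\<Sum>n\<in>{j\<^sup>2..<N}. v n)"
        using jN by (simp add: lessThan_atLeast0 sum.atLeastLessThan_concat)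
      moreover have "norm (\<Sum>n\<in>{j\<^sup>2..<N}. v n) \<le> of_nat (card {j\<^sup>2..<N}) * B"
        by (intro sum_norm_bound B)
      moreover have "of_nat (card {j\<^sup>2..<N}) * B \<le> (2 * real j) * B"
      proof (rule mult_right_mono[OF _ B0])
        have "real (N - j\<^sup>2) \<le> real (2 * j)" using Nj by (simp only: of_nat_le_iff)
        then show "of_nat (card {j\<^sup>2..<N}) \<le> 2 * real j" by simp
      qed
      ultimately have "norm (\<Sum>n<N. v n) \<le> norm (\<Sum>n<j\<^sup>2. v n) + 2 * real j * B"
        using norm_triangle_ineq[of "\<Sum>n<j\<^sup>2. v n" "\<Sum>n\<in>{j\<^sup>2..<N}. v n"] by simp
      then have "norm ((\<Sum>n<N. v n) / of_nat N) \<le> (norm (\<Sum>n<j\<^sup>2. v n) + 2 * real j * B) / real N"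
        by (simp add: norm_divide divide_right_mono)
      also have "\<dots> \<le> (norm (\<Sum>n<j\<^sup>2. v n) + 2 * real j * B) / real (j\<^sup>2)"
        using elim j jN B0
        by (intro divide_left_mono mult_pos_pos add_nonneg_nonneg) (simp_all del: of_nat_power)
      also have "\<dots> = r j" using j by (simp add: r_def norm_divide power2_eq_square field_simps norm_power norm_mult)
      finally show ?case by (simp add: j_def)
    qed
  qed
qed

context prob_space begin

lemma integrable_norm_sum_sq:
  fixes V :: "nat \<Rightarrow> 'a \<Rightarrow> complex"
  assumes [measurable]: "\<And>n. V n \<in> borel_measurable M" and B: "\<And>n \<omega>. norm (V n \<omega>) \<le> B"
  shows "integrable M (\<lambda>\<omega>. (norm (\<Sum>n<N. V n \<omega>))\<^sup>2)"
proof (rule integrable_const_bound[where B = "(real N * B)\<^sup>2"])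
  have "norm (\<Sum>n<N. V n \<omega>) \<le> real N * B" for \<omega>
    using sum_norm_bound[of "{..<N}" "\<lambda>n. V n \<omega>" B] B by simp
  then show "AE \<omega> in M. norm ((norm (\<Sum>n<N. V n \<omega>))\<^sup>2) \<le> (real N * B)\<^sup>2"
    by (intro AE_I2) (auto intro: power_mono)
qed measurable

text \<open>The second moment of the average of \<open>N\<close> terms is at most
  \<open>C / N\<close>. Along squares these bounds are summable, so the series of squared averages
  is almost surely finite and its terms tend to 0; boundedness fills the gaps between
  squares.\<close>

lemma bounded_averages_tendsto_0:
  fixes V :: "nat \<Rightarrow> 'a \<Rightarrow> complex"
  assumes [measurable]: "\<And>n. V n \<in> borel_measurable M" and B: "\<And>n \<omega>. norm (V n \<omega>) \<le> B"
    and var: "\<And>N. expectation (\<lambda>\<omega>. (norm (\<Sum>n<N. V n \<omega>))\<^sup>2) \<le> C * real N"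
  shows "AE \<omega> in M. (\<lambda>N. (\<Sum>n<N. V n \<omega>) / of_nat N) \<longlonglongrightarrow> 0"
proof -
  \<comment> \<open>Starting at \<open>Suc j\<close> keeps the denominator positive.\<close>
  define a where "a j \<omega> = (norm ((\<Sum>n<(Suc j)\<^sup>2. V n \<omega>) / of_nat ((Suc j)\<^sup>2)))\<^sup>2" for j \<omega>
  have [measurable]: "a j \<in> borel_measurable M" for j unfolding a_def by measurable
  have C: "0 \<le> C"
  proof -
    have "0 \<le> expectation (\<lambda>\<omega>. (norm (\<Sum>n<1. V n \<omega>))\<^sup>2)" by (intro integral_nonneg_AE) auto
    also have "\<dots> \<le> C * real 1" by (rule var)
    finally show ?thesis by simp
  qed
  have B0: "0 \<le> B" using B norm_ge_zero order_trans by blast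
  note S_int = integrable_norm_sum_sq[of V B, OF assms(1) B]
  have a_int: "(\<integral>\<^sup>+\<omega>. ennreal (a j \<omega>) \<partial>M) \<le> ennreal (C / (real (Suc j))\<^sup>2)" for j
  proof -
    let ?N = "(Suc j)\<^sup>2"
    have a: "a j \<omega> = (norm (\<Sum>n<?N. V n \<omega>))\<^sup>2 / (real ?N)\<^sup>2" for \<omega>
      by (simp only: a_def norm_divide norm_of_nat power_divide)
    have int: "integrable M (a j)" unfolding a[abs_def] using S_int[of ?N] by simp
    have "(\<integral>\<^sup>+\<omega>. ennreal (a j \<omega>) \<partial>M) = ennreal (expectation (a j))"
      by (rule nn_integral_eq_integral[OF int]) (simp add: a_def)
    also have "expectation (a j) = expectation (\<lambda>\<omega>. (norm (\<Sum>n<?N. V n \<omega>))\<^sup>2) / (real ?N)\<^sup>2"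
      unfolding a[abs_def] by simp
    also have "\<dots> \<le> C * real ?N / (real ?N)\<^sup>2"
      using var[of ?N] by (intro divide_right_mono) auto
    also have "\<dots> = C / (real (Suc j))\<^sup>2"
    proof -
      have "C * y / y\<^sup>2 = C / y" if "0 < y" for y using that by (simp add: power2_eq_square)
      from this[of "real ?N"] show ?thesis by (simp only: of_nat_power) simp
    qed
    finally show ?thesis by (simp add: ennreal_leI)
  qed
  have sum: "summable (\<lambda>j. C / (real (Suc j))\<^sup>2)"
  proof -
    have "summable (\<lambda>n. inverse ((real n)\<^sup>2))" by (rule inverse_power_summable) simp
    then have "summable (\<lambda>n. inverse ((real (Suc n))\<^sup>2))" by (subst summable_Suc_iff)
    then show ?thesis unfolding divide_inverse by (rule summable_mult)
  qed
  have "(\<integral>\<^sup>+\<omega>. (\<Sum>j. ennreal (a j \<omega>)) \<partial>M) = (\<Sum>j. \<integral>\<^sup>+\<omega>. ennreal (a j \<omega>) \<partial>M)"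
    by (intro nn_integral_suminf) measurable
  also have "\<dots> \<le> (\<Sum>j. ennreal (C / (real (Suc j))\<^sup>2))"
    by (intro suminf_le a_int summableI)
  also have "\<dots> = ennreal (\<Sum>j. C / (real (Suc j))\<^sup>2)"
    using C sum by (intro suminf_ennreal2) auto
  also have "\<dots> < \<infinity>" by simp
  finally have "AE \<omega> in M. (\<Sum>j. ennreal (a j \<omega>)) \<noteq> \<infinity>"
    by (intro nn_integral_PInf_AE) auto
  then show ?thesis
  proof eventually_elim
    case (elim \<omega>)
    have "summable (\<lambda>j. a j \<omega>)"
      using elim by (intro summable_suminf_not_top) (auto simp: a_def)
    then have "(\<lambda>j. a j \<omega>) \<longlonglongrightarrow> 0" by (rule summable_LIMSEQ_zero)
    then have "(\<lambda>j. sqrt (a j \<omega>)) \<longlonglongrightarrow> sqrt 0" by (rule tendsto_real_sqrt)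
    then have "(\<lambda>j. (\<Sum>n<(Suc j)\<^sup>2. V n \<omega>) / of_nat ((Suc j)\<^sup>2)) \<longlonglongrightarrow> 0"
      unfolding a_def by (simp only: real_sqrt_abs abs_norm_cancel real_sqrt_zero tendsto_norm_zero_iff)
    then have "(\<lambda>j. (\<Sum>n<j\<^sup>2. V n \<omega>) / of_nat (j\<^sup>2)) \<longlonglongrightarrow> 0"
      by (subst (asm) filterlim_sequentially_Suc)
    then show ?case by (rule averages_tendsto_0_along_squares[OF B])
  qed
qed

text \<open>Adding the term with index \<open>N\<close> costs twice the real part of its
  correlations with all earlier ones plus its own square. Only the norm of the summed correlations
  is bounded, so cancellation inside that sum can be exploited.\<close>

lemma second_moment_sum_le:
  fixes V :: "nat \<Rightarrow> 'a \<Rightarrow> complex"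
  assumes [measurable]: "\<And>n. V n \<in> borel_measurable M" and B: "\<And>n \<omega>. norm (V n \<omega>) \<le> B"
    and cov: "\<And>N. norm (\<Sum>n<N. expectation (\<lambda>\<omega>. V n \<omega> * cnj (V N \<omega>))) \<le> C"
  shows "expectation (\<lambda>\<omega>. (norm (\<Sum>n<N. V n \<omega>))\<^sup>2) \<le> (2 * C + B\<^sup>2) * real N"
proof (induction N)
  case (Suc N)
  have B0: "0 \<le> B" using B norm_ge_zero order_trans by blast
  note S_int = integrable_norm_sum_sq[of V B, OF assms(1) B]
  have V_int: "integrable M (\<lambda>\<omega>. V n \<omega> * cnj (V N \<omega>))" for n N
    by (rule integrable_const_bound[where B = "B * B"])
      (auto simp: norm_mult intro!: AE_I2 mult_mono B B0)
  have VN_int: "integrable M (\<lambda>\<omega>. (norm (V N \<omega>))\<^sup>2)"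
    by (rule integrable_const_bound[where B = "B\<^sup>2"]) (auto intro!: AE_I2 power_mono B)
  have eq: "(norm (\<Sum>n<Suc N. V n \<omega>))\<^sup>2 = (norm (\<Sum>n<N. V n \<omega>))\<^sup>2
      + 2 * Re (\<Sum>n<N. V n \<omega> * cnj (V N \<omega>)) + (norm (V N \<omega>))\<^sup>2" for \<omega>
  proof -
    have "(norm (a + b))\<^sup>2 = (norm a)\<^sup>2 + 2 * Re (a * cnj b) + (norm b)\<^sup>2" for a b :: complex
      unfolding cmod_power2 by (simp add: power2_eq_square algebra_simps)
    then show ?thesis by (simp only: sum.lessThan_Suc sum_distrib_right)
  qed
  have "expectation (\<lambda>\<omega>. (norm (\<Sum>n<Suc N. V n \<omega>))\<^sup>2)
      = expectation (\<lambda>\<omega>. (norm (\<Sum>n<N. V n \<omega>))\<^sup>2)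
        + 2 * expectation (\<lambda>\<omega>. Re (\<Sum>n<N. V n \<omega> * cnj (V N \<omega>))) + expectation (\<lambda>\<omega>. (norm (V N \<omega>))\<^sup>2)"
  proof -
    have "integrable M (\<lambda>\<omega>. Re (\<Sum>n<N. V n \<omega> * cnj (V N \<omega>)))"
      by (intro integrable_Re Bochner_Integration.integrable_sum V_int)
    then show ?thesis
      unfolding eq using S_int[of N] VN_int by (simp del: Re_sum times_complex.sel)
  qed
  also have "expectation (\<lambda>\<omega>. Re (\<Sum>n<N. V n \<omega> * cnj (V N \<omega>)))
      = Re (\<Sum>n<N. expectation (\<lambda>\<omega>. V n \<omega> * cnj (V N \<omega>)))"
    using V_int by (subst integral_Re) simp_all
  also have "\<dots> \<le> C" using complex_Re_le_cmod cov order_trans by blast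
  also have "expectation (\<lambda>\<omega>. (norm (V N \<omega>))\<^sup>2) \<le> B\<^sup>2"
    using VN_int B by (intro integral_le_const) (auto intro!: AE_I2 power_mono)
  finally show ?case using Suc by (simp add: algebra_simps)
qed simp

end

section \<open>Equidistribution of words along the walk\<close>

text \<open>The probabilistic input is reduced to the joint characteristic function of consecutive
  increments. The law of \<open>Z 0\<close>, and its dependence on the increments, remain
  free.\<close>

locale char_walk = prob_space M
  for M :: "'w measure" +
  fixes Z :: "nat \<Rightarrow> 'w \<Rightarrow> 'n::finite torus" and l :: "int ^ 'n \<Rightarrow> complex"
  assumes Z_measurable [measurable]: "\<And>n. Z n \<in> borel_measurable M"
    and increments: "\<And>c N. expectation (\<lambda>\<omega>. \<Prod>j<N. torus_char (c j) (Z (Suc j) \<omega> - Z j \<omega>)) = (\<Prod>j<N. l (c j))"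
    and l_uminus: "\<And>k. l (- k) = cnj (l k)" and l_0: "l 0 = 1"
    and norm_l: "\<And>k. norm (l k) \<le> 1" and l_neq: "\<And>k. k \<noteq> 0 \<Longrightarrow> l k \<noteq> 1"
begin

primrec W :: "(int ^ 'n) list \<Rightarrow> nat \<Rightarrow> 'w \<Rightarrow> complex" where
  "W [] n \<omega> = 1"
| "W (k # ks) n \<omega> = torus_char k (Z n \<omega>) * W ks (Suc n) \<omega>"

text \<open>Counterpart of \<open>W\<close> for increments; unlike those of \<open>W\<close>, its
  expectations are determined by \<open>l\<close> without knowledge of the starting point.\<close>

primrec R :: "(int ^ 'n) list \<Rightarrow> nat \<Rightarrow> 'w \<Rightarrow> complex" where
  "R [] n \<omega> = 1"
| "R (k # ks) n \<omega> = torus_char k (Z (Suc n) \<omega> - Z n \<omega>) * R ks (Suc n) \<omega>"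

end

text \<open>Exponents of the increments when a word is expanded around its first position.\<close>

primrec tail_sums :: "(int ^ 'n::finite) list \<Rightarrow> (int ^ 'n) list" where
  "tail_sums [] = []"
| "tail_sums (k # ks) = sum_list ks # tail_sums ks"

lemma length_tail_sums [simp]: "length (tail_sums ks) = length ks"
  by (induction ks) simp_all

context char_walk begin

lemma W_measurable [measurable]: "W ks n \<in> borel_measurable M"
proof (induction ks arbitrary: n)
  case Nil
  have "W [] n = (\<lambda>_. 1)" by (simp add: fun_eq_iff)
  then show ?case by simp
next
  case (Cons k ks)
  note [measurable] = Cons
  have "W (k # ks) n = (\<lambda>\<omega>. torus_char k (Z n \<omega>) * W ks (Suc n) \<omega>)" by (simp add: fun_eq_iff)
  then show ?case by simp
qed

lemma R_measurable [measurable]: "R ks n \<in> borel_measurable M"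
proof (induction ks arbitrary: n)
  case Nil
  have "R [] n = (\<lambda>_. 1)" by (simp add: fun_eq_iff)
  then show ?case by simp
next
  case (Cons k ks)
  note [measurable] = Cons
  have "torus_char k (x - y) = torus_char k x * cnj (torus_char k y)" for x y
    by (metis diff_conv_add_uminus torus_char_add torus_char_uminus_right)
  then have "R (k # ks) n = (\<lambda>\<omega>. torus_char k (Z (Suc n) \<omega>) * cnj (torus_char k (Z n \<omega>)) * R ks (Suc n) \<omega>)"
    by (simp add: fun_eq_iff)
  then show ?case by simp
qed

lemma norm_W: "norm (W ks n \<omega>) = 1"
  by (induction ks arbitrary: n) (simp_all add: norm_mult)

text \<open>Each later position is the first one plus the increments in between, so an increment is
  weighted with the sum of all frequencies that come after it.\<close>

lemma W_eq: "W ks n \<omega> = torus_char (sum_list ks) (Z n \<omega>) * R (tail_sums ks) n \<omega>"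
proof (induction ks arbitrary: n)
  case (Cons k ks)
  have "torus_char (sum_list ks) (Z (Suc n) \<omega>)
      = torus_char (sum_list ks) (Z n \<omega>) * torus_char (sum_list ks) (Z (Suc n) \<omega> - Z n \<omega>)"
    by (simp add: torus_char_add[symmetric])
  then show ?case using Cons by (simp add: torus_char_add_left mult_ac)
qed simp

lemma R_append: "R (cs @ cs') n \<omega> = R cs n \<omega> * R cs' (n + length cs) \<omega>"
  by (induction cs arbitrary: n) (simp_all add: mult.assoc)

lemma R_uminus: "R (map uminus cs) n \<omega> = cnj (R cs n \<omega>)"
  by (induction cs arbitrary: n) (simp_all add: torus_char_uminus)

lemma R_replicate: "R (replicate q k) n \<omega> = torus_char k (Z (n + q) \<omega> - Z n \<omega>)"
proof (induction q arbitrary: n)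
  case (Suc q)
  then show ?case by (simp add: torus_char_add[symmetric])
qed simp

lemma R_map_diff: "R (map (\<lambda>d. d - k) cs) n \<omega> = R cs n \<omega> * R (replicate (length cs) (- k)) n \<omega>"
proof (induction cs arbitrary: n)
  case (Cons c cs)
  have "torus_char (c - k) x = torus_char c x * torus_char (- k) x" for x
    by (simp add: torus_char_add_left[symmetric])
  then show ?case using Cons by (simp add: mult_ac)
qed simp

lemma R_prod: "R cs n \<omega> = (\<Prod>j<length cs. torus_char (cs ! j) (Z (Suc (n + j)) \<omega> - Z (n + j) \<omega>))"
proof (induction cs arbitrary: n)
  case (Cons c cs)
  then show ?case by (simp add: prod.lessThan_Suc_shift del: prod.lessThan_Suc)
qed simp

lemma expectation_R: "expectation (R cs n) = prod_list (map l cs)"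
proof -
  have "expectation (R cs 0) = prod_list (map l cs)" for cs
  proof -
    have "expectation (R cs 0) = (\<Prod>j<length cs. l (cs ! j))"
      unfolding R_prod[abs_def] using increments[of "\<lambda>j. cs ! j" "length cs"] by simp
    also have "\<dots> = prod_list (map l cs)"
      by (simp add: prod.list_conv_set_nth lessThan_atLeast0)
    finally show ?thesis .
  qed
  \<comment> \<open>Zero frequencies in front move the starting index from 0 to \<open>n\<close>
    without changing value or expectation, as \<open>l 0 = 1\<close>.\<close>
  from this[of "replicate n 0 @ cs"] show ?thesis
    by (simp add: R_append R_replicate l_0 cong: Bochner_Integration.integral_cong)
qed

text \<open>The start enters only through the character \<open>- L\<close> of
  \<open>Z N - Z n\<close>, so each increment between \<open>n\<close> and \<open>N\<close> receives
  an extra \<open>- L\<close>. Because the words do not overlap, three blocks appear: the increments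
  of the first word with shifted exponents, the gap with \<open>- L\<close> alone, and the
  conjugated second word.\<close>

lemma W_cov:
  assumes "n + length ks \<le> N"
  defines "L \<equiv> sum_list ks"
  shows "expectation (\<lambda>\<omega>. W ks n \<omega> * cnj (W ks N \<omega>))
    = prod_list (map (\<lambda>d. l (d - L)) (tail_sums ks)) * l (- L) ^ (N - n - length ks)
      * cnj (prod_list (map l (tail_sums ks)))"
proof -
  define m where "m = length ks"
  define cs where "cs = map (\<lambda>d. d - L) (tail_sums ks) @ replicate (N - n - m) (- L) @ map uminus (tail_sums ks)"
  have eq: "W ks n \<omega> * cnj (W ks N \<omega>) = R cs n \<omega>" for \<omega>
  proof -
    have "R (replicate m (- L)) n \<omega> * R (replicate (N - n - m) (- L)) (n + m) \<omega>
        = torus_char (- L) (Z N \<omega> - Z n \<omega>)"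
      using assms(1) by (simp add: R_replicate m_def torus_char_add[symmetric])
    also have "\<dots> = torus_char L (Z n \<omega>) * cnj (torus_char L (Z N \<omega>))"
      by (simp add: diff_conv_add_uminus torus_char_add torus_char_uminus torus_char_uminus_right mult.commute
          del: add_uminus_conv_diff)
    finally have "R cs n \<omega> = torus_char L (Z n \<omega>) * cnj (torus_char L (Z N \<omega>)) * R (tail_sums ks) n \<omega>
        * cnj (R (tail_sums ks) N \<omega>)"
      using assms(1) by (simp add: cs_def R_append R_map_diff R_uminus m_def mult_ac)
    then show ?thesis by (simp add: W_eq L_def mult_ac)
  qed
  have "prod_list (map l (map uminus ds)) = cnj (prod_list (map l ds))" for ds
    by (induction ds) (simp_all add: l_uminus)
  then show ?thesis
    unfolding eq expectation_R by (simp add: cs_def m_def comp_def mult.assoc prod_list_replicate)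
qed

text \<open>For \<open>l = ev\<close> this is the Haar integral of the nested word of characters, as
  \<open>nest_chars\<close> shows.\<close>

definition W_limit :: "(int ^ 'n) list \<Rightarrow> complex" where
  "W_limit ks = (if sum_list ks = 0 then prod_list (map l (tail_sums ks)) else 0)"

lemma norm_prod_list_l: "norm (prod_list (map l ds)) \<le> 1"
  by (induction ds) (auto simp: norm_mult intro: mult_le_one norm_l)

text \<open>At most \<open>m\<close> words overlap a given one and contribute boundedly. For the
  others, the correlations vanish exactly if \<open>L = 0\<close>; if \<open>L\<close> is nonzero,
  they form a geometric progression with ratio \<open>l (- L)\<close> different from 1, whose
  partial sums are bounded. In the latter case the mean of \<open>W\<close> depends on the unknown
  start, so the correlations are taken around 0 and not around that mean.\<close>

lemma W_averages_AE:
  "AE \<omega> in M. (\<lambda>N. (\<Sum>n<N. W ks n \<omega>) / of_nat N) \<longlonglongrightarrow> W_limit ks"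
proof -
  define m where "m = length ks"
  define L where "L = sum_list ks"
  define \<kappa> where "\<kappa> = prod_list (map l (tail_sums ks))"
  define c where "c = W_limit ks"
  define V where "V n \<omega> = W ks n \<omega> - c" for n \<omega>
  have nk: "norm \<kappa> \<le> 1" unfolding \<kappa>_def by (rule norm_prod_list_l)
  have nc: "norm c \<le> 1" using norm_prod_list_l by (simp add: c_def W_limit_def)
  have [measurable]: "V n \<in> borel_measurable M" for n unfolding V_def by measurable
  have V2: "norm (V n \<omega>) \<le> 2" for n \<omega>
    using norm_triangle_ineq4[of "W ks n \<omega>" c] nc norm_W[of ks n \<omega>] unfolding V_def by linarith
  have W_int: "integrable M (W ks n)" for n
    by (rule integrable_const_bound[where B = 1]) (auto simp: norm_W)
  have WW_int: "integrable M (\<lambda>\<omega>. W ks n \<omega> * cnj (W ks N \<omega>))" for n N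
    by (rule integrable_const_bound[where B = 1]) (auto simp: norm_mult norm_W)
  define r where "r n N = expectation (\<lambda>\<omega>. V n \<omega> * cnj (V N \<omega>))" for n N
  have r4: "norm (r n N) \<le> 4" for n N
  proof -
    have VV: "norm (V n \<omega> * cnj (V N \<omega>)) \<le> 2 * 2" for \<omega>
      unfolding norm_mult complex_mod_cnj by (intro mult_mono V2) auto
    then have i: "integrable M (\<lambda>\<omega>. V n \<omega> * cnj (V N \<omega>))"
      by (intro integrable_const_bound[where B = "2 * 2"] AE_I2) auto
    have "norm (r n N) \<le> expectation (\<lambda>\<omega>. norm (V n \<omega> * cnj (V N \<omega>)))"
      unfolding r_def by (rule integral_norm_bound)
    also have "\<dots> \<le> 2 * 2"
      using i VV by (intro integral_le_const AE_I2) auto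
    finally show ?thesis by simp
  qed
  obtain C where C: "\<And>N. norm (\<Sum>n | n < N \<and> n + m \<le> N. r n N) \<le> C" "0 \<le> C"
  proof (cases "L = 0")
    case True
    have c: "c = \<kappa>" using True by (simp add: c_def W_limit_def \<kappa>_def L_def)
    have EW: "expectation (W ks n) = \<kappa>" for n
      using expectation_R[of "tail_sums ks" n] True by (simp add: W_eq[abs_def] L_def \<kappa>_def)
    have "r n N = 0" if "n + m \<le> N" for n N
    proof -
      have "V n \<omega> * cnj (V N \<omega>) = W ks n \<omega> * cnj (W ks N \<omega>) - W ks n \<omega> * cnj \<kappa> - \<kappa> * cnj (W ks N \<omega>) + \<kappa> * cnj \<kappa>" for \<omega>
        by (simp add: V_def c algebra_simps)
      then have "r n N = expectation (\<lambda>\<omega>. W ks n \<omega> * cnj (W ks N \<omega>)) - \<kappa> * cnj \<kappa>"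
        unfolding r_def using W_int WW_int prob_space by (simp add: EW)
      also have "expectation (\<lambda>\<omega>. W ks n \<omega> * cnj (W ks N \<omega>)) = \<kappa> * cnj \<kappa>"
        using W_cov[of n ks N] that True by (simp add: m_def L_def l_0 \<kappa>_def)
      finally show ?thesis by simp
    qed
    then show ?thesis by (intro that[of 0]) simp_all
  next
    case False
    then have m: "0 < m" by (auto simp: m_def L_def)
    have c: "c = 0" using False by (simp add: c_def W_limit_def L_def)
    define z where "z = l (- L)"
    have z: "z \<noteq> 1" "norm z \<le> 1" unfolding z_def using False l_neq[of "- L"] norm_l by auto
    define a where "a = prod_list (map (\<lambda>d. l (d - L)) (tail_sums ks))"
    have na: "norm a \<le> 1"
      using norm_prod_list_l[of "map (\<lambda>d. d - L) (tail_sums ks)"] by (simp add: a_def comp_def)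
    have r: "r n N = a * cnj \<kappa> * z ^ (N - n - m)" if "n + m \<le> N" for n N
      using W_cov[of n ks N] that by (simp add: r_def V_def c m_def a_def \<kappa>_def L_def z_def mult_ac)
    have "norm (\<Sum>n | n < N \<and> n + m \<le> N. r n N) \<le> 2 / norm (1 - z)" for N
    proof (cases "m \<le> N")
      case mN: True
      \<comment> \<open>The admissible \<open>n\<close> are those up to \<open>N - m\<close>, hence
        \<open>q\<close> of them, and the exponent \<open>N - n - m\<close> becomes
        \<open>q - Suc n\<close>: the geometric sum in reverse order.\<close>
      define q where "q = Suc (N - m)"
      have set: "{n. n < N \<and> n + m \<le> N} = {..<q}" using mN m by (auto simp: q_def)
      have "(\<Sum>n | n < N \<and> n + m \<le> N. r n N) = (\<Sum>n<q. a * cnj \<kappa> * z ^ (q - Suc n))"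
        unfolding set using mN by (intro sum.cong refl) (simp add: r q_def add.commute)
      also have "\<dots> = a * cnj \<kappa> * (\<Sum>n<q. z ^ n)"
        by (subst sum_distrib_left[symmetric], subst sum.nat_diff_reindex) simp
      also have "(\<Sum>n<q. z ^ n) = (1 - z ^ q) / (1 - z)"
        using z(1) by (simp add: sum_gp_strict)
      finally have eq: "(\<Sum>n | n < N \<and> n + m \<le> N. r n N) = a * cnj \<kappa> * ((1 - z ^ q) / (1 - z))" .
      have "norm (1 - z ^ q) \<le> 2"
        using norm_triangle_ineq4[of 1 "z ^ q"] power_le_one[OF norm_ge_zero z(2), of q] by (simp add: norm_power)
      moreover have "norm (a * cnj \<kappa>) \<le> 1" using na nk by (simp add: norm_mult mult_le_one)
      ultimately have "norm (a * cnj \<kappa>) * (norm (1 - z ^ q) / norm (1 - z)) \<le> 1 * (2 / norm (1 - z))"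
        by (intro mult_mono divide_right_mono) auto
      then show ?thesis unfolding eq by (simp add: norm_mult norm_divide)
    next
      case False
      then have "{n. n < N \<and> n + m \<le> N} = {}" by auto
      then show ?thesis by (simp only: sum.empty) simp
    qed
    then show ?thesis by (intro that[of "2 / norm (1 - z)"]) auto
  qed
  have "norm (\<Sum>n<N. r n N) \<le> C + 4 * real m" for N
  proof -
    have split: "{..<N} = {n. n < N \<and> n + m \<le> N} \<union> {n. n < N \<and> N < n + m}" by auto
    have "(\<Sum>n<N. r n N) = (\<Sum>n | n < N \<and> n + m \<le> N. r n N) + (\<Sum>n | n < N \<and> N < n + m. r n N)"
      by (subst split, rule sum.union_disjoint) auto
    moreover have "norm (\<Sum>n | n < N \<and> N < n + m. r n N) \<le> of_nat (card {n. n < N \<and> N < n + m}) * 4"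
      by (intro sum_norm_bound r4)
    moreover have "card {n. n < N \<and> N < n + m} \<le> m"
    proof -
      have "card {n. n < N \<and> N < n + m} \<le> card {N - m..<N}" by (intro card_mono) auto
      then show ?thesis by simp
    qed
    ultimately show ?thesis
      using C(1)[of N] norm_triangle_ineq[of "\<Sum>n | n < N \<and> n + m \<le> N. r n N" "\<Sum>n | n < N \<and> N < n + m. r n N"]
      by simp
  qed
  then have cov: "norm (\<Sum>n<N. expectation (\<lambda>\<omega>. V n \<omega> * cnj (V N \<omega>))) \<le> C + 4 * real m" for N
    unfolding r_def .
  have "AE \<omega> in M. (\<lambda>N. (\<Sum>n<N. V n \<omega>) / of_nat N) \<longlonglongrightarrow> 0"
    by (rule bounded_averages_tendsto_0[OF \<open>\<And>n. V n \<in> borel_measurable M\<close> V2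
          second_moment_sum_le[OF \<open>\<And>n. V n \<in> borel_measurable M\<close> V2 cov]])
  then show ?thesis
  proof eventually_elim
    case (elim \<omega>)
    then have "(\<lambda>N. (\<Sum>n<N. V n \<omega>) / of_nat N + c) \<longlonglongrightarrow> 0 + c" by (intro tendsto_add tendsto_const)
    then have "(\<lambda>N. (\<Sum>n<N. V n \<omega>) / of_nat N + c) \<longlonglongrightarrow> c" by simp
    moreover have "eventually (\<lambda>N. (\<Sum>n<N. V n \<omega>) / of_nat N + c = (\<Sum>n<N. W ks n \<omega>) / of_nat N) sequentially"
      using eventually_gt_at_top[of 0]
      by eventually_elim (simp add: V_def sum_subtractf diff_divide_distrib)
    ultimately show ?case unfolding c_def by (rule Lim_transform_eventually)
  qed
qed

text \<open>There are countably many words over integer vectors, which gives one null set for all of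
  them and, later, for all indicator functions.\<close>

lemma W_averages_AE_all:
  "AE \<omega> in M. \<forall>ks. (\<lambda>N. (\<Sum>n<N. W ks n \<omega>) / of_nat N) \<longlonglongrightarrow> W_limit ks"
  unfolding AE_all_countable using W_averages_AE by blast

end

section \<open>Nested correlations as averages along a path\<close>

lemma tendsto_if_approx:
  fixes A :: "nat \<Rightarrow> complex"
  assumes "\<And>e. 0 < e \<Longrightarrow> \<exists>B b. B \<longlonglongrightarrow> b \<and> norm (b - a) \<le> e \<and>
      eventually (\<lambda>N. norm (A N - B N) \<le> e) sequentially"
  shows "A \<longlonglongrightarrow> a"
proof (rule tendstoI)
  fix e :: real assume "0 < e"
  then obtain B b where *: "B \<longlonglongrightarrow> b" "norm (b - a) \<le> e / 4"
      "eventually (\<lambda>N. norm (A N - B N) \<le> e / 4) sequentially"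
    using assms[of "e / 4"] by auto
  have "eventually (\<lambda>N. dist (B N) b < e / 4) sequentially"
    using *(1) \<open>0 < e\<close> by (intro tendstoD) auto
  with *(3) show "eventually (\<lambda>N. dist (A N) a < e) sequentially"
  proof eventually_elim
    case (elim N)
    have "A N - a = (A N - B N) + (B N - b) + (b - a)" by simp
    then have "norm (A N - a) \<le> norm (A N - B N) + norm (B N - b) + norm (b - a)"
      by (metis norm_triangle_le norm_triangle_ineq order_refl add_mono)
    then show ?case using elim *(2) \<open>0 < e\<close> by (simp add: dist_norm)
  qed
qed

primrec path_prod :: "('x \<Rightarrow> complex) list \<Rightarrow> (nat \<Rightarrow> 'x) \<Rightarrow> nat \<Rightarrow> complex" where
  "path_prod [] z n = 1"
| "path_prod (h # hs) z n = h (z n) * path_prod hs z (Suc n)"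

lemma path_prod_add:
  "path_prod (hs @ (\<lambda>x. p x + q x) # hs') z n
    = path_prod (hs @ p # hs') z n + path_prod (hs @ q # hs') z n"
  by (induction hs arbitrary: n) (simp_all add: distrib_left distrib_right)

lemma path_prod_scale:
  "path_prod (hs @ (\<lambda>x. c * p x) # hs') z n = c * path_prod (hs @ p # hs') z n"
  by (induction hs arbitrary: n) (simp_all add: mult_ac)

lemma path_prod_replicate: "path_prod (replicate i (\<lambda>_. 1) @ hs) z n = path_prod hs z (n + i)"
  by (induction i arbitrary: n) simp_all

lemma norm_path_prod_le:
  assumes "\<And>h x. h \<in> set hs \<Longrightarrow> norm (h x) \<le> B"
  shows "norm (path_prod hs z n) \<le> B ^ length hs"
  using assms
proof (induction hs arbitrary: n)
  case (Cons h hs)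
  have "norm (h (z n)) \<le> B" using Cons.prems by simp
  moreover have "norm (path_prod hs z (Suc n)) \<le> B ^ length hs" using Cons by simp
  ultimately show ?case
    by (simp add: norm_mult) (meson mult_mono norm_ge_zero order_trans)
qed simp

definition path_average :: "(nat \<Rightarrow> complex) \<Rightarrow> nat \<Rightarrow> complex" where
  "path_average v N = (\<Sum>n<N. v n) / of_nat N"

lemma path_average_add: "path_average (\<lambda>n. v n + w n) N = path_average v N + path_average w N"
  by (simp add: path_average_def sum.distrib add_divide_distrib)

lemma path_average_scale: "path_average (\<lambda>n. c * v n) N = c * path_average v N"
  by (simp add: path_average_def sum_distrib_left)

lemma path_average_sum:
  "finite I \<Longrightarrow> path_average (\<lambda>n. \<Sum>i\<in>I. v i n) N = (\<Sum>i\<in>I. path_average (v i) N)"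
  by (induction I rule: finite_induct) (simp_all add: path_average_add, simp add: path_average_def)

lemma norm_path_average_diff_le:
  assumes "\<And>n. norm (v n - w n) \<le> g n"
  shows "norm (path_average v N - path_average w N) \<le> Re (path_average (\<lambda>n. complex_of_real (g n)) N)"
proof -
  have "norm (path_average v N - path_average w N) = norm (\<Sum>n<N. v n - w n) / real N"
    by (simp add: path_average_def sum_subtractf diff_divide_distrib[symmetric] norm_divide)
  also have "\<dots> \<le> (\<Sum>n<N. g n) / real N"
    by (intro divide_right_mono sum_norm_le assms) auto
  also have "\<dots> = Re (path_average (\<lambda>n. complex_of_real (g n)) N)"
    by (simp add: path_average_def Re_divide_of_nat)
  finally show ?thesis .
qed

context torus_walk begin

lemma nest_scale: "nest (hs @ (\<lambda>x. c * p x) # hs') = (\<lambda>x. c * nest (hs @ p # hs') x)"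
  by (induction hs) (simp_all add: P_scale mult_ac)

lemma nest_add:
  assumes "\<And>h. h \<in> set (hs @ p # q # hs') \<Longrightarrow> trig_approx h"
  shows "nest (hs @ (\<lambda>x. p x + q x) # hs') = (\<lambda>x. nest (hs @ p # hs') x + nest (hs @ q # hs') x)"
  using assms
proof (induction hs)
  case Nil
  then show ?case by (simp add: distrib_right)
next
  case (Cons h hs)
  have ta: "trig_approx (nest (hs @ p # hs'))" "trig_approx (nest (hs @ q # hs'))"
    using Cons.prems by (auto intro!: trig_approx_nest)
  obtain B where B: "\<forall>x. norm (nest (hs @ p # hs') x) \<le> B" using trig_approx_bounded[OF ta(1)] by (elim exE)
  obtain C where C: "\<forall>x. norm (nest (hs @ q # hs') x) \<le> C" using trig_approx_bounded[OF ta(2)] by (elim exE)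
  have "nest (hs @ (\<lambda>x. p x + q x) # hs') = (\<lambda>x. nest (hs @ p # hs') x + nest (hs @ q # hs') x)"
    using Cons by simp
  then show ?case
    using P_add[OF trig_approx_measurable[OF ta(1)] B[rule_format] trig_approx_measurable[OF ta(2)] C[rule_format]]
    by (simp add: distrib_left)
qed

lemma nest_chars:
  "nest (map torus_char ks) = (\<lambda>x. prod_list (map ev (tail_sums ks)) * torus_char (sum_list ks) x)"
proof (induction ks)
  case (Cons k ks)
  then show ?case
    by (simp only: list.map nest.simps P_scale P_char tail_sums.simps sum_list.Cons prod_list.Cons)
      (simp add: torus_char_add_left mult_ac)
qed simp

text \<open>A property of a single deterministic path that mentions no observed function. The choice
  in the reconstruction depends on this.\<close>

definition char_generic :: "(nat \<Rightarrow> 'n torus) \<Rightarrow> bool" where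
  "char_generic z \<longleftrightarrow> (\<forall>ks. path_average (path_prod (map torus_char ks) z)
     \<longlonglongrightarrow> (LINT x|haar. nest (map torus_char ks) x))"

text \<open>Multilinearity in each position. Positions are processed from the left; once a factor is
  reduced to a character it joins the prefix \<open>ks\<close>, which therefore varies in the
  induction.\<close>

lemma char_generic_trig:
  assumes z: "char_generic z" and "list_all trig hs"
  shows "path_average (path_prod (map torus_char ks @ hs) z)
    \<longlonglongrightarrow> (LINT x|haar. nest (map torus_char ks @ hs) x)"
  using assms(2)
proof (induction hs arbitrary: ks)
  case Nil
  then show ?case using z by (simp add: char_generic_def)
next
  case (Cons h hs)
  then have hs: "list_all trig hs" and "trig h" by simp_all
  have ta: "trig_approx g" if "g \<in> set (map torus_char ks @ hs)" for g
    using that hs by (auto simp: list_all_iff intro: trig_approx_trig trig_char)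
  from \<open>trig h\<close> show ?case
  proof induction
    case (trig_char k)
    show ?case using Cons.IH[OF hs, of "ks @ [k]"] by simp
  next
    case (trig_add p q)
    have t: "trig_approx g" if "g \<in> set (map torus_char ks @ p # q # hs)" for g
      using that ta trig_add(1,2) by (auto intro: trig_approx_trig)
    have i: "integrable haar (nest (map torus_char ks @ p # hs))" "integrable haar (nest (map torus_char ks @ q # hs))"
      using t by (auto intro!: trig_approx_integrable trig_approx_nest)
    have "path_prod (map torus_char ks @ (\<lambda>x. p x + q x) # hs) z
        = (\<lambda>n. path_prod (map torus_char ks @ p # hs) z n + path_prod (map torus_char ks @ q # hs) z n)"
      by (simp add: fun_eq_iff path_prod_add)
    moreover have "(LINT x|haar. nest (map torus_char ks @ (\<lambda>x. p x + q x) # hs) x)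
        = (LINT x|haar. nest (map torus_char ks @ p # hs) x) + (LINT x|haar. nest (map torus_char ks @ q # hs) x)"
      using nest_add[where hs = "map torus_char ks" and p = p and q = q and hs' = hs, OF t] i by simp
    ultimately show ?case
      using tendsto_add[OF trig_add.IH] by (simp add: path_average_add[abs_def])
  next
    case (trig_scale p c)
    have "path_prod (map torus_char ks @ (\<lambda>x. c * p x) # hs) z
        = (\<lambda>n. c * path_prod (map torus_char ks @ p # hs) z n)"
      by (simp add: fun_eq_iff path_prod_scale)
    then show ?case
      using tendsto_mult[OF tendsto_const trig_scale.IH, of c]
      by (simp add: path_average_scale[abs_def] nest_scale)
  qed
qed

section \<open>Replacing the observed function by an approximating polynomial\<close>

lemma trig_sel: "trig p \<Longrightarrow> trig (sel p b)"
  by (simp add: sel_def trig_const)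

lemma norm_sel_le: "(\<And>x. norm (f x) \<le> 2) \<Longrightarrow> norm (sel f b x) \<le> 2"
  by (simp add: sel_def)

lemma norm_sel_diff_le: "norm (sel f b x - sel p b x) \<le> norm (f x - p x)"
  by (simp add: sel_def)

lemma norm_path_prod_sel_le:
  assumes "\<And>x. norm (f x) \<le> 2"
  shows "norm (path_prod (map (sel f) bs) z n) \<le> 2 ^ length bs"
proof -
  have "norm (h x) \<le> 2" if "h \<in> set (map (sel f) bs)" for h x
    using that assms by (auto simp: sel_def)
  then have "norm (path_prod (map (sel f) bs) z n) \<le> 2 ^ length (map (sel f) bs)"
    by (rule norm_path_prod_le)
  then show ?thesis by simp
qed

text \<open>Telescoping, one factor at a time. The constant 2 is the common bound for an indicator
  and the approximants of \<open>indicator_approx\<close>.\<close>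

lemma path_prod_sel_diff:
  assumes f: "\<And>x. norm (f x) \<le> 2" and p: "\<And>x. norm (p x) \<le> 2"
  shows "norm (path_prod (map (sel f) bs) z n - path_prod (map (sel p) bs) z n)
    \<le> 2 ^ length bs * (\<Sum>i<length bs. norm (f (z (n + i)) - p (z (n + i))))"
proof (induction bs arbitrary: n)
  case (Cons b bs)
  let ?F = "path_prod (map (sel f) bs) z (Suc n)" and ?G = "path_prod (map (sel p) bs) z (Suc n)"
  have F: "norm ?F \<le> 2 ^ length bs"
    by (rule norm_path_prod_sel_le[OF f])
  let ?S = "\<Sum>i<length bs. norm (f (z (Suc n + i)) - p (z (Suc n + i)))"
  have sd: "norm (sel f b (z n) - sel p b (z n)) \<le> norm (f (z n) - p (z n))" by (rule norm_sel_diff_le)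
  have sp: "norm (sel p b (z n)) \<le> 2" by (rule norm_sel_le[of p, OF p])
  have "sel f b (z n) * ?F - sel p b (z n) * ?G
      = (sel f b (z n) - sel p b (z n)) * ?F + sel p b (z n) * (?F - ?G)"
    by (simp only: left_diff_distrib right_diff_distrib) simp
  then have "norm (sel f b (z n) * ?F - sel p b (z n) * ?G)
      \<le> norm (sel f b (z n) - sel p b (z n)) * norm ?F + norm (sel p b (z n)) * norm (?F - ?G)"
    unfolding norm_mult[symmetric] by (simp only: norm_triangle_ineq)
  also have "\<dots> \<le> norm (f (z n) - p (z n)) * 2 ^ length bs + 2 * (2 ^ length bs * ?S)"
    by (rule add_mono[OF mult_mono[OF sd F] mult_mono[OF sp Cons.IH]]) simp_all
  also have "\<dots> \<le> 2 * (norm (f (z n) - p (z n)) * 2 ^ length bs) + 2 * (2 ^ length bs * ?S)"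
    by (rule add_right_mono) simp
  also have "\<dots> = 2 ^ length (b # bs) * (\<Sum>i<length (b # bs). norm (f (z (n + i)) - p (z (n + i))))"
    by (simp add: sum.lessThan_Suc_shift distrib_left mult_ac del: sum.lessThan_Suc)
  finally show ?case by simp
qed simp

lemma norm_nest_le:
  assumes "\<And>h x. h \<in> set hs \<Longrightarrow> norm (h x) \<le> B"
  shows "norm (nest hs x) \<le> B ^ length hs"
  using assms
proof (induction hs arbitrary: x)
  case (Cons h hs)
  have "norm (h x) \<le> B" using Cons.prems by simp
  moreover have "norm (P (nest hs) x) \<le> B ^ length hs" using Cons by (intro norm_P_le) simp
  ultimately show ?case
    by (simp add: norm_mult) (meson mult_mono norm_ge_zero order_trans)
qed simp

lemma norm_nest_sel_le:
  assumes "\<And>x. norm (f x) \<le> 2"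
  shows "norm (nest (map (sel f) bs) x) \<le> 2 ^ length bs"
proof -
  have "norm (h x) \<le> 2" if "h \<in> set (map (sel f) bs)" for h x
    using that assms by (auto simp: sel_def)
  then have "norm (nest (map (sel f) bs) x) \<le> 2 ^ length (map (sel f) bs)"
    by (rule norm_nest_le)
  then show ?thesis by simp
qed

text \<open>The same telescoping in mean; each application of \<open>P\<close> is absorbed by its
  contraction property.\<close>

lemma nest_sel_diff:
  assumes f: "trig_approx f" "\<And>x. norm (f x) \<le> 2" and p: "trig_approx p" "\<And>x. norm (p x) \<le> 2"
  shows "(LINT x|haar. norm (nest (map (sel f) bs) x - nest (map (sel p) bs) x))
    \<le> 2 ^ length bs * (real (length bs) * (LINT x|haar. norm (f x - p x)))"
proof (induction bs)
  case (Cons b bs)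
  let ?F = "nest (map (sel f) bs)" and ?G = "nest (map (sel p) bs)" and ?d = "LINT x|haar. norm (f x - p x)"
  have d: "0 \<le> ?d" by (intro integral_nonneg_AE) auto
  have ta: "trig_approx ?F" "trig_approx ?G"
    using f p by (auto intro!: trig_approx_nest trig_approx_sel)
  note [measurable] = trig_approx_measurable[OF ta(1)] trig_approx_measurable[OF ta(2)]
  have F: "norm (?F x) \<le> 2 ^ length bs" for x
    by (rule norm_nest_sel_le[OF f(2)])
  have G: "norm (?G x) \<le> 2 ^ length bs" for x
    by (rule norm_nest_sel_le[OF p(2)])
  have FG: "norm (?F x - ?G x) \<le> 2 ^ length bs + 2 ^ length bs" for x
    using norm_triangle_ineq4[of "?F x" "?G x"] F[of x] G[of x] by linarith
  have i1: "integrable haar (\<lambda>x. norm (f x - p x))"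
    using trig_approx_integrable[OF f(1)] trig_approx_integrable[OF p(1)] by simp
  have i2: "integrable haar (\<lambda>x. norm (P (\<lambda>x. ?F x - ?G x) x))"
    by (intro integrable_norm integrable_haar_bounded[OF P_measurable norm_P_le[OF FG]]) measurable
  have "(LINT x|haar. norm (nest (map (sel f) (b # bs)) x - nest (map (sel p) (b # bs)) x))
      \<le> (LINT x|haar. 2 ^ length bs * norm (f x - p x) + 2 * norm (P (\<lambda>x. ?F x - ?G x) x))"
  proof (rule integral_mono')
    fix x
    have sd: "norm (sel f b x - sel p b x) \<le> norm (f x - p x)" by (rule norm_sel_diff_le)
    have sp: "norm (sel p b x) \<le> 2" by (rule norm_sel_le[of p, OF p(2)])
    have PF: "norm (P ?F x) \<le> 2 ^ length bs" by (rule norm_P_le[OF F])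
    have "nest (map (sel f) (b # bs)) x - nest (map (sel p) (b # bs)) x
        = (sel f b x - sel p b x) * P ?F x + sel p b x * (P ?F x - P ?G x)"
      by (simp only: left_diff_distrib right_diff_distrib list.map nest.simps) simp
    then have "norm (nest (map (sel f) (b # bs)) x - nest (map (sel p) (b # bs)) x)
        \<le> norm (sel f b x - sel p b x) * norm (P ?F x) + norm (sel p b x) * norm (P ?F x - P ?G x)"
      unfolding norm_mult[symmetric] by (simp only: norm_triangle_ineq)
    also have "\<dots> \<le> norm (f x - p x) * 2 ^ length bs + 2 * norm (P ?F x - P ?G x)"
      by (rule add_mono[OF mult_mono[OF sd PF] mult_right_mono[OF sp]]) simp_all
    also have "P ?F x - P ?G x = P (\<lambda>x. ?F x - ?G x) x"
      by (subst P_diff[OF _ F _ G]) auto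
    finally show "norm (nest (map (sel f) (b # bs)) x - nest (map (sel p) (b # bs)) x)
        \<le> 2 ^ length bs * norm (f x - p x) + 2 * norm (P (\<lambda>x. ?F x - ?G x) x)"
      by (simp add: mult.commute)
  qed (use i1 i2 in simp_all)
  also have "\<dots> = 2 ^ length bs * ?d + 2 * (LINT x|haar. norm (P (\<lambda>x. ?F x - ?G x) x))"
    using i1 i2 by simp
  also have "(LINT x|haar. norm (P (\<lambda>x. ?F x - ?G x) x)) \<le> (LINT x|haar. norm (?F x - ?G x))"
    by (rule integral_norm_P_le[OF _ FG]) measurable
  also have "\<dots> \<le> 2 ^ length bs * (real (length bs) * ?d)" by (rule Cons.IH)
  also have "2 ^ length bs * ?d \<le> 2 * (2 ^ length bs * ?d)" using d by simp
  finally show ?case by (simp add: algebra_simps)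
qed simp


lemma Re_integral_P_pow_le:
  assumes "trig g"
  shows "Re (LINT x|haar. (P ^^ i) g x) \<le> (LINT x|haar. norm (g x))"
proof -
  obtain B where B: "\<And>x. norm (g x) \<le> B"
    using continuous_torus_bounded[OF trig_continuous[OF assms]] by blast
  have "Re (LINT x|haar. (P ^^ i) g x) \<le> norm (LINT x|haar. (P ^^ i) g x)" by (rule complex_Re_le_cmod)
  also have "\<dots> \<le> (LINT x|haar. norm ((P ^^ i) g x))" by (rule integral_norm_bound)
  also have "\<dots> \<le> (LINT x|haar. norm (g x))"
    by (rule integral_norm_P_pow_le[OF trig_measurable[OF assms] B])
  finally show ?thesis .
qed

text \<open>Convergence is known for the approximating polynomial. Along the path, the cost of the
  replacement is at most a multiple of the averages of the trigonometric majorant \<open>g\<close>,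
  and these converge to limits that are small because \<open>g\<close> has small integral.\<close>

lemma char_generic_indicator:
  fixes \<Omega> :: "'n torus set"
  assumes z: "char_generic z" and \<Omega>: "open \<Omega>" "emeasure torus_lebesgue (frontier \<Omega>) = 0"
  defines "f \<equiv> torus_indicator \<Omega>"
  shows "path_average (path_prod (map (sel f) bs) z) \<longlonglongrightarrow> (LINT x|haar. nest (map (sel f) bs) x)"
proof (rule tendsto_if_approx)
  fix e :: real assume e: "0 < e"
  define m where "m = length bs"
  \<comment> \<open>Chosen so that the telescoping constant \<open>2 ^ m * m\<close> times
    \<open>d\<close> is at most \<open>e\<close>; adding 1 avoids division by 0 for the empty
    word.\<close>
  define d where "d = e / (2 ^ m * (real m + 1))"
  have d: "0 < d" using e by (simp add: d_def)
  have md: "2 ^ m * (real m * d) \<le> e"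
  proof -
    have "2 ^ m * (real m * d) \<le> 2 ^ m * ((real m + 1) * d)"
      using d by (intro mult_left_mono mult_right_mono) simp_all
    also have "\<dots> = e" by (simp add: d_def)
    finally show ?thesis .
  qed
  obtain p and g :: "'n torus \<Rightarrow> real" where pg: "trig p" "\<And>x. norm (p x) \<le> 2"
    "trig (\<lambda>x. complex_of_real (g x))" "\<And>x. norm (torus_indicator \<Omega> x - p x) \<le> g x" "(LINT x|haar. g x) < d"
    by (rule indicator_approx[OF \<Omega> d], rule that)
  note pg = pg[folded f_def]
  have f: "trig_approx f" "\<And>x. norm (f x) \<le> 2"
    using trig_approx_torus_indicator[OF \<Omega>] order_trans[OF norm_torus_indicator, of 2] by (auto simp: f_def)
  have gn: "0 \<le> g x" for x using pg(4)[of x] norm_ge_zero order_trans by blast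
  have fpd: "(LINT x|haar. norm (f x - p x)) \<le> d"
  proof -
    have "(LINT x|haar. norm (f x - p x)) \<le> (LINT x|haar. g x)"
      using integrable_Re[OF integrable_trig[OF pg(3)]] gn by (intro integral_mono' pg(4)) simp_all
    then show ?thesis using pg(5) by simp
  qed
  have i: "integrable haar (nest (map (sel f) bs))" "integrable haar (nest (map (sel p) bs))"
    by (rule trig_approx_integrable, rule trig_approx_nest,
        use trig_approx_sel[OF f(1)] trig_approx_sel[OF trig_approx_trig[OF pg(1)]] in auto)+
  have "(LINT x|haar. nest (map (sel p) bs) x) - (LINT x|haar. nest (map (sel f) bs) x)
      = - (LINT x|haar. nest (map (sel f) bs) x - nest (map (sel p) bs) x)"
    using i by simp
  also have "norm \<dots> \<le> (LINT x|haar. norm (nest (map (sel f) bs) x - nest (map (sel p) bs) x))"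
    unfolding norm_minus_cancel by (rule integral_norm_bound)
  also have "\<dots> \<le> 2 ^ m * (real m * (LINT x|haar. norm (f x - p x)))"
    unfolding m_def by (rule nest_sel_diff[OF f trig_approx_trig[OF pg(1)] pg(2)])
  also have "\<dots> \<le> 2 ^ m * (real m * d)"
    using fpd by (intro mult_left_mono) simp_all
  finally have 1: "norm ((LINT x|haar. nest (map (sel p) bs) x) - (LINT x|haar. nest (map (sel f) bs) x)) \<le> e"
    using md by linarith
  have 2: "path_average (path_prod (map (sel p) bs) z) \<longlonglongrightarrow> (LINT x|haar. nest (map (sel p) bs) x)"
    using char_generic_trig[OF z, of "map (sel p) bs" "[]"] trig_sel[OF pg(1)] by (simp add: list_all_iff)
  define g' where "g' x = complex_of_real (g x)" for x
  have g': "trig g'" using pg(3) by (simp add: g'_def[abs_def])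
  \<comment> \<open>The factor at position \<open>i\<close> is read at time \<open>n + i\<close>.
    Averages of \<open>g\<close> with this delay are again correlations of trigonometric
    polynomials, obtained by padding with \<open>i\<close> constant factors.\<close>
  define G where "G i N = Re (path_average (\<lambda>n. g' (z (n + i))) N)" for i N
  have G_ev: "eventually (\<lambda>N. G i N < d) sequentially" for i
  proof -
    have "path_average (path_prod (replicate i (\<lambda>_. 1) @ [g']) z)
        \<longlonglongrightarrow> (LINT x|haar. nest (replicate i (\<lambda>_. 1) @ [g']) x)"
    proof -
      have "list_all trig (replicate i (\<lambda>_. 1) @ [g'])" using g' by (auto simp: list_all_iff trig_const)
      from char_generic_trig[OF z this, of "[]"] show ?thesis by simp
    qed
    moreover have "path_prod (replicate i (\<lambda>_. 1) @ [g']) z = (\<lambda>n. g' (z (n + i)))"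
      by (simp add: fun_eq_iff path_prod_replicate)
    moreover have "nest (replicate i (\<lambda>_. 1) @ [g']) = (P ^^ i) g'"
      by (simp add: nest_replicate P_const)
    ultimately have "path_average (\<lambda>n. g' (z (n + i))) \<longlonglongrightarrow> (LINT x|haar. (P ^^ i) g' x)"
      by simp
    then have "(\<lambda>N. G i N) \<longlonglongrightarrow> Re (LINT x|haar. (P ^^ i) g' x)"
      unfolding G_def by (rule tendsto_Re)
    moreover have "Re (LINT x|haar. (P ^^ i) g' x) < d"
      using Re_integral_P_pow_le[OF g', of i] pg(5) gn by (simp add: g'_def)
    ultimately show ?thesis by (rule order_tendstoD(2))
  qed
  have bound: "norm (path_average (path_prod (map (sel f) bs) z) N - path_average (path_prod (map (sel p) bs) z) N)
      \<le> 2 ^ m * (\<Sum>i<m. G i N)" for N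
  proof -
    define w where "w n = 2 ^ m * (\<Sum>i<m. g (z (n + i)))" for n
    have le: "norm (path_prod (map (sel f) bs) z n - path_prod (map (sel p) bs) z n) \<le> w n" for n
    proof -
      have "norm (path_prod (map (sel f) bs) z n - path_prod (map (sel p) bs) z n)
          \<le> 2 ^ m * (\<Sum>i<m. norm (f (z (n + i)) - p (z (n + i))))"
        unfolding m_def by (rule path_prod_sel_diff[OF f(2) pg(2)])
      also have "\<dots> \<le> w n" unfolding w_def by (intro mult_left_mono sum_mono pg(4)) simp
      finally show ?thesis .
    qed
    have w: "complex_of_real (w n) = complex_of_real (2 ^ m) * (\<Sum>i<m. g' (z (n + i)))" for n
      unfolding w_def g'_def by simp
    have "Re (path_average (\<lambda>n. complex_of_real (w n)) N) = 2 ^ m * (\<Sum>i<m. G i N)"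
    proof -
      have "path_average (\<lambda>n. complex_of_real (w n)) N
          = complex_of_real (2 ^ m) * (\<Sum>i<m. path_average (\<lambda>n. g' (z (n + i))) N)"
        unfolding w by (subst path_average_scale) (simp add: path_average_sum)
      then show ?thesis unfolding G_def by (simp only: times_complex.sel Re_complex_of_real Im_complex_of_real Re_sum)
    qed
    then show ?thesis using norm_path_average_diff_le[where N = N and g = w, of "path_prod (map (sel f) bs) z" "path_prod (map (sel p) bs) z", OF le] by simp
  qed
  have "eventually (\<lambda>N. \<forall>i<m. G i N < d) sequentially"
  proof -
    have "eventually (\<lambda>N. \<forall>i\<in>{..<m}. G i N < d) sequentially"
      using G_ev by (intro eventually_ball_finite) auto
    then show ?thesis by (rule eventually_mono) auto
  qed
  then have 3: "eventually (\<lambda>N. norm (path_average (path_prod (map (sel f) bs) z) N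
      - path_average (path_prod (map (sel p) bs) z) N) \<le> e) sequentially"
  proof eventually_elim
    case (elim N)
    have "(\<Sum>i<m. G i N) \<le> (\<Sum>i<m. d)" using elim by (intro sum_mono) (simp add: less_imp_le)
    then have "2 ^ m * (\<Sum>i<m. G i N) \<le> 2 ^ m * (real m * d)" by simp
    then show ?case using bound[of N] md by linarith
  qed
  show "\<exists>B b. B \<longlonglongrightarrow> b \<and> norm (b - (LINT x|haar. nest (map (sel f) bs) x)) \<le> e \<and>
      eventually (\<lambda>N. norm (path_average (path_prod (map (sel f) bs) z) N - B N) \<le> e) sequentially"
    by (rule exI, rule exI, rule conjI[OF 2 conjI[OF 1 3]])
qed

end

section \<open>Reconstruction from a generic path\<close>

context torus_walk begin

text \<open>Purely pathwise. Equal observations give equal averages, hence equal correlations, hence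
  equal products of coefficients. These fix the coefficients up to a common shift, and the
  coefficients fix the function almost everywhere.\<close>

lemma generic_paths_determine_set:
  assumes z: "char_generic z" "char_generic z'"
    and \<Omega>: "open \<Omega>" "emeasure torus_lebesgue (frontier \<Omega>) = 0"
    and \<Omega>': "open \<Omega>'" "emeasure torus_lebesgue (frontier \<Omega>') = 0"
    and same: "\<And>n. z n \<in> \<Omega> \<longleftrightarrow> z' n \<in> \<Omega>'"
    and ev: "inj ev" "\<And>k. ev k \<noteq> w" "\<And>e. 0 < e \<Longrightarrow> finite {k. e \<le> norm (ev k - w)}"
  shows "\<exists>\<theta>. AE x in torus_lebesgue. (indicator \<Omega>' x :: real) = indicator \<Omega> (x + \<theta>)"
proof -
  define f where "f = torus_indicator \<Omega>"
  define g where "g = torus_indicator \<Omega>'"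
  have f: "trig_approx f" unfolding f_def by (rule trig_approx_torus_indicator[OF \<Omega>])
  have g: "trig_approx g" unfolding g_def by (rule trig_approx_torus_indicator[OF \<Omega>'])
  have idem: "f x * f x = f x" "g x * g x = g x" for x
    by (simp_all add: f_def g_def torus_indicator_def indicator_def)
  have "f (z n) = g (z' n)" for n
    using same[of n] by (simp add: f_def g_def torus_indicator_def indicator_def)
  then have "path_prod (map (sel f) bs) z n = path_prod (map (sel g) bs) z' n" for bs n
    by (induction bs arbitrary: n) (simp_all add: sel_def)
  then have "path_prod (map (sel f) bs) z = path_prod (map (sel g) bs) z'" for bs
    by (simp add: fun_eq_iff)
  moreover have "path_average (path_prod (map (sel f) bs) z) \<longlonglongrightarrow> (LINT x|haar. nest (map (sel f) bs) x)" for bs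
    unfolding f_def by (rule char_generic_indicator[OF z(1) \<Omega>])
  moreover have "path_average (path_prod (map (sel g) bs) z') \<longlonglongrightarrow> (LINT x|haar. nest (map (sel g) bs) x)" for bs
    unfolding g_def by (rule char_generic_indicator[OF z(2) \<Omega>'])
  ultimately have eq: "(LINT x|haar. nest (map (sel f) bs) x) = (LINT x|haar. nest (map (sel g) bs) x)" for bs
    by (metis LIMSEQ_unique)
  have prods: "prod_list (map (fcoef f) ks) = prod_list (map (fcoef g) ks)" if "sum_list ks = 0" for ks
    using nested_correlations_determine_products[where bs = "[]" and ks = ks, OF f idem(1) g idem(2) eq ev] that
    by simp
  have "\<exists>\<theta>. \<forall>k. fcoef g k = fcoef f k * torus_char k \<theta>"
    by (rule translation_exists[OF prods]) (simp_all add: f_def g_def fcoef_torus_indicator_uminus)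
  then obtain \<theta> where \<theta>: "\<And>k. fcoef g k = fcoef f k * torus_char k \<theta>" by (elim exE) (rule, blast)
  have ft: "trig_approx (\<lambda>x. f (x + \<theta>))" by (rule trig_approx_translate[OF f])
  have "fcoef (\<lambda>x. g x - f (x + \<theta>)) k = 0" for k
    using \<theta>[of k]
    by (simp add: fcoef_diff trig_approx_integrable[OF g] trig_approx_integrable[OF ft]
        fcoef_translate trig_approx_measurable[OF f])
  then have "AE x in haar. g x - f (x + \<theta>) = 0"
    by (rule trig_approx_fcoef_zero[OF trig_approx_diff[OF g ft]])
  then have "AE x in haar. (indicator \<Omega>' x :: real) = indicator \<Omega> (x + \<theta>)"
    by eventually_elim (simp add: f_def g_def torus_indicator_def)
  then show ?thesis unfolding AE_haar_iff by blast
qed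

end

section \<open>Increments of the process\<close>

text \<open>Consequently \<open>\<beta> t\<close> is the exact mass of \<open>D t\<close> at 0, the
  density contributing nothing.\<close>

lemma torus_lebesgue_singleton: "emeasure torus_lebesgue {x :: 'n::finite torus} = 0"
proof -
  have cl: "{y :: 'n torus} \<in> sets borel" for y by (simp add: borel_closed)
  have z: "x = 0" if "x \<in> torus_box" "to_torus x = 0" for x :: "real^'n"
  proof -
    have "torus_rel x 0" using that(2) by (simp add: zero_torus_def to_torus_eq_iff)
    have "x $ i = 0" for i
    proof -
      obtain k :: int where k: "x $ i = 2 * pi * of_int k"
        using \<open>torus_rel x 0\<close> unfolding torus_rel_def by auto
      moreover have "0 \<le> x $ i" "x $ i < 2 * pi" using that(1) by (auto simp: torus_box_def)
      ultimately have "0 \<le> k" "k < 1"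
        using pi_gt_zero by (simp_all add: zero_le_mult_iff)
      then show ?thesis using k by simp
    qed
    then show ?thesis by (simp add: vec_eq_iff)
  qed
  have "emeasure torus_lebesgue {0 :: 'n torus}
      \<le> (\<integral>\<^sup>+v. indicator {0} v \<partial>(lborel :: (real^'n) measure))"
    unfolding emeasure_torus_lebesgue[OF cl]
    by (intro nn_integral_mono) (auto simp: indicator_def dest: z)
  then have "emeasure torus_lebesgue {0 :: 'n torus} = 0" by simp
  moreover have "(+) x -` {x} = {0}" by auto
  ultimately show ?thesis
    using emeasure_torus_lebesgue_translate[OF cl, of x x] by simp
qed

text \<open>Bessel's inequality as a quantitative Riemann-Lebesgue lemma: \<open>n\<close>
  coefficients of norm at least \<open>e\<close> force the squared mean to be at least
  \<open>n * e\<^sup>2\<close>.\<close>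

lemma finite_large_fcoef:
  fixes h :: "'n::finite torus \<Rightarrow> complex"
  assumes "h \<in> borel_measurable borel" "integrable haar (\<lambda>x. (norm (h x))\<^sup>2)" "0 < e"
  shows "finite {k. e \<le> norm (fcoef h k)}"
proof (rule ccontr)
  assume inf: "infinite {k. e \<le> norm (fcoef h k)}"
  obtain n :: nat where n: "(LINT x|haar. (norm (h x))\<^sup>2) < real n * e\<^sup>2"
    using ex_less_of_nat_mult[of "e\<^sup>2" "LINT x|haar. (norm (h x))\<^sup>2"] assms(3) by auto
  obtain K where K: "finite K" "card K = n" "K \<subseteq> {k. e \<le> norm (fcoef h k)}"
    using infinite_arbitrarily_large[OF inf, of n] by auto
  have "real n * e\<^sup>2 = (\<Sum>k\<in>K. e\<^sup>2)" using K by simp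
  also have "\<dots> \<le> (\<Sum>k\<in>K. (norm (fcoef h k))\<^sup>2)"
    using K(3) assms(3) by (intro sum_mono power_mono) auto
  also have "\<dots> \<le> (LINT x|haar. (norm (h x))\<^sup>2)" by (rule bessel_inequality[OF assms(1,2) K(1)])
  finally show False using n by simp
qed

section \<open>The atom of the increment laws and their Fourier coefficients\<close>

context torus_process begin

lemma emeasure_D_singleton:
  assumes "0 \<le> t"
  shows "emeasure (D t) {y} = (if y = 0 then ennreal (\<beta> t) else 0)"
proof -
  have [measurable]: "{y} \<in> sets borel" by (simp add: borel_closed)
  have [measurable]: "\<gamma> t \<in> borel_measurable borel"
    using \<gamma>_density[OF assms] by (simp add: torus_prob_density_def)
  have "emeasure (density torus_lebesgue (\<lambda>x. ennreal (\<gamma> t x))) {y} = 0"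
    by (subst emeasure_density) (auto simp: nn_integral_0_iff_AE torus_lebesgue_singleton)
  then show ?thesis using D_mixture[OF assms, of "{y}"] by auto
qed

text \<open>Compare the masses at 0 in the convolution identity. For fixed \<open>x\<close> the
  second summand must be \<open>- x\<close>, which has positive mass only if \<open>x = 0\<close>,
  so only the two atoms meet.\<close>

lemma \<beta>_add:
  assumes "0 \<le> t" "0 \<le> s"
  shows "\<beta> (t + s) = \<beta> t * \<beta> s"
proof -
  interpret t: prob_space "D t" by (rule D_prob_space[OF assms(1)])
  interpret s: prob_space "D s" by (rule D_prob_space[OF assms(2)])
  interpret ts: pair_sigma_finite "D t" "D s" ..
  note [measurable_cong] = sets_D[OF assms(1)] sets_D[OF assms(2)]
  have sp: "space (D t) = UNIV" "space (D s) = UNIV"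
    using sets_eq_imp_space_eq[OF sets_D[OF assms(1)]] sets_eq_imp_space_eq[OF sets_D[OF assms(2)]] by simp_all
  have m: "(\<lambda>(x, y). x + y) \<in> borel_measurable (D t \<Otimes>\<^sub>M D s)" by measurable
  have z: "{0 :: 'n torus} \<in> sets borel" by (simp add: borel_closed)
  have "ennreal (\<beta> (t + s)) = emeasure (torus_convolution (D t) (D s)) {0}"
    using emeasure_D_singleton[of "t + s" 0] D_convolution[OF assms(2,1)] assms by (simp add: D_convolution)
  also have "\<dots> = emeasure (D t \<Otimes>\<^sub>M D s) ((\<lambda>(x, y). x + y) -` {0} \<inter> space (D t \<Otimes>\<^sub>M D s))"
    unfolding torus_convolution_def by (rule emeasure_distr[OF m z])
  also have "\<dots> = (\<integral>\<^sup>+x. emeasure (D s) (Pair x -` ((\<lambda>(x, y). x + y) -` {0} \<inter> space (D t \<Otimes>\<^sub>M D s))) \<partial>D t)"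
    by (rule s.emeasure_pair_measure_alt[OF measurable_sets[OF m z]])
  also have "\<dots> = (\<integral>\<^sup>+x. ennreal (\<beta> s) * indicator {0} x \<partial>D t)"
  proof (rule nn_integral_cong)
    fix x
    have "Pair x -` ((\<lambda>(x, y). x + y) -` {0} \<inter> space (D t \<Otimes>\<^sub>M D s)) = {- x}"
      by (auto simp: space_pair_measure sp eq_neg_iff_add_eq_0 add.commute)
    then show "emeasure (D s) (Pair x -` ((\<lambda>(x, y). x + y) -` {0} \<inter> space (D t \<Otimes>\<^sub>M D s)))
        = ennreal (\<beta> s) * indicator {0} x"
      using emeasure_D_singleton[OF assms(2), of "- x"] by (simp add: indicator_def)
  qed
  also have "\<dots> = ennreal (\<beta> s) * emeasure (D t) {0}"
    using z sets_D[OF assms(1)] by (intro nn_integral_cmult_indicator) simp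
  also have "\<dots> = ennreal (\<beta> t * \<beta> s)"
    using emeasure_D_singleton[OF assms(1), of 0] \<beta>_range[OF assms(1)] \<beta>_range[OF assms(2)]
    by (simp add: ennreal_mult mult.commute)
  finally show ?thesis
    using \<beta>_range[OF assms(1)] \<beta>_range[OF assms(2)] \<beta>_range[of "t + s"] assms by simp
qed

text \<open>If \<open>\<beta> t = 1\<close>, multiplicativity gives 1 at all positive multiples of
  \<open>t\<close>. Any \<open>s\<close> lies below such a multiple, and \<open>\<beta> s\<close> is
  a factor of the value there, which forces \<open>\<beta> s = 1\<close> and makes the process
  constant.\<close>

lemma \<beta>_less_1:
  assumes "0 < t"
  shows "\<beta> t < 1"
proof (rule ccontr)
  assume "\<not> \<beta> t < 1"
  then have 1: "\<beta> t = 1" using \<beta>_range[of t] assms by simp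
  obtain s where s: "0 \<le> s" "\<beta> s \<noteq> 1" using \<beta>_not_identically_1 by auto
  then have s1: "0 \<le> \<beta> s" "\<beta> s < 1" using \<beta>_range[of s] by auto
  have nt: "\<beta> (real (Suc n) * t) = 1" for n
  proof (induction n)
    case (Suc n)
    have "\<beta> (real (Suc n) * t + t) = 1"
      using \<beta>_add[of "real (Suc n) * t" t] Suc 1 assms by simp
    then show ?case by (simp add: algebra_simps)
  qed (simp add: 1)
  obtain n where n: "s < real n * t" using ex_less_of_nat_mult[OF assms] by blast
  have "real n * t \<le> real (Suc n) * t" using assms by simp
  then have le: "0 \<le> real (Suc n) * t - s" using n by linarith
  have "1 = \<beta> (s + (real (Suc n) * t - s))" using nt[of n] by simp
  also have "\<dots> = \<beta> s * \<beta> (real (Suc n) * t - s)" by (rule \<beta>_add[OF s(1) le])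
  also have "\<dots> \<le> \<beta> s * 1" using \<beta>_range[OF le] s1 by (intro mult_left_mono) auto
  finally show False using s1 by simp
qed

text \<open>Off the null set \<open>{0}\<close> the law \<open>D t\<close> has density \<open>(1 - \<beta> t) * \<gamma> t\<close>.\<close>

lemma integral_D_char:
  assumes t: "0 \<le> t"
  shows "(LINT y|D t. torus_char k y)
    = of_real (\<beta> t) + of_real (1 - \<beta> t) * torus_fourier (\<lambda>x. complex_of_real (\<gamma> t x)) (- k)"
proof -
  interpret D: prob_space "D t" by (rule D_prob_space[OF t])
  note [measurable_cong, simp] = sets_D[OF t]
  have sp [simp]: "space (D t) = UNIV" using sets_eq_imp_space_eq[OF sets_D[OF t]] by simp
  have [measurable]: "{0 :: 'n torus} \<in> sets borel" by (simp add: borel_closed)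
  have [measurable]: "\<gamma> t \<in> borel_measurable borel" and \<gamma>0: "\<And>x. 0 \<le> \<gamma> t x"
    using \<gamma>_density[OF t] by (simp_all add: torus_prob_density_def)
  have \<beta>: "0 \<le> \<beta> t" "\<beta> t \<le> 1" using \<beta>_range[OF t] by auto
  have null: "AE x in torus_lebesgue. x \<noteq> 0"
    by (rule AE_I'[of "{0}"]) (auto simp: null_sets_def torus_lebesgue_singleton)
  have dens: "density (D t) (\<lambda>x. ennreal (indicator (- {0}) x))
      = density torus_lebesgue (\<lambda>x. ennreal ((1 - \<beta> t) * \<gamma> t x))"
  proof (rule measure_eqI)
    fix A assume "A \<in> sets (density (D t) (\<lambda>x. ennreal (indicator (- {0}) x)))"
    then have [measurable]: "A \<in> sets borel" by simp
    have "emeasure (density (D t) (\<lambda>x. ennreal (indicator (- {0}) x))) A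
        = (\<integral>\<^sup>+x. indicator (A - {0}) x \<partial>D t)"
      by (subst emeasure_density, measurable) (rule nn_integral_cong, auto simp: indicator_def)
    also have "\<dots> = emeasure (D t) (A - {0})" by (rule nn_integral_indicator) simp
    also have "\<dots> = ennreal (1 - \<beta> t) * emeasure (density torus_lebesgue (\<lambda>x. ennreal (\<gamma> t x))) (A - {0})"
      by (subst D_mixture[OF t]) simp_all
    also have "emeasure (density torus_lebesgue (\<lambda>x. ennreal (\<gamma> t x))) (A - {0})
        = (\<integral>\<^sup>+x. ennreal (\<gamma> t x) * indicator A x \<partial>torus_lebesgue)"
      by (subst emeasure_density) (auto intro!: nn_integral_cong_AE simp: indicator_def eventually_mono[OF null])
    also have "ennreal (1 - \<beta> t) * \<dots> = (\<integral>\<^sup>+x. ennreal (1 - \<beta> t) * (ennreal (\<gamma> t x) * indicator A x) \<partial>torus_lebesgue)"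
      by (rule nn_integral_cmult[symmetric]) measurable
    also have "\<dots> = emeasure (density torus_lebesgue (\<lambda>x. ennreal ((1 - \<beta> t) * \<gamma> t x))) A"
      using \<beta> \<gamma>0 by (subst emeasure_density) (auto simp: ennreal_mult mult.assoc)
    finally show "emeasure (density (D t) (\<lambda>x. ennreal (indicator (- {0}) x))) A
        = emeasure (density torus_lebesgue (\<lambda>x. ennreal ((1 - \<beta> t) * \<gamma> t x))) A" .
  qed simp
  have int: "integrable (D t) (\<lambda>y. indicator A y *\<^sub>R torus_char k y)" if "A \<in> sets borel" for A
    using that by (intro D.integrable_const_bound[of _ 1] AE_I2) (auto simp: indicator_def)
  have "(LINT y|D t. torus_char k y)
      = (LINT y|D t. indicator {0} y *\<^sub>R torus_char k y + indicator (- {0}) y *\<^sub>R torus_char k y)"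
    by (intro Bochner_Integration.integral_cong) (auto simp: indicator_def)
  also have "\<dots> = (LINT y|D t. indicator {0} y *\<^sub>R torus_char k y) + (LINT y|D t. indicator (- {0}) y *\<^sub>R torus_char k y)"
    by (intro Bochner_Integration.integral_add int) simp_all
  also have "(LINT y|D t. indicator {0} y *\<^sub>R torus_char k y) = (LINT y|D t. indicator {0} y *\<^sub>R (1 :: complex))"
    by (intro Bochner_Integration.integral_cong) (auto simp: indicator_def)
  also have "\<dots> = of_real (\<beta> t)"
  proof -
    have "measure (D t) {0} = \<beta> t" using emeasure_D_singleton[OF t, of 0] \<beta> by (simp add: measure_def)
    then show ?thesis by (simp add: scaleR_conv_of_real)
  qed
  also have "(LINT y|D t. indicator (- {0}) y *\<^sub>R torus_char k y)
      = (LINT y|density (D t) (\<lambda>x. ennreal (indicator (- {0}) x)). torus_char k y)"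
    by (subst integral_density) auto
  also have "\<dots> = (LINT y|torus_lebesgue. ((1 - \<beta> t) * \<gamma> t y) *\<^sub>R torus_char k y)"
    unfolding dens using \<beta> \<gamma>0 by (subst integral_density) auto
  also have "\<dots> = of_real (1 - \<beta> t) * torus_fourier (\<lambda>x. complex_of_real (\<gamma> t x)) (- k)"
    unfolding torus_fourier_def by (simp add: scaleR_conv_of_real mult.assoc)
  finally show ?thesis .
qed

lemma finite_large_torus_fourier:
  assumes t: "0 < t" and e: "0 < e"
  shows "finite {k. e \<le> norm (torus_fourier (\<lambda>x. complex_of_real (\<gamma> t x)) k)}"
proof -
  have [measurable]: "\<gamma> t \<in> borel_measurable borel"
    using \<gamma>_density[of t] t by (simp add: torus_prob_density_def)
  have V: "0 < torus_volume TYPE('n)" by (rule torus_volume_pos)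
  have "integrable haar (\<lambda>x. (\<gamma> t x)\<^sup>2)"
    using \<gamma>_square_integrable[OF t] V unfolding haar_def by (subst integrable_density) auto
  then have sq: "integrable haar (\<lambda>x. (norm (complex_of_real (\<gamma> t x)))\<^sup>2)" by simp
  have "fcoef (\<lambda>x. complex_of_real (\<gamma> t x)) k
      = torus_fourier (\<lambda>x. complex_of_real (\<gamma> t x)) k / of_real (torus_volume TYPE('n))" for k
    unfolding fcoef_def torus_fourier_def by (rule integral_haar) measurable
  then have "norm (fcoef (\<lambda>x. complex_of_real (\<gamma> t x)) k)
      = norm (torus_fourier (\<lambda>x. complex_of_real (\<gamma> t x)) k) / torus_volume TYPE('n)" for k
    using V by (simp add: norm_divide)
  then have "{k. e \<le> norm (torus_fourier (\<lambda>x. complex_of_real (\<gamma> t x)) k)}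
      = {k. e / torus_volume TYPE('n) \<le> norm (fcoef (\<lambda>x. complex_of_real (\<gamma> t x)) k)}"
    using V by (simp add: divide_le_cancel)
  also have "finite \<dots>"
    using e V by (intro finite_large_fcoef sq) auto
  finally show ?thesis .
qed

lemma expectation_increments:
  assumes t: "0 < t"
  shows "expectation (\<lambda>\<omega>. \<Prod>j<N. torus_char (c j) (X (real (Suc j) * t) \<omega> - X (real j * t) \<omega>))
    = (\<Prod>j<N. LINT y|D t. torus_char (c j) y)"
proof -
  define Y where "Y j \<omega> = X (real (Suc j) * t) \<omega> - X (real j * t) \<omega>" for j \<omega>
  have ind: "indep_vars (\<lambda>_. borel) Y {..<N}"
    unfolding Y_def using t by (intro independent_increments[of "\<lambda>j. real j * t"]) simp_all
  have [measurable]: "Y j \<in> borel_measurable M" if "j < N" for j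
    using ind that by (simp add: indep_vars_def)
  have ind': "indep_vars (\<lambda>_. borel) (\<lambda>j \<omega>. torus_char (c j) (Y j \<omega>)) {..<N}"
    by (rule indep_vars_compose2[OF ind]) simp
  have "expectation (\<lambda>\<omega>. \<Prod>j<N. torus_char (c j) (Y j \<omega>)) = (\<Prod>j<N. expectation (\<lambda>\<omega>. torus_char (c j) (Y j \<omega>)))"
  proof (rule indep_vars_lebesgue_integral[OF _ ind'])
    fix j assume "j \<in> {..<N}"
    then have [measurable]: "Y j \<in> borel_measurable M" using ind by (simp add: indep_vars_def)
    show "integrable M (\<lambda>\<omega>. torus_char (c j) (Y j \<omega>))"
      by (rule integrable_const_bound[where B = 1]) (auto intro!: AE_I2)
  qed simp
  also have "\<dots> = (\<Prod>j<N. LINT y|D t. torus_char (c j) y)"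
  proof (intro prod.cong refl)
    fix j assume "j \<in> {..<N}"
    then have [measurable]: "Y j \<in> borel_measurable M" using ind by (simp add: indep_vars_def)
    have "distr M borel (Y j) = D (real (Suc j) * t - real j * t)"
      unfolding Y_def using t by (intro stationary_increments) (simp_all add: mult_right_mono)
    also have "real (Suc j) * t - real j * t = t" by (simp add: algebra_simps)
    finally have "D t = distr M borel (Y j)" by simp
    then show "expectation (\<lambda>\<omega>. torus_char (c j) (Y j \<omega>)) = (LINT y|D t. torus_char (c j) y)"
      by (simp add: integral_distr)
  qed
  finally show ?thesis unfolding Y_def .
qed

end

theorem theorem5:
  fixes M :: "'w measure"
    and X :: "real \<Rightarrow> 'w \<Rightarrow> 'n::finite torus"
    and D :: "real \<Rightarrow> 'n torus measure"
    and \<beta> :: "real \<Rightarrow> real"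
    and \<gamma> :: "real \<Rightarrow> 'n torus \<Rightarrow> real"
  assumes "torus_process M X D \<beta> \<gamma>"
    and "\<exists>t0>0. inj (torus_fourier (\<lambda>x. complex_of_real (\<gamma> t0 x))) \<and>
           (\<forall>k. torus_fourier (\<lambda>x. complex_of_real (\<gamma> t0 x)) k \<noteq> 0)"
  shows "reconstructible M X (open_null_boundary_indicators :: ('n torus \<Rightarrow> real) set)"
proof -
  interpret torus_process M X D \<beta> \<gamma> by fact
  obtain t where t: "0 < t" and inj: "inj (torus_fourier (\<lambda>x. complex_of_real (\<gamma> t x)))"
    and nz: "\<And>k. torus_fourier (\<lambda>x. complex_of_real (\<gamma> t x)) k \<noteq> 0"
    using assms(2) by auto
  define F where "F = torus_fourier (\<lambda>x. complex_of_real (\<gamma> t x))"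
  have t0: "0 \<le> t" using t by simp
  have \<beta>: "0 \<le> \<beta> t" "\<beta> t < 1" using \<beta>_range[OF t0] \<beta>_less_1[OF t] by auto
  interpret walk: torus_walk "D t"
    using D_prob_space[OF t0] sets_D[OF t0] by (simp add: torus_walk_def torus_walk_axioms_def)
  have ev: "walk.ev k = of_real (\<beta> t) + of_real (1 - \<beta> t) * F (- k)" for k
    unfolding walk.ev_def F_def by (rule integral_D_char[OF t0])
  have ev_inj: "inj walk.ev"
  proof (rule injI)
    fix k l assume "walk.ev k = walk.ev l"
    then have "F (- k) = F (- l)" using \<beta> by (simp add: ev)
    then show "k = l" using inj by (simp add: F_def inj_eq)
  qed
  \<comment> \<open>The non-vanishing of the Fourier coefficients enters here: the accumulation
    point of the eigenvalues is not itself an eigenvalue.\<close>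
  have ev_neq: "walk.ev k \<noteq> of_real (\<beta> t)" for k using \<beta> nz by (simp add: ev F_def)
  have ev_fin: "finite {k. e \<le> norm (walk.ev k - of_real (\<beta> t))}" if "0 < e" for e
  proof (rule finite_subset)
    show "finite (uminus ` {k. e \<le> norm (F k)})"
      using finite_large_torus_fourier[OF t that] by (simp add: F_def)
    show "{k. e \<le> norm (walk.ev k - of_real (\<beta> t))} \<subseteq> uminus ` {k. e \<le> norm (F k)}"
    proof
      fix k assume "k \<in> {k. e \<le> norm (walk.ev k - of_real (\<beta> t))}"
      then have "e \<le> norm (of_real (1 - \<beta> t) * F (- k))" by (simp add: ev)
      also have "\<dots> = (1 - \<beta> t) * norm (F (- k))"
        using \<beta> by (simp only: norm_mult norm_of_real)
      also have "\<dots> \<le> norm (F (- k))" using \<beta> by (intro mult_left_le_one_le) auto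
      finally show "k \<in> uminus ` {k. e \<le> norm (F k)}" by (intro image_eqI[of _ _ "- k"]) auto
    qed
  qed
  interpret cw: char_walk M "\<lambda>n. X (real n * t)" walk.ev
  proof
    show "X (real n * t) \<in> borel_measurable M" for n using t by (intro X_measurable) simp
    show "expectation (\<lambda>\<omega>. \<Prod>j<N. torus_char (c j) (X (real (Suc j) * t) \<omega> - X (real j * t) \<omega>))
        = (\<Prod>j<N. walk.ev (c j))" for c N
      unfolding walk.ev_def by (rule expectation_increments[OF t])
    show "walk.ev (- k) = cnj (walk.ev k)" for k by (rule walk.ev_uminus)
    show "walk.ev 0 = 1" by (rule walk.ev_0)
    show "norm (walk.ev k) \<le> 1" for k by (rule walk.norm_ev_le)
    \<comment> \<open>\<open>ev 0 = 1\<close>, and injectivity reserves this value for frequency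
      0.\<close>
    show "walk.ev k \<noteq> 1" if "k \<noteq> 0" for k
      using ev_inj that walk.ev_0 by (metis injD)
  qed
  define E where "E \<omega> \<longleftrightarrow> walk.char_generic (\<lambda>n. X (real n * t) \<omega>)" for \<omega>
  have AE_E: "AE \<omega> in M. E \<omega>"
    using cw.W_averages_AE_all
  proof eventually_elim
    case (elim \<omega>)
    have "cw.W ks n \<omega> = path_prod (map torus_char ks) (\<lambda>n. X (real n * t) \<omega>) n" for ks n
      by (induction ks arbitrary: n) simp_all
    moreover have "cw.W_limit ks = (LINT x|haar. walk.nest (map torus_char ks) x)" for ks
      by (simp add: cw.W_limit_def walk.nest_chars integral_torus_char)
    ultimately show ?case
      using elim by (simp add: E_def walk.char_generic_def path_average_def[abs_def])
  qed
  define obs where "obs f \<omega> = (\<lambda>s\<in>{0..}. f (X s \<omega>))" for f :: "'n torus \<Rightarrow> real" and \<omega>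
  \<comment> \<open>\<open>f\<close> itself, with the actual outcome, shows that the choice is
    possible on \<open>E\<close>. The chosen \<open>h\<close> may come with another outcome, which
    is why \<open>E\<close> is demanded of that outcome as well.\<close>
  define A where "A p = (SOME h. h \<in> open_null_boundary_indicators \<and> (\<exists>\<omega>. E \<omega> \<and> p = obs h \<omega>))"
    for p :: "real \<Rightarrow> real"
  show ?thesis
    unfolding reconstructible_def
  proof (intro exI[of _ A] ballI)
    fix f :: "'n torus \<Rightarrow> real" assume f: "f \<in> open_null_boundary_indicators"
    show "AE \<omega> in M. \<exists>\<theta>. AE x in torus_lebesgue. A (\<lambda>t\<in>{0..}. f (X t \<omega>)) x = f (x + \<theta>)"
      using AE_E
    proof eventually_elim
      case (elim \<omega>)
      define h where "h = A (obs f \<omega>)"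
      have "\<exists>h. h \<in> open_null_boundary_indicators \<and> (\<exists>\<omega>'. E \<omega>' \<and> obs f \<omega> = obs h \<omega>')"
        using f elim by blast
      then have "h \<in> open_null_boundary_indicators \<and> (\<exists>\<omega>'. E \<omega>' \<and> obs f \<omega> = obs h \<omega>')"
        unfolding h_def A_def by (rule someI_ex)
      then obtain \<omega>' where h: "h \<in> open_null_boundary_indicators" and \<omega>': "E \<omega>'" "obs f \<omega> = obs h \<omega>'"
        by blast
      obtain \<Omega> where \<Omega>: "f = indicator \<Omega>" "open \<Omega>" "emeasure torus_lebesgue (frontier \<Omega>) = 0"
        using f by (auto simp: open_null_boundary_indicators_def)
      obtain \<Omega>' where \<Omega>': "h = indicator \<Omega>'" "open \<Omega>'" "emeasure torus_lebesgue (frontier \<Omega>') = 0"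
        using h by (auto simp: open_null_boundary_indicators_def)
      have "X (real n * t) \<omega> \<in> \<Omega> \<longleftrightarrow> X (real n * t) \<omega>' \<in> \<Omega>'" for n
      proof -
        have "obs f \<omega> (real n * t) = obs h \<omega>' (real n * t)" by (simp add: \<omega>'(2))
        then show ?thesis using t by (simp add: obs_def \<Omega>(1) \<Omega>'(1) indicator_def of_bool_eq_iff)
      qed
      then have "\<exists>\<theta>. AE x in torus_lebesgue. (indicator \<Omega>' x :: real) = indicator \<Omega> (x + \<theta>)"
        using elim \<omega>'(1) unfolding E_def
        by (intro walk.generic_paths_determine_set[OF _ _ \<Omega>(2,3) \<Omega>'(2,3) _ ev_inj ev_neq ev_fin])
      then show ?case unfolding h_def[symmetric, unfolded obs_def] \<Omega>(1)[symmetric] \<Omega>'(1)[symmetric] .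
    qed
  qed
qed

end
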